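(* Let $V_1,V_2$ be two commuting polynomial vector fields on $\mathbb{C}^n$ and let $\mathcal{F}$ be the foliation they generate. Let $p\in\mathbb{C}^n$ be a nonsingular point of $\mathcal{F}$ (so $V_1(p),V_2(p)$ are linearly independent), and let $\mathcal{L}$ be the (two-dimensional) leaf of $\mathcal{F}$ through $p$. Let $F,G\in\mathbb{C}[x_1,\dots,x_n]$ be polynomials whose restrictions $F|_{\mathcal{L}},G|_{\mathcal{L}}$ are not identically zero near $p$. In the ring $\mathcal{O}_p(\mathcal{L})$ of germs at $p$ of holomorphic functions on $\mathcal{L}$ (a factorial ring isomorphic to $\mathbb{C}\{x,y\}$), write $$F|_{\mathcal{L}}=h_f\, f,\qquad G|_{\mathcal{L}}=h_g\, g,$$ where $h_f$ (resp. $h_g$) is the product, with multiplicities, of those irreducible factors of $F|_{\mathcal{L}}$ (resp. $G|_{\mathcal{L}}$) that are common to $F|_{\mathcal{L}}$ and $G|_{\mathcal{L}}$ (the common factors may appear in $h_f$ and $h_g$ with different multiplicities), and $f,g$ consist of the remaining factors. Let $\mathcal{I}=\langle f,g\rangle\subset\mathcal{O}_p(\mathcal{L})$. Then $\operatorname{mult}_p\mathcal{I}=\dim_{\mathbb{C}}\mathcal{O}_p(\mathcal{L})/\mathcal{I}$ can be bounded from above by a quantity depending only on $n$ and the degrees of $V_1,V_2,F,G$.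
   Context: A leaf of $\mathcal{F}$ is a maximal connected integral surface of the distribution spanned by $V_1,V_2$. The decomposition $F|_{\mathcal{L}}=h_f f$, $G|_{\mathcal{L}}=h_g g$ is defined only on $\mathcal{L}$ near $p$ and need not extend off $\mathcal{L}$. *)

theory Defs
  imports "HOL-Analysis.Analysis"
begin

definition poly_fun :: "nat \<Rightarrow> (complex ^ 'n \<Rightarrow> complex) \<Rightarrow> bool" where
  "poly_fun d P \<longleftrightarrow> (\<exists>c :: ('n \<Rightarrow> nat) \<Rightarrow> complex.
     P = (\<lambda>x. \<Sum>\<alpha>\<in>{\<alpha> :: 'n \<Rightarrow> nat. (\<Sum>i\<in>UNIV. \<alpha> i) \<le> d}.
                 c \<alpha> * (\<Prod>i\<in>UNIV. (x $ i) ^ (\<alpha> i))))"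

definition poly_vf :: "nat \<Rightarrow> (complex ^ 'n \<Rightarrow> complex ^ 'n) \<Rightarrow> bool" where
  "poly_vf d V \<longleftrightarrow> (\<forall>i. poly_fun d (\<lambda>x. V x $ i))"

definition commuting_vf :: "(complex ^ 'n \<Rightarrow> complex ^ 'n) \<Rightarrow> (complex ^ 'n \<Rightarrow> complex ^ 'n) \<Rightarrow> bool" where
  "commuting_vf V1 V2 \<longleftrightarrow>
     (\<forall>x. frechet_derivative V2 (at x) (V1 x) = frechet_derivative V1 (at x) (V2 x))"

definition lin_indep2 :: "complex ^ 'n \<Rightarrow> complex ^ 'n \<Rightarrow> bool" where
  "lin_indep2 v w \<longleftrightarrow> (\<forall>a b :: complex. a *s v + b *s w = 0 \<longrightarrow> a = 0 \<and> b = 0)"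

text \<open>An integral parametrisation of the foliation generated by V1, V2 at p:
  a holomorphic map phi from an open neighbourhood U of 0 in C^2 to C^n with
  phi 0 = p, d phi/ds = V1 o phi, d phi/dt = V2 o phi
  (for commuting fields, phi(s,t) = flow of V1 at time s of the flow of V2 at time t).
  When V1(p), V2(p) are independent, phi is a biholomorphism from a neighbourhood
  of 0 onto a neighbourhood of p in the leaf L; pulling back by phi identifies
  O_p(L) with the ring of germs at 0 of holomorphic functions on C^2.\<close>

definition cscale2 :: "complex \<Rightarrow> complex \<times> complex \<Rightarrow> complex \<times> complex" where
  "cscale2 c w = (c * fst w, c * snd w)"

definition leaf_param ::
  "(complex ^ 'n \<Rightarrow> complex ^ 'n) \<Rightarrow> (complex ^ 'n \<Rightarrow> complex ^ 'n) \<Rightarrow> complex ^ 'n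
   \<Rightarrow> (complex \<times> complex \<Rightarrow> complex ^ 'n) \<Rightarrow> (complex \<times> complex) set \<Rightarrow> bool" where
  "leaf_param V1 V2 p \<phi> U \<longleftrightarrow> open U \<and> 0 \<in> U \<and> \<phi> 0 = p \<and>
     (\<forall>z\<in>U. \<exists>D. (\<phi> has_derivative D) (at z) \<and>
        (\<forall>c w. D (cscale2 c w) = c *s D w) \<and>
        D (1, 0) = V1 (\<phi> z) \<and> D (0, 1) = V2 (\<phi> z))"

definition holo2_on :: "(complex \<times> complex \<Rightarrow> complex) \<Rightarrow> (complex \<times> complex) set \<Rightarrow> bool" where
  "holo2_on h U \<longleftrightarrow> (\<forall>z\<in>U. \<exists>D. (h has_derivative D) (at z) \<and>
        (\<forall>c w. D (cscale2 c w) = c * D w))"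

definition germ_hol :: "(complex \<times> complex \<Rightarrow> complex) \<Rightarrow> bool" where
  "germ_hol h \<longleftrightarrow> (\<exists>U. open U \<and> 0 \<in> U \<and> holo2_on h U)"

definition germ_eq :: "(complex \<times> complex \<Rightarrow> complex) \<Rightarrow> (complex \<times> complex \<Rightarrow> complex) \<Rightarrow> bool" where
  "germ_eq a b \<longleftrightarrow> (\<forall>\<^sub>F z in nhds 0. a z = b z)"

definition germ_unit :: "(complex \<times> complex \<Rightarrow> complex) \<Rightarrow> bool" where
  "germ_unit u \<longleftrightarrow> germ_hol u \<and> u 0 \<noteq> 0"

definition germ_dvd :: "(complex \<times> complex \<Rightarrow> complex) \<Rightarrow> (complex \<times> complex \<Rightarrow> complex) \<Rightarrow> bool" where
  "germ_dvd a b \<longleftrightarrow> (\<exists>c. germ_hol c \<and> germ_eq b (\<lambda>z. a z * c z))"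

definition germ_irred :: "(complex \<times> complex \<Rightarrow> complex) \<Rightarrow> bool" where
  "germ_irred q \<longleftrightarrow> germ_hol q \<and> \<not> germ_eq q (\<lambda>_. 0) \<and> \<not> germ_unit q \<and>
     (\<forall>a b. germ_hol a \<and> germ_hol b \<and> germ_eq q (\<lambda>z. a z * b z) \<longrightarrow> germ_unit a \<or> germ_unit b)"

definition quot_dim_le :: "(complex \<times> complex \<Rightarrow> complex) \<Rightarrow> (complex \<times> complex \<Rightarrow> complex) \<Rightarrow> nat \<Rightarrow> bool" where
  "quot_dim_le f g k \<longleftrightarrow> (\<exists>e :: nat \<Rightarrow> complex \<times> complex \<Rightarrow> complex.
     (\<forall>i<k. germ_hol (e i)) \<and>
     (\<forall>h. germ_hol h \<longrightarrow> (\<exists>c :: nat \<Rightarrow> complex. \<exists>a b. germ_hol a \<and> germ_hol b \<and>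
        germ_eq h (\<lambda>z. (\<Sum>i<k. c i * e i z) + a z * f z + b z * g z))))"

end

theory Submission
  imports
    Defs
    "HOL-Library.Function_Algebras"
    "HOL-Complex_Analysis.Complex_Analysis"
    "Jordan_Normal_Form.Char_Poly"
begin

text \<open>
  The Taylor coefficients at the base point of the restrictions F and G to the leaf are polynomials
  in finitely many parameters: the coefficients of V1, V2, F, G and the coordinates of p. By
  Noetherianity of polynomial rings, the order of vanishing of a power series whose coefficients are
  polynomials in the parameters is bounded on the set of parameters where the series is nonzero.

  After a linear change of the time variables, F is regular in y of some order d, and d is bounded by
  that principle. Multiplication by G on the free C{x}-module O/(F) of rank d has a characteristic
  polynomial chi whose coefficients are series in x with Taylor coefficients polynomial in the
  parameters and the inverse of one leading coefficient. By Cayley and Hamilton, F divides chi(G).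
  Write chi(T) = T^l (c_l + T S(T)) with c_l nonzero. As f divides F and is coprime to G, it divides
  c_l + G S(G), so the series c_l(x) lies in (f, G), and hence in (f, g). Its order M is again bounded,
  x^M lies in (f, g), and by Weierstrass division by f the quotient is spanned by the monomials
  x^i y^j with i < M and j < d.
\<close>

section \<open>Noetherianity of finitely generated function algebras\<close>

text \<open>The factors \<open>f\<close> and \<open>g\<close> exist only as germs on a single leaf
  and do not vary polynomially with the data, so no finiteness argument applies to them directly.
  Only the series of F and G form a polynomial family. Every uniform bound is therefore drawn from F
  and G, while \<open>f\<close> enters merely as a divisor of F that is coprime to G.

  The natural invariant, the determinant of multiplication by G modulo F, vanishes when F and G
  share a nonunit factor. The lowest nonzero coefficient of the characteristic polynomial replaces
  it: the power of G split off in front takes up the common factors and can be cancelled against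
  \<open>f\<close>.

  Noetherianity gives existence only, so the bound is a choice of stabilisation indices and not a
  formula. Weierstrass division is written as an explicit recursion on coefficients, because that
  recursion has to serve twice, once for convergence and once for polynomial dependence on the
  parameters. Unique factorisation of germs is not invoked; the instance of Euclid's lemma that is
  needed comes from division.\<close>

definition is_subring :: "'a::comm_ring_1 set \<Rightarrow> bool" where
  "is_subring R \<longleftrightarrow> 0 \<in> R \<and> 1 \<in> R \<and> (\<forall>a\<in>R. \<forall>b\<in>R. a + b \<in> R) \<and> (\<forall>a\<in>R. - a \<in> R)
     \<and> (\<forall>a\<in>R. \<forall>b\<in>R. a * b \<in> R)"

definition lin_span :: "'a::comm_ring_1 set \<Rightarrow> (nat \<Rightarrow> 'a) \<Rightarrow> nat \<Rightarrow> 'a set" where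
  "lin_span R a n = {\<Sum>i<n. c i * a i | c. \<forall>i. c i \<in> R}"

text \<open>Equivalent to the ascending chain condition on ideals, in the form that applies directly
  to sequences of Taylor coefficients. Rings are carrier sets in an ambient ring, so adjoining
  functions stays inside one type of functions.\<close>

definition noeth :: "'a::comm_ring_1 set \<Rightarrow> bool" where
  "noeth R \<longleftrightarrow> (\<forall>a. (\<forall>i. a i \<in> R) \<longrightarrow> (\<exists>N. a N \<in> lin_span R a N))"

lemma is_subring_sum:
  assumes "is_subring R" "\<And>i. i \<in> I \<Longrightarrow> f i \<in> R"
  shows "sum f I \<in> R"
proof -
  have "0 \<in> R" "\<And>a b. a \<in> R \<Longrightarrow> b \<in> R \<Longrightarrow> a + b \<in> R"
    using assms(1) by (auto simp: is_subring_def)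
  then show ?thesis using assms(2)
    by (induction I rule: infinite_finite_induct) auto
qed

lemma lin_span_add:
  assumes "is_subring R" "x \<in> lin_span R a n" "y \<in> lin_span R a n"
  shows "x + y \<in> lin_span R a n"
proof -
  obtain c c' where "\<forall>i. c i \<in> R" "\<forall>i. c' i \<in> R" "x = (\<Sum>i<n. c i * a i)" "y = (\<Sum>i<n. c' i * a i)"
    using assms unfolding lin_span_def by auto
  then show ?thesis using assms(1) unfolding lin_span_def is_subring_def
    by (auto intro!: exI[of _ "\<lambda>i. c i + c' i"] simp: sum.distrib algebra_simps)
qed

lemma lin_span_mult:
  assumes "is_subring R" "x \<in> lin_span R a n" "y \<in> R"
  shows "y * x \<in> lin_span R a n"
proof -
  obtain c where "\<forall>i. c i \<in> R" "x = (\<Sum>i<n. c i * a i)"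
    using assms unfolding lin_span_def by auto
  then show ?thesis using assms unfolding lin_span_def is_subring_def
    by (auto intro!: exI[of _ "\<lambda>i. y * c i"] simp: sum_distrib_left algebra_simps)
qed

lemma lin_span_zero:
  assumes "is_subring R"
  shows "0 \<in> lin_span R a n"
proof -
  have "0 \<in> R" using assms by (auto simp: is_subring_def)
  then show ?thesis unfolding lin_span_def by (auto intro!: exI[of _ "\<lambda>i. 0"])
qed

lemma lin_span_sum:
  assumes "is_subring R" "\<And>i. i \<in> I \<Longrightarrow> f i \<in> lin_span R a n"
  shows "sum f I \<in> lin_span R a n"
  using assms by (induction I rule: infinite_finite_induct) (auto simp: lin_span_zero lin_span_add)

lemma lin_span_base:
  assumes "is_subring R" "i < n"
  shows "a i \<in> lin_span R a n"
proof -
  have "a i = (\<Sum>j<n. (if j = i then 1 else 0) * a j)"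
    using assms by (subst sum.remove[of _ i]) (auto intro!: sum.neutral)
  then show ?thesis using assms unfolding lin_span_def is_subring_def
    by (auto intro!: exI[of _ "\<lambda>j. if j = i then 1 else 0"])
qed

lemma lin_span_mono:
  assumes "is_subring R" "x \<in> lin_span R a n" "n \<le> m"
  shows "x \<in> lin_span R a m"
proof -
  obtain c where c: "\<forall>i. c i \<in> R" "x = (\<Sum>i<n. c i * a i)"
    using assms unfolding lin_span_def by auto
  show ?thesis unfolding c(2)
    by (rule lin_span_sum[OF assms(1)], rule lin_span_mult[OF assms(1)])
      (use c assms in \<open>auto intro!: lin_span_base\<close>)
qed

lemma lin_span_trans:
  assumes "is_subring R" "x \<in> lin_span R b k" "\<And>i. i < k \<Longrightarrow> b i \<in> lin_span R a n"
  shows "x \<in> lin_span R a n"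
proof -
  obtain c where c: "\<forall>i. c i \<in> R" "x = (\<Sum>i<k. c i * b i)"
    using assms unfolding lin_span_def by auto
  show ?thesis unfolding c(2)
    by (rule lin_span_sum[OF assms(1)], rule lin_span_mult[OF assms(1)]) (use c assms in auto)
qed

section \<open>Hilbert's basis theorem\<close>

definition polys_over :: "'a::comm_ring_1 set \<Rightarrow> 'a poly set" where
  "polys_over R = {p. \<forall>i. coeff p i \<in> R}"

lemma is_subring_polys_over:
  assumes "is_subring R"
  shows "is_subring (polys_over R)"
proof -
  have R: "0 \<in> R" "1 \<in> R" "\<And>a b. a \<in> R \<Longrightarrow> b \<in> R \<Longrightarrow> a + b \<in> R" "\<And>a. a \<in> R \<Longrightarrow> - a \<in> R"
    "\<And>a b. a \<in> R \<Longrightarrow> b \<in> R \<Longrightarrow> a * b \<in> R"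
    using assms by (auto simp: is_subring_def)
  then show ?thesis
    unfolding polys_over_def is_subring_def
    by (auto simp: coeff_mult coeff_1 intro!: is_subring_sum[OF assms])
qed

text \<open>Cancellation of leading terms: the relation between leading coefficients is lifted by
  monomials that raise each \<open>f i\<close> to the degree of \<open>f N\<close>. The case
  \<open>f N = g\<close> is listed apart because the zero polynomial has degree 0, which is not
  below the degree of a constant.\<close>

lemma lin_span_lead_coeffs:
  fixes f :: "nat \<Rightarrow> 'a::comm_ring_1 poly"
  assumes R: "is_subring R" and f: "\<And>i. f i \<in> polys_over R"
    and mono: "\<And>i. i < N \<Longrightarrow> degree (f i) \<le> degree (f N)"
    and lc: "lead_coeff (f N) \<in> lin_span R (\<lambda>i. lead_coeff (f i)) N"
  shows "\<exists>g. g \<in> lin_span (polys_over R) f N \<and> (f N = g \<or> degree (f N - g) < degree (f N))"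
proof -
  obtain c where c: "\<forall>i. c i \<in> R" "lead_coeff (f N) = (\<Sum>i<N. c i * lead_coeff (f i))"
    using lc unfolding lin_span_def by auto
  define g where "g = (\<Sum>i<N. monom (c i) (degree (f N) - degree (f i)) * f i)"
  have 0: "0 \<in> R" using R unfolding is_subring_def by auto
  have gs: "g \<in> lin_span (polys_over R) f N"
    unfolding g_def lin_span_def polys_over_def using c 0
    by (auto intro!: exI[of _ "\<lambda>i. monom (c i) (degree (f N) - degree (f i))"])
  have dg: "degree g \<le> degree (f N)" unfolding g_def
  proof (rule degree_sum_le)
    fix i assume "i \<in> {..<N}"
    then have i: "degree (f i) \<le> degree (f N)" using mono by auto
    have "degree (monom (c i) (degree (f N) - degree (f i)) * f i)
       \<le> (degree (f N) - degree (f i)) + degree (f i)"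
      by (rule order_trans[OF degree_mult_le]) (auto intro: degree_monom_le)
    then show "degree (monom (c i) (degree (f N) - degree (f i)) * f i) \<le> degree (f N)"
      using i by simp
  qed simp
  have cg: "coeff g (degree (f N)) = lead_coeff (f N)"
    unfolding g_def c(2) coeff_sum
    by (rule sum.cong) (use mono in \<open>auto simp: coeff_monom_mult\<close>)
  have "degree (f N - g) \<le> degree (f N)" using dg by (intro degree_diff_le) auto
  moreover have "coeff (f N - g) (degree (f N)) = 0" using cg by simp
  ultimately have "degree (f N - g) < degree (f N) \<or> f N - g = 0"
    by (metis le_neq_implies_less leading_coeff_0_iff)
  then show ?thesis using gs by auto
qed

text \<open>Hilbert's argument by least degrees. In the ideal generated by a counterexample
  sequence, choose repeatedly an element of least degree outside the span of those already chosen. A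
  relation among leading coefficients in \<open>R\<close> then yields an element of smaller degree
  that is still outside the span.\<close>

lemma noeth_polys_over:
  fixes R :: "'a::comm_ring_1 set"
  assumes R: "is_subring R" and N: "noeth R"
  shows "noeth (polys_over R)"
  unfolding noeth_def
proof (intro allI impI)
  fix p :: "nat \<Rightarrow> 'a poly" assume p: "\<forall>i. p i \<in> polys_over R"
  let ?P = "polys_over R"
  have P: "is_subring ?P" using R by (rule is_subring_polys_over)
  show "\<exists>N. p N \<in> lin_span ?P p N"
  proof (rule ccontr)
    assume neg: "\<not> ?thesis"
    define I where "I = (\<Union>n. lin_span ?P p n)"
    \<comment> \<open>No finite family from \<open>I\<close> spans \<open>I\<close>: such a family
      lies in the span of the first \<open>K\<close> terms of \<open>p\<close>, and then
      \<open>p K\<close> would lie there too.\<close>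
    have I_ex: "\<exists>h. h \<in> I - lin_span ?P f n" if f: "\<And>i. i < n \<Longrightarrow> f i \<in> I" for f n
    proof (rule ccontr)
      assume "\<not> ?thesis"
      then have sub: "I \<subseteq> lin_span ?P f n" by auto
      have "\<forall>i\<in>{..<n}. \<exists>k. f i \<in> lin_span ?P p k" using f unfolding I_def by auto
      then obtain k where k: "\<And>i. i < n \<Longrightarrow> f i \<in> lin_span ?P p (k i)" by (metis lessThan_iff)
      define K where "K = (\<Sum>i<n. k i)"
      have fK: "f i \<in> lin_span ?P p K" if "i < n" for i
        by (rule lin_span_mono[OF P k[OF that]]) (use that in \<open>auto simp: K_def intro: member_le_sum\<close>)
      have "p K \<in> I" unfolding I_def using lin_span_base[OF P, of K "Suc K" p] by auto
      then have "p K \<in> lin_span ?P p K" using lin_span_trans[OF P _ fK] sub by auto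
      then show False using neg by auto
    qed
    define Q where "Q = (\<lambda>f n h. h \<in> I \<and> ((\<forall>i<n. f i \<in> I) \<longrightarrow> h \<notin> lin_span ?P f n
       \<and> (\<forall>h'. h' \<in> I - lin_span ?P f n \<longrightarrow> degree h \<le> degree h')))"
    have "\<exists>f. \<forall>n. Q f n (f n)"
    proof (rule dependent_wellorder_choice)
      fix r :: "'a poly" and f g :: "nat \<Rightarrow> 'a poly" and n :: nat
      assume fg: "\<And>y. y < n \<Longrightarrow> f y = g y"
      then have "lin_span ?P f n = lin_span ?P g n" unfolding lin_span_def by auto
      then show "Q f n r = Q g n r" unfolding Q_def using fg by auto
    next
      fix n and f :: "nat \<Rightarrow> 'a poly"
      assume "\<And>y. y < n \<Longrightarrow> Q f y (f y)"
      then have "\<And>i. i < n \<Longrightarrow> f i \<in> I" unfolding Q_def by auto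
      from I_ex[of n f, OF this] obtain h0 where "h0 \<in> I - lin_span ?P f n" by blast
      then obtain h where "h \<in> I - lin_span ?P f n"
        "\<forall>h'. h' \<in> I - lin_span ?P f n \<longrightarrow> degree h \<le> degree h'"
        using ex_has_least_nat[of "\<lambda>h. h \<in> I - lin_span ?P f n" h0 degree] by auto
      then show "\<exists>r. Q f n r" unfolding Q_def by auto
    qed
    then obtain f where f: "\<And>n. Q f n (f n)" by auto
    have fI: "f i \<in> I" for i using f unfolding Q_def by auto
    have fn: "f n \<notin> lin_span ?P f n" for n using f fI unfolding Q_def by auto
    have fm: "h \<in> I \<Longrightarrow> h \<notin> lin_span ?P f n \<Longrightarrow> degree (f n) \<le> degree h" for n h
      using f fI unfolding Q_def by auto
    have IP: "I \<subseteq> ?P" unfolding I_def lin_span_def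
      using p P by (auto intro!: is_subring_sum[OF P]) (auto simp: is_subring_def)
    \<comment> \<open>A later choice was already outside the earlier, smaller span, so minimality
      makes the degrees weakly increasing.\<close>
    have mono: "degree (f i) \<le> degree (f n)" if "i < n" for i n
      using fm[OF fI] fn lin_span_mono[OF P, of _ f i n] that by auto
    have "\<forall>i. lead_coeff (f i) \<in> R" using fI IP unfolding polys_over_def by auto
    then obtain n where n: "lead_coeff (f n) \<in> lin_span R (\<lambda>i. lead_coeff (f i)) n"
      using N unfolding noeth_def by (metis (no_types, lifting))
    obtain g where g: "g \<in> lin_span ?P f n" "f n = g \<or> degree (f n - g) < degree (f n)"
      using lin_span_lead_coeffs[OF R _ mono n] fI IP by auto
    then have lt: "degree (f n - g) < degree (f n)" using fn by auto
    have m1: "(-1) \<in> ?P" using P unfolding is_subring_def by auto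
    have "g \<in> I"
    proof -
      have "\<forall>i\<in>{..<n}. \<exists>k. f i \<in> lin_span ?P p k" using fI unfolding I_def by auto
      then obtain k where k: "\<And>i. i < n \<Longrightarrow> f i \<in> lin_span ?P p (k i)" by (metis lessThan_iff)
      have "f i \<in> lin_span ?P p (\<Sum>i<n. k i)" if "i < n" for i
        by (rule lin_span_mono[OF P k[OF that]]) (use that in \<open>auto intro: member_le_sum\<close>)
      then show ?thesis using lin_span_trans[OF P g(1)] unfolding I_def by blast
    qed
    then obtain k1 k2 where k: "g \<in> lin_span ?P p k1" "f n \<in> lin_span ?P p k2"
      using fI[of n] unfolding I_def by auto
    have "f n + (-1) * g \<in> lin_span ?P p (max k1 k2)"
      using lin_span_mono[OF P k(1), of "max k1 k2"] lin_span_mono[OF P k(2), of "max k1 k2"]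
      by (intro lin_span_add[OF P] lin_span_mult[OF P _ m1]) auto
    then have "f n - g \<in> I" unfolding I_def by auto
    moreover have "f n - g \<notin> lin_span ?P f n"
      using lin_span_add[OF P _ g(1), of "f n - g"] fn by auto
    ultimately show False using fm lt by (meson not_less)
  qed
qed

section \<open>Finitely generated algebras of functions\<close>

definition adjoin :: "'a::comm_ring_1 set \<Rightarrow> 'a \<Rightarrow> 'a set" where
  "adjoin R t = (\<lambda>p. poly p t) ` polys_over R"

lemma is_subring_adjoin:
  assumes "is_subring R"
  shows "is_subring (adjoin R t)"
proof -
  have R: "0 \<in> polys_over R" "1 \<in> polys_over R"
    "\<And>a b. a \<in> polys_over R \<Longrightarrow> b \<in> polys_over R \<Longrightarrow> a + b \<in> polys_over R"
    "\<And>a. a \<in> polys_over R \<Longrightarrow> - a \<in> polys_over R"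
    "\<And>a b. a \<in> polys_over R \<Longrightarrow> b \<in> polys_over R \<Longrightarrow> a * b \<in> polys_over R"
    using is_subring_polys_over[OF assms] by (auto simp: is_subring_def)
  show ?thesis
    unfolding adjoin_def is_subring_def
    using R image_eqI[of 0 "\<lambda>p. poly p t" 0] image_eqI[of 1 "\<lambda>p. poly p t" 1]
    by (auto simp flip: poly_add poly_mult poly_minus)
qed

lemma adjoin_base:
  assumes "is_subring R" "a \<in> R"
  shows "a \<in> adjoin R t"
proof -
  have "0 \<in> R" using assms(1) by (auto simp: is_subring_def)
  then have "[:a:] \<in> polys_over R" using assms(2)
    by (auto simp: polys_over_def coeff_pCons split: nat.split)
  then show ?thesis unfolding adjoin_def by (rule image_eqI[rotated]) simp
qed

lemma adjoin_gen:
  assumes "is_subring R"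
  shows "t \<in> adjoin R t"
proof -
  have "0 \<in> R" "1 \<in> R" using assms(1) by (auto simp: is_subring_def)
  then have "[:0, 1:] \<in> polys_over R"
    by (auto simp: polys_over_def coeff_pCons split: nat.split)
  then show ?thesis unfolding adjoin_def by (rule image_eqI[rotated]) simp
qed

text \<open>\<open>adjoin R t\<close> is a quotient of the polynomial ring: lift the sequence to
  polynomials, find the relation there and evaluate it at \<open>t\<close>. Algebraic relations
  satisfied by \<open>t\<close> do no harm.\<close>

lemma noeth_adjoin:
  assumes R: "is_subring R" and N: "noeth R"
  shows "noeth (adjoin R t)"
  unfolding noeth_def
proof (intro allI impI)
  fix a :: "nat \<Rightarrow> 'a" assume "\<forall>i. a i \<in> adjoin R t"
  then have "\<forall>i. \<exists>p. p \<in> polys_over R \<and> a i = poly p t" unfolding adjoin_def by auto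
  then obtain p where p: "\<And>i. p i \<in> polys_over R" "\<And>i. a i = poly (p i) t" by metis
  obtain n where "p n \<in> lin_span (polys_over R) p n"
    using noeth_polys_over[OF R N] p(1) unfolding noeth_def by auto
  then obtain c where c: "\<And>i. c i \<in> polys_over R" "p n = (\<Sum>i<n. c i * p i)"
    unfolding lin_span_def by auto
  have "a n \<in> lin_span (adjoin R t) a n"
    unfolding p(2)[of n] c(2) lin_span_def adjoin_def using c(1) p(2)
    by (auto simp: poly_sum intro!: exI[of _ "\<lambda>i. poly (c i) t"])
  then show "\<exists>n. a n \<in> lin_span (adjoin R t) a n" by auto
qed

text \<open>Polynomial expressions in \<open>B\<close> are kept as functions and not as formal
  polynomials, because only their zeros at parameter points matter.\<close>

inductive_set fun_alg :: "('l \<Rightarrow> complex) set \<Rightarrow> ('l \<Rightarrow> complex) set" for B where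
  const: "(\<lambda>_. c) \<in> fun_alg B"
| gen: "b \<in> B \<Longrightarrow> b \<in> fun_alg B"
| add: "u \<in> fun_alg B \<Longrightarrow> v \<in> fun_alg B \<Longrightarrow> (\<lambda>l. u l + v l) \<in> fun_alg B"
| mult: "u \<in> fun_alg B \<Longrightarrow> v \<in> fun_alg B \<Longrightarrow> (\<lambda>l. u l * v l) \<in> fun_alg B"

text \<open>Inclusion in a Noetherian ring of functions suffices: the relations it provides are only
  evaluated at points, so their coefficients may be any functions.\<close>

lemma noeth_subset_fun_alg:
  assumes "finite B"
  shows "\<exists>R. is_subring R \<and> noeth R \<and> fun_alg B \<subseteq> R"
  using assms
proof (induction B)
  case empty
  let ?R = "range (\<lambda>c (_::'l). c::complex)"
  have R: "is_subring ?R" unfolding is_subring_def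
    by (auto simp: zero_fun_def one_fun_def plus_fun_def times_fun_def fun_Compl_def)
  have "noeth ?R" unfolding noeth_def
  proof (intro allI impI)
    fix a :: "nat \<Rightarrow> 'l \<Rightarrow> complex" assume a: "\<forall>i. a i \<in> ?R"
    then have "\<forall>i. \<exists>d. a i = (\<lambda>_. d)" by blast
    then obtain c where c: "\<And>i. a i = (\<lambda>_. c i)" using choice[of "\<lambda>i d. a i = (\<lambda>_. d)"] by blast
    show "\<exists>n. a n \<in> lin_span ?R a n"
    \<comment> \<open>Constants form a field: either the first term is zero or the second is a
      multiple of it.\<close>
    proof (cases "c 0 = 0")
      case True
      then have "a 0 = 0" by (simp add: c zero_fun_def)
      then show ?thesis using lin_span_zero[OF R, of a 0] by metis
    next
      case False
      then have "a 1 = (\<lambda>_. c 1 / c 0) * a 0" by (simp add: c times_fun_def)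
      moreover have "a 0 \<in> lin_span ?R a 1" by (rule lin_span_base[OF R]) simp
      ultimately have "a 1 \<in> lin_span ?R a 1"
        using lin_span_mult[OF R, of "a 0" a 1 "\<lambda>_. c 1 / c 0"] by auto
      then show ?thesis by blast
    qed
  qed
  moreover have "u \<in> ?R" if "u \<in> fun_alg {}" for u
    using that by induction auto
  ultimately show ?case using R by blast
next
  case (insert t B)
  then obtain R where R: "is_subring R" "noeth R" "fun_alg B \<subseteq> R" by auto
  have S: "is_subring (adjoin R t)" using R by (simp add: is_subring_adjoin)
  have "u \<in> adjoin R t" if "u \<in> fun_alg (insert t B)" for u
    using that
  proof induction
    case (const c)
    then show ?case using R adjoin_base fun_alg.const by blast
  next
    case (gen b)
    then show ?case using R adjoin_base adjoin_gen fun_alg.gen by (metis insertE subsetD)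
  next
    case (add u v)
    then have "u + v \<in> adjoin R t" using S unfolding is_subring_def by auto
    then show ?case by (simp add: plus_fun_def)
  next
    case (mult u v)
    then have "u * v \<in> adjoin R t" using S unfolding is_subring_def by auto
    then show ?case by (simp add: times_fun_def)
  qed
  then show ?case using noeth_adjoin[OF R(1,2)] S by blast
qed

text \<open>\<open>M\<close> collects the indices at which a first nonzero value occurs for some
  point. If it were infinite, one of the functions at these indices would be a combination of its
  predecessors; evaluating at a point where the predecessors vanish and this function does not gives
  a contradiction.\<close>

lemma fun_alg_zeros_stable:
  fixes a :: "nat \<Rightarrow> 'l \<Rightarrow> complex"
  assumes "finite B" and a: "\<And>i. a i \<in> fun_alg B"
  shows "\<exists>N. \<forall>l. (\<forall>i<N. a i l = 0) \<longrightarrow> (\<forall>i. a i l = 0)"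
proof -
  define M where "M = {m. \<exists>l. a m l \<noteq> 0 \<and> (\<forall>i<m. a i l = 0)}"
  have fin: "finite M"
  proof (rule ccontr)
    assume inf: "infinite M"
    obtain R where R: "noeth R" "fun_alg B \<subseteq> R"
      using noeth_subset_fun_alg[OF assms(1)] by auto
    define b where "b = (\<lambda>i. a (enumerate M i))"
    have "\<forall>i. b i \<in> R" using a R unfolding b_def by auto
    then obtain n where "b n \<in> lin_span R b n" using R unfolding noeth_def by blast
    then obtain c where c: "b n = (\<Sum>i<n. c i * b i)" unfolding lin_span_def by auto
    have "enumerate M n \<in> M" using enumerate_in_set inf by auto
    then obtain l where l: "a (enumerate M n) l \<noteq> 0" "\<forall>i<enumerate M n. a i l = 0"
      unfolding M_def by auto
    have "b i l = 0" if "i < n" for i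
      using l(2) enumerate_mono[OF that inf] unfolding b_def by auto
    moreover have "(\<Sum>i<n. c i * b i) l = (\<Sum>i<n. c i l * b i l)"
      by (induction n) (auto simp: plus_fun_def times_fun_def zero_fun_def)
    ultimately have "b n l = 0" unfolding c by simp
    then show False using l unfolding b_def by auto
  qed
  have "(\<forall>i. a i l = 0)" if "\<forall>i<Suc (Max M). a i l = 0" for l
  proof (rule ccontr)
    assume "\<not> ?thesis"
    then have ex: "\<exists>m. a m l \<noteq> 0" by auto
    define m where "m = (LEAST m. a m l \<noteq> 0)"
    have "a m l \<noteq> 0" using LeastI_ex[OF ex] unfolding m_def by auto
    moreover have "\<forall>i<m. a i l = 0" using not_less_Least unfolding m_def by blast
    ultimately have "m \<in> M" unfolding M_def by auto
    then have "m \<le> Max M" using fin by auto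
    then show False using that \<open>a m l \<noteq> 0\<close> by auto
  qed
  then show ?thesis by blast
qed

section \<open>Convergent double series and Weierstrass division\<close>

text \<open>The weighted l1 norm of \<open>a\<close> at radius \<open>s\<close> is at most
  \<open>K\<close>. Bounding the partial sums states convergence and the bound at once, and this
  norm is submultiplicative.\<close>

definition wbound :: "real \<Rightarrow> real \<Rightarrow> complex fps \<Rightarrow> bool" where
  "wbound s K a \<longleftrightarrow> (\<forall>n. (\<Sum>j\<le>n. norm (fps_nth a j) * s ^ j) \<le> K)"

lemma wbound_nonneg: "wbound s K a \<Longrightarrow> 0 \<le> K"
  unfolding wbound_def by (metis (no_types, lifting) atMost_0 finite.emptyI empty_iff norm_ge_zero
    mult.right_neutral order_trans power_0 sum.empty sum.insert add.right_neutral)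

lemma wbound_mono: "wbound s K a \<Longrightarrow> K \<le> L \<Longrightarrow> wbound s L a"
  unfolding wbound_def by (meson order_trans)

lemma wbound_antimono:
  assumes "wbound s K a" "0 \<le> s'" "s' \<le> s" shows "wbound s' K a"
  unfolding wbound_def
proof
  fix n
  have "(\<Sum>j\<le>n. norm (fps_nth a j) * s' ^ j) \<le> (\<Sum>j\<le>n. norm (fps_nth a j) * s ^ j)"
    using assms by (intro sum_mono mult_left_mono power_mono) auto
  also have "\<dots> \<le> K" using assms(1) unfolding wbound_def by auto
  finally show "(\<Sum>j\<le>n. norm (fps_nth a j) * s' ^ j) \<le> K" .
qed

lemma wbound_add:
  assumes "wbound s K a" "wbound s L b" "0 \<le> s" shows "wbound s (K + L) (a + b)"
  unfolding wbound_def
proof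
  fix n
  have "(\<Sum>j\<le>n. norm (fps_nth (a + b) j) * s ^ j)
      \<le> (\<Sum>j\<le>n. norm (fps_nth a j) * s ^ j + norm (fps_nth b j) * s ^ j)"
    using assms(3) by (intro sum_mono) (auto simp flip: distrib_right intro!: mult_right_mono norm_triangle_ineq)
  also have "\<dots> \<le> K + L" using assms unfolding wbound_def sum.distrib by (intro add_mono) auto
  finally show "(\<Sum>j\<le>n. norm (fps_nth (a + b) j) * s ^ j) \<le> K + L" .
qed

lemma wbound_uminus: "wbound s K a \<Longrightarrow> wbound s K (- a)"
  unfolding wbound_def by simp

lemma wbound_diff:
  assumes "wbound s K a" "wbound s L b" "0 \<le> s" shows "wbound s (K + L) (a - b)"
  using wbound_add[OF assms(1) wbound_uminus[OF assms(2)] assms(3)] by simp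

lemma wbound_0: "wbound s 0 0"
  unfolding wbound_def by simp

lemma wbound_sum:
  assumes "\<And>i. i \<in> I \<Longrightarrow> wbound s (K i) (a i)" "0 \<le> s"
  shows "wbound s (sum K I) (sum a I)"
  using assms by (induction I rule: infinite_finite_induct) (auto simp: wbound_0 wbound_add)

lemma wbound_mult:
  assumes "wbound s K a" "wbound s L b" "0 \<le> s" shows "wbound s (K * L) (a * b)"
  unfolding wbound_def
proof
  fix n
  define p q where "p = (\<lambda>j. norm (fps_nth a j) * s ^ j)" "q = (\<lambda>j. norm (fps_nth b j) * s ^ j)"
  have pos: "0 \<le> p j" "0 \<le> q j" for j using assms(3) unfolding p_q_def by auto
  have "(\<Sum>j\<le>n. norm (fps_nth (a * b) j) * s ^ j) \<le> (\<Sum>k\<le>n. \<Sum>i\<le>k. p i * q (k - i))"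
  proof (rule sum_mono)
    fix k
    have "norm (fps_nth (a * b) k) * s ^ k
        \<le> (\<Sum>i\<le>k. norm (fps_nth a i) * norm (fps_nth b (k - i))) * s ^ k"
      unfolding fps_mult_nth using assms(3) atLeast0AtMost[of k]
      by (intro mult_right_mono) (auto intro!: order_trans[OF norm_sum] simp: norm_mult)
    also have "\<dots> = (\<Sum>i\<le>k. p i * q (k - i))"
      unfolding sum_distrib_right p_q_def
      by (rule sum.cong) (auto simp: algebra_simps simp flip: power_add)
    finally show "norm (fps_nth (a * b) k) * s ^ k \<le> (\<Sum>i\<le>k. p i * q (k - i))" .
  qed
  also have "\<dots> = (\<Sum>(i, j)\<in>{(i, j). i + j \<le> n}. p i * q j)"
    by (rule sum.triangle_reindex_eq[symmetric])
  also have "\<dots> \<le> (\<Sum>(i, j)\<in>{..n} \<times> {..n}. p i * q j)"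
    by (rule sum_mono2) (auto simp: pos)
  also have "\<dots> = (\<Sum>i\<le>n. p i) * (\<Sum>j\<le>n. q j)"
    by (simp add: sum_product sum.cartesian_product)
  also have "\<dots> \<le> K * L"
    using assms wbound_nonneg[OF assms(1)] pos unfolding wbound_def p_q_def
    by (intro mult_mono) (auto intro: sum_nonneg)
  finally show "(\<Sum>j\<le>n. norm (fps_nth (a * b) j) * s ^ j) \<le> K * L" .
qed

lemma wbound_shift:
  assumes "wbound s K a" "0 < s" shows "wbound s (K / s ^ d) (fps_shift d a)"
  unfolding wbound_def
proof
  fix n
  have "(\<Sum>j\<le>n. norm (fps_nth a (j + d)) * s ^ j) * s ^ d
      = (\<Sum>j\<le>n. norm (fps_nth a (j + d)) * s ^ (j + d))"
    unfolding sum_distrib_right by (simp add: power_add mult.assoc)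
  also have "\<dots> = (\<Sum>j\<in>(\<lambda>j. j + d) ` {..n}. norm (fps_nth a j) * s ^ j)"
    by (subst sum.reindex) auto
  also have "\<dots> \<le> (\<Sum>j\<le>n + d. norm (fps_nth a j) * s ^ j)"
    using assms(2) by (intro sum_mono2) auto
  also have "\<dots> \<le> K" using assms(1) unfolding wbound_def by auto
  finally show "(\<Sum>j\<le>n. norm (fps_nth (fps_shift d a) j) * s ^ j) \<le> K / s ^ d"
    using assms(2) by (simp add: field_simps)
qed

lemma wbound_cutoff:
  assumes "wbound s K a" "0 \<le> s" shows "wbound s K (fps_cutoff d a)"
  unfolding wbound_def
proof
  fix n
  have "(\<Sum>j\<le>n. norm (fps_nth (fps_cutoff d a) j) * s ^ j) \<le> (\<Sum>j\<le>n. norm (fps_nth a j) * s ^ j)"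
    using assms(2) by (intro sum_mono) auto
  also have "\<dots> \<le> K" using assms(1) unfolding wbound_def by auto
  finally show "(\<Sum>j\<le>n. norm (fps_nth (fps_cutoff d a) j) * s ^ j) \<le> K" .
qed

section \<open>Convergent series in one variable\<close>

definition conv1 :: "complex fps \<Rightarrow> bool" where
  "conv1 a \<longleftrightarrow> (\<exists>s>0. \<exists>K. wbound s K a)"

lemma wbound_nth: "wbound s K a \<Longrightarrow> 0 \<le> s \<Longrightarrow> norm (fps_nth a j) * s ^ j \<le> K"
  unfolding wbound_def
  by (rule order_trans[of _ "(\<Sum>j\<le>j. norm (fps_nth a j) * s ^ j)"], rule member_le_sum) auto

lemma wbound_geometric:
  assumes "\<And>j. norm (fps_nth a j) \<le> A * B ^ j" "0 < s" "s * B \<le> 1 / 2" "0 \<le> B" "0 \<le> A"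
  shows "wbound s (2 * A) a"
  unfolding wbound_def
proof
  fix n
  have "(\<Sum>j\<le>n. norm (fps_nth a j) * s ^ j) \<le> (\<Sum>j\<le>n. A * (1 / 2) ^ j)"
  proof (rule sum_mono)
    fix j
    have "norm (fps_nth a j) * s ^ j \<le> (A * B ^ j) * s ^ j"
      using assms by (intro mult_right_mono) auto
    also have "\<dots> = A * (s * B) ^ j" by (simp add: power_mult_distrib mult_ac)
    also have "\<dots> \<le> A * (1 / 2) ^ j"
      using assms by (intro mult_left_mono power_mono) auto
    finally show "norm (fps_nth a j) * s ^ j \<le> A * (1 / 2) ^ j" .
  qed
  also have "\<dots> = A * (\<Sum>j\<le>n. (1 / 2) ^ j)" by (simp add: sum_distrib_left)
  also have "(\<Sum>j\<le>n. (1 / 2) ^ j) = 2 - (1 / 2 :: real) ^ n"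
    by (induction n) auto
  also have "A * (2 - (1 / 2) ^ n) \<le> A * 2"
    using assms(5) by (intro mult_left_mono) auto
  finally show "(\<Sum>j\<le>n. norm (fps_nth a j) * s ^ j) \<le> 2 * A" by simp
qed

lemma conv_radius_wbound:
  assumes "wbound s K a" "s > 0" shows "ereal s \<le> fps_conv_radius a"
proof -
  have "summable (\<lambda>j. norm (fps_nth a j * of_real s ^ j))"
    using assms unfolding wbound_def
    by (intro bounded_imp_summable[of _ K]) (auto simp: norm_mult norm_power)
  then have "summable (\<lambda>j. fps_nth a j * of_real s ^ j)" by (rule summable_norm_cancel)
  then have "conv_radius (fps_nth a) \<ge> norm (of_real s :: complex)" by (rule conv_radius_geI)
  then show ?thesis using assms(2) unfolding fps_conv_radius_def by simp
qed

lemma conv1_iff_radius: "conv1 a \<longleftrightarrow> fps_conv_radius a > 0"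
proof
  assume "conv1 a"
  then obtain s K where s: "s > 0" "wbound s K a" unfolding conv1_def by auto
  then show "fps_conv_radius a > 0"
    using conv_radius_wbound by (meson ereal_less(2) less_le_trans)
next
  assume "fps_conv_radius a > 0"
  then obtain s where s: "0 < ereal s" "ereal s < fps_conv_radius a"
    using ereal_dense2 by blast
  then have "summable (\<lambda>j. norm (fps_nth a j * of_real s ^ j))"
    by (intro norm_summable_fps) auto
  then have sm: "summable (\<lambda>j. norm (fps_nth a j) * s ^ j)" using s by (simp add: norm_mult norm_power)
  have "wbound s (\<Sum>j. norm (fps_nth a j) * s ^ j) a"
    unfolding wbound_def using s by (auto intro!: sum_le_suminf[OF sm])
  then show "conv1 a" unfolding conv1_def using s by auto
qed

lemma conv1_inverse: "conv1 a \<Longrightarrow> fps_nth a 0 \<noteq> 0 \<Longrightarrow> conv1 (inverse a)"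
  unfolding conv1_iff_radius by (rule fps_conv_radius_inverse_pos)

lemma conv1_add: "conv1 a \<Longrightarrow> conv1 b \<Longrightarrow> conv1 (a + b)"
  unfolding conv1_iff_radius using fps_conv_radius_add[of a b] by (metis less_le_trans min_less_iff_conj)

lemma conv1_mult: "conv1 a \<Longrightarrow> conv1 b \<Longrightarrow> conv1 (a * b)"
  unfolding conv1_iff_radius using fps_conv_radius_mult[of a b] by (metis less_le_trans min_less_iff_conj)

lemma conv1_uminus: "conv1 a \<Longrightarrow> conv1 (- a)"
  unfolding conv1_iff_radius by simp

lemma conv1_shift: "conv1 a \<Longrightarrow> conv1 (fps_shift d a)"
  unfolding conv1_iff_radius by simp

text \<open>A double series is encoded as a power series in x (outer index) whose coefficients are
  power series in y (inner index).\<close>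

definition conv2 :: "complex fps fps \<Rightarrow> bool" where
  "conv2 a \<longleftrightarrow> (\<exists>s>0. \<exists>A B. \<forall>i. wbound s (A * B ^ i) (fps_nth a i))"

text \<open>Makes the constants monotone, so that several series can be estimated with a common
  radius and common \<open>A\<close>, \<open>B\<close>.\<close>

lemma conv2_bounds:
  assumes "conv2 a"
  obtains s0 A0 B0 where "s0 > 0" "A0 \<ge> 0" "B0 \<ge> 1"
    "\<And>s A B i. 0 < s \<Longrightarrow> s \<le> s0 \<Longrightarrow> A0 \<le> A \<Longrightarrow> B0 \<le> B \<Longrightarrow> wbound s (A * B ^ i) (fps_nth a i)"
proof -
  obtain s0 A0 B0 where s: "s0 > 0" "\<And>i. wbound s0 (A0 * B0 ^ i) (fps_nth a i)"
    using assms unfolding conv2_def by auto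
  show thesis
  proof (rule that[of s0 "\<bar>A0\<bar>" "max 1 \<bar>B0\<bar>"])
    fix s A B :: real and i :: nat
    assume *: "0 < s" "s \<le> s0" "\<bar>A0\<bar> \<le> A" "max 1 \<bar>B0\<bar> \<le> B"
    have "A0 * B0 ^ i \<le> \<bar>A0\<bar> * \<bar>B0\<bar> ^ i" by (metis abs_ge_self abs_mult power_abs)
    also have "\<dots> \<le> A * B ^ i" using * by (intro mult_mono power_mono) auto
    finally show "wbound s (A * B ^ i) (fps_nth a i)"
      using wbound_antimono[OF wbound_mono[OF s(2)]] * by auto
  qed (use s in auto)
qed

lemma conv2_bounds2:
  assumes "conv2 a" "conv2 b" "t > 0"
  obtains s A B where "s > 0" "s \<le> t" "A \<ge> 0" "B \<ge> 1"
    "\<And>i. wbound s (A * B ^ i) (fps_nth a i)" "\<And>i. wbound s (A * B ^ i) (fps_nth b i)"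
proof -
  obtain s1 A1 B1 where a: "s1 > 0" "A1 \<ge> 0" "B1 \<ge> 1"
    "\<And>s A B i. 0 < s \<Longrightarrow> s \<le> s1 \<Longrightarrow> A1 \<le> A \<Longrightarrow> B1 \<le> B \<Longrightarrow> wbound s (A * B ^ i) (fps_nth a i)"
    using conv2_bounds[OF assms(1)] by blast
  obtain s2 A2 B2 where b: "s2 > 0" "A2 \<ge> 0" "B2 \<ge> 1"
    "\<And>s A B i. 0 < s \<Longrightarrow> s \<le> s2 \<Longrightarrow> A2 \<le> A \<Longrightarrow> B2 \<le> B \<Longrightarrow> wbound s (A * B ^ i) (fps_nth b i)"
    using conv2_bounds[OF assms(2)] by blast
  show thesis
    by (rule that[of "min t (min s1 s2)" "max A1 A2" "max B1 B2"])
       (use a b assms(3) in auto)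
qed

lemma conv2_add:
  assumes "conv2 a" "conv2 b" shows "conv2 (a + b)"
proof -
  obtain s A B where s: "s > 0" "A \<ge> 0" "B \<ge> (1::real)"
    "\<And>i. wbound s (A * B ^ i) (fps_nth a i)" "\<And>i. wbound s (A * B ^ i) (fps_nth b i)"
    by (rule conv2_bounds2[OF assms, of 1]) auto
  have "wbound s ((2 * A) * B ^ i) (fps_nth (a + b) i)" for i
    using wbound_add[OF s(4)[of i] s(5)[of i]] s(1) by (simp flip: mult_2 mult.assoc)
  then show ?thesis unfolding conv2_def using s(1) by blast
qed

lemma conv2_uminus: "conv2 a \<Longrightarrow> conv2 (- a)"
  unfolding conv2_def using wbound_uminus by (metis fps_neg_nth)

lemma conv2_diff: "conv2 a \<Longrightarrow> conv2 b \<Longrightarrow> conv2 (a - b)"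
  using conv2_add[of a "- b"] conv2_uminus by simp

lemma Suc_le_two_power: "real (Suc n) \<le> 2 ^ n"
proof -
  have "Suc n \<le> 2 ^ n" by (metis Suc_leI less_exp)
  then show ?thesis by (metis of_nat_le_iff of_nat_numeral of_nat_power)
qed

lemma conv2_mult:
  assumes "conv2 a" "conv2 b" shows "conv2 (a * b)"
proof -
  obtain s A B where s: "s > 0" "A \<ge> 0" "B \<ge> (1::real)"
    "\<And>i. wbound s (A * B ^ i) (fps_nth a i)" "\<And>i. wbound s (A * B ^ i) (fps_nth b i)"
    by (rule conv2_bounds2[OF assms, of 1]) auto
  have "wbound s ((A * A) * (2 * B) ^ i) (fps_nth (a * b) i)" for i
  proof -
    have "wbound s (\<Sum>l=0..i. (A * B ^ l) * (A * B ^ (i - l))) (fps_nth (a * b) i)"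
      unfolding fps_mult_nth using s by (intro wbound_sum wbound_mult) auto
    moreover have "(\<Sum>l=0..i. (A * B ^ l) * (A * B ^ (i - l))) = (\<Sum>l=0..i. A * A * B ^ i)"
      by (rule sum.cong) (auto simp: algebra_simps simp flip: power_add)
    moreover have "\<dots> = (A * A * B ^ i) * real (Suc i)" by simp
    ultimately have "wbound s ((A * A * B ^ i) * real (Suc i)) (fps_nth (a * b) i)" by metis
    \<comment> \<open>The \<open>i + 1\<close> terms of the convolution are absorbed by doubling the
      rate \<open>B\<close>.\<close>
    moreover have "(A * A * B ^ i) * real (Suc i) \<le> (A * A * B ^ i) * 2 ^ i"
      using s by (intro mult_left_mono Suc_le_two_power) auto
    ultimately have "wbound s ((A * A * B ^ i) * 2 ^ i) (fps_nth (a * b) i)" by (rule wbound_mono)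
    then show ?thesis by (simp add: power_mult_distrib mult_ac)
  qed
  then show ?thesis unfolding conv2_def using s(1) by blast
qed

lemma conv2_const: "conv1 c \<Longrightarrow> conv2 (fps_const c)"
proof -
  assume "conv1 c"
  then obtain s K where s: "s > 0" "wbound s K c" unfolding conv1_def by auto
  have "wbound s (K * 1 ^ i) (fps_nth (fps_const c) i)" for i
    using s wbound_mono[OF wbound_0, of K s] wbound_nonneg[OF s(2)] by auto
  then show ?thesis unfolding conv2_def using s by blast
qed

lemma conv1_simps [simp]: "conv1 0" "conv1 1" "conv1 (fps_const c)" "conv1 (fps_X ^ n)"
  unfolding conv1_iff_radius by auto

lemma conv2_0 [simp]: "conv2 0" and conv2_1 [simp]: "conv2 1"
  using conv2_const[of 0] conv2_const[of 1] by auto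

lemma conv2_sum: "(\<And>i. i \<in> I \<Longrightarrow> conv2 (a i)) \<Longrightarrow> conv2 (sum a I)"
  by (induction I rule: infinite_finite_induct) (auto intro: conv2_add)

lemma conv2_power: "conv2 a \<Longrightarrow> conv2 (a ^ n)"
  by (induction n) (auto intro: conv2_mult)

text \<open>Embeds the series in \<open>x\<close> alone, whereas \<open>fps_const\<close> embeds the
  series in \<open>y\<close> alone.\<close>

definition xser :: "complex fps \<Rightarrow> complex fps fps" where
  "xser c = Abs_fps (\<lambda>i. fps_const (fps_nth c i))"

lemma conv2_xser:
  assumes "conv1 c" shows "conv2 (xser c)"
proof -
  obtain s K where s: "s > 0" "wbound s K c" using assms unfolding conv1_def by auto
  have "wbound s (K * (1 / s) ^ i) (fps_nth (xser c) i)" for i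
  proof -
    have "norm (fps_nth c i) * s ^ i \<le> K" using wbound_nth[OF s(2)] s(1) by simp
    then have *: "norm (fps_nth c i) \<le> K * (1 / s) ^ i" using s(1) by (simp add: field_simps)
    have "(\<Sum>j\<le>n. norm (fps_nth (fps_const (fps_nth c i)) j) * s ^ j) = norm (fps_nth c i)" for n
      by (subst sum.remove[of _ 0]) (auto intro!: sum.neutral)
    then show ?thesis unfolding wbound_def xser_def using * by simp
  qed
  then show ?thesis unfolding conv2_def using s by blast
qed

lemma xser_add: "xser (a + b) = xser a + xser b"
  unfolding xser_def by (intro fps_ext) auto

lemma xser_mult: "xser (a * b) = xser a * xser b"
  unfolding xser_def
  by (rule fps_ext) (auto simp: fps_mult_nth fps_sum_nth intro!: fps_ext sum.cong)

lemma xser_0 [simp]: "xser 0 = 0" and xser_1 [simp]: "xser 1 = 1"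
  unfolding xser_def by (auto intro!: fps_ext)

lemma xser_X_power: "xser (fps_X ^ n) = fps_X ^ n"
  unfolding xser_def by (rule fps_ext) (simp add: fps_X_power_nth)

lemma conv2_X_power [simp]: "conv2 (fps_X ^ n)"
  using conv2_xser[of "fps_X ^ n"] by (simp add: xser_X_power)

lemma conv2_shift:
  assumes "conv2 a" shows "conv2 (fps_shift k a)"
proof -
  obtain s A B where s: "s > 0" "\<And>i. wbound s (A * B ^ i) (fps_nth a i)"
    using assms unfolding conv2_def by auto
  have "wbound s ((A * B ^ k) * B ^ i) (fps_nth (fps_shift k a) i)" for i
    using s(2)[of "i + k"] by (simp add: power_add mult_ac)
  then show ?thesis unfolding conv2_def using s by blast
qed

lemma conv2_nth: "conv2 a \<Longrightarrow> conv1 (fps_nth a i)"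
  unfolding conv2_def conv1_def by auto

text \<open>Comparing the coefficients of x^i in h = q F + r determines the i-th coefficients of q and r
  from the earlier ones. This recursion also shows how they depend on parameters in F and h.\<close>

fun wq :: "nat \<Rightarrow> complex fps fps \<Rightarrow> complex fps fps \<Rightarrow> nat \<Rightarrow> complex fps" where
  "wq d F h i = fps_shift d (fps_nth h i - (\<Sum>l<i. wq d F h l * fps_nth F (i - l)))
      * inverse (fps_shift d (fps_nth F 0))"

declare wq.simps [simp del]

definition wquot :: "nat \<Rightarrow> complex fps fps \<Rightarrow> complex fps fps \<Rightarrow> complex fps fps" where
  "wquot d F h = Abs_fps (wq d F h)"

definition wrem :: "nat \<Rightarrow> complex fps fps \<Rightarrow> complex fps fps \<Rightarrow> complex fps fps" where
  "wrem d F h = Abs_fps (\<lambda>i. fps_cutoff d (fps_nth h i - (\<Sum>l<i. wq d F h l * fps_nth F (i - l))))"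

text \<open>\<open>fps_nth F 0\<close> is the restriction of \<open>F\<close> to the line x = 0, so
  this is Weierstrass regularity in y of order exactly \<open>d\<close>.\<close>

definition yreg :: "nat \<Rightarrow> complex fps fps \<Rightarrow> bool" where
  "yreg d F \<longleftrightarrow> fps_nth F 0 \<noteq> 0 \<and> subdegree (fps_nth F 0) = d"

lemma wrem_nth_ge: "d \<le> j \<Longrightarrow> fps_nth (fps_nth (wrem d F h) i) j = 0"
  unfolding wrem_def by simp

text \<open>For each power of x, what is left of \<open>h\<close> splits at y^d: the lower part is
  the remainder, and the upper part is divided by F(0, y), which is y^d times the unit
  \<open>?u\<close>.\<close>

lemma weierstrass_division:
  assumes "yreg d F"
  shows "h = wquot d F h * F + wrem d F h"
proof (rule fps_ext)
  fix i
  let ?u = "fps_shift d (fps_nth F 0)" and ?E = "fps_nth h i - (\<Sum>l<i. wq d F h l * fps_nth F (i - l))"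
  have F0: "fps_nth F 0 = ?u * fps_X ^ d"
    using assms subdegree_decompose[of "fps_nth F 0"] unfolding yreg_def by simp
  have u0: "fps_nth ?u 0 \<noteq> 0" using assms unfolding yreg_def by auto
  have "fps_nth (wquot d F h * F) i = (\<Sum>l<Suc i. wq d F h l * fps_nth F (i - l))"
    unfolding fps_mult_nth wquot_def by (simp add: atLeast0AtMost lessThan_Suc_atMost)
  also have "\<dots> = (\<Sum>l<i. wq d F h l * fps_nth F (i - l)) + wq d F h i * fps_nth F 0"
    by simp
  also have "wq d F h i * fps_nth F 0 = (fps_shift d ?E * fps_X ^ d) * (inverse ?u * ?u)"
    by (subst F0, subst wq.simps) (simp only: mult_ac)
  also have "inverse ?u * ?u = 1" using u0 by (rule inverse_mult_eq_1)
  finally have "fps_nth (wquot d F h * F + wrem d F h) i =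
     (\<Sum>l<i. wq d F h l * fps_nth F (i - l)) + (fps_shift d ?E * fps_X ^ d + fps_cutoff d ?E)"
    unfolding wrem_def by simp
  also have "fps_shift d ?E * fps_X ^ d + fps_cutoff d ?E = ?E"
    by (simp add: fps_shift_cutoff)
  finally show "fps_nth h i = fps_nth (wquot d F h * F + wrem d F h) i" by simp
qed

lemma conv2_wquot_wrem:
  assumes F: "yreg d F" and cF: "conv2 F" and ch: "conv2 h"
  shows "conv2 (wquot d F h) \<and> conv2 (wrem d F h)"
proof -
  let ?u = "fps_shift d (fps_nth F 0)"
  let ?E = "\<lambda>i. fps_nth h i - (\<Sum>l<i. wq d F h l * fps_nth F (i - l))"
  have "fps_nth ?u 0 \<noteq> 0" using F unfolding yreg_def by auto
  then have "conv1 (inverse ?u)" by (intro conv1_inverse conv1_shift conv2_nth cF)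
  then obtain t U where t: "t > 0" "wbound t U (inverse ?u)" unfolding conv1_def by auto
  obtain s A B where s: "s > 0" "s \<le> t" "A \<ge> 0" "B \<ge> (1::real)"
    "\<And>i. wbound s (A * B ^ i) (fps_nth F i)" "\<And>i. wbound s (A * B ^ i) (fps_nth h i)"
    by (rule conv2_bounds2[OF cF ch t(1)]) auto
  have U: "wbound s U (inverse ?u)" using wbound_antimono[OF t(2)] s by auto
  \<comment> \<open>One step of the recursion costs \<open>U\<close> for the inverted unit and
    \<open>1 / s ^ d\<close> for the shift, and earlier quotients enter with the factor
    \<open>A\<close> from \<open>F\<close>.\<close>
  define T where "T = U * A / s ^ d"
  have T: "T \<ge> 0" using wbound_nonneg[OF U] s unfolding T_def by auto
  \<comment> \<open>This identity closes the recursive estimate: at the rate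
    \<open>B * (1 + T)\<close> the contribution of \<open>h\<close> and those of all earlier
    quotients add up to exactly the bound wanted at index \<open>i\<close>.\<close>
  have geo: "1 + T * (\<Sum>l<i. (1 + T) ^ l) = (1 + T) ^ i" for i
    by (induction i) (auto simp: algebra_simps)
  have E: "wbound s (A * (B * (1 + T)) ^ i) (?E i)"
    if "\<And>l. l < i \<Longrightarrow> wbound s (T * (B * (1 + T)) ^ l) (wq d F h l)" for i
  proof -
    have "wbound s (A * B ^ i + (\<Sum>l<i. (T * (B * (1 + T)) ^ l) * (A * B ^ (i - l)))) (?E i)"
      using s that by (intro wbound_diff wbound_sum wbound_mult) auto
    moreover have "(\<Sum>l<i. (T * (B * (1 + T)) ^ l) * (A * B ^ (i - l))) = (\<Sum>l<i. A * B ^ i * (T * (1 + T) ^ l))"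
    proof (rule sum.cong)
      fix l assume "l \<in> {..<i}"
      then have "B ^ i = B ^ l * B ^ (i - l)" by (simp flip: power_add)
      then show "(T * (B * (1 + T)) ^ l) * (A * B ^ (i - l)) = A * B ^ i * (T * (1 + T) ^ l)"
        by (simp add: power_mult_distrib mult_ac)
    qed simp
    moreover have "A * B ^ i + \<dots> = A * B ^ i * (1 + T * (\<Sum>l<i. (1 + T) ^ l))"
      by (simp add: sum_distrib_left algebra_simps)
    ultimately show ?thesis unfolding geo by (simp add: power_mult_distrib mult_ac)
  qed
  have q: "wbound s (T * (B * (1 + T)) ^ i) (wq d F h i)" for i
  proof (induction i rule: less_induct)
    case (less i)
    have "wbound s ((A * (B * (1 + T)) ^ i) / s ^ d * U) (wq d F h i)"
      by (subst wq.simps) (intro wbound_mult wbound_shift E less U; use s in simp)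
    then show ?case unfolding T_def by (simp add: mult_ac)
  qed
  have r: "wbound s (A * (B * (1 + T)) ^ i) (fps_nth (wrem d F h) i)" for i
    unfolding wrem_def fps_nth_Abs_fps using s by (intro wbound_cutoff E q) auto
  show ?thesis unfolding conv2_def wquot_def using q r s(1) by (metis fps_nth_Abs_fps)
qed

text \<open>Uniqueness of Weierstrass division. The lowest x-coefficient of \<open>F * m\<close> has
  F(0, y) as a factor, hence order at least \<open>d\<close> in y, which the cutoff
  excludes.\<close>

lemma yreg_mult_eq_cutoff:
  assumes F: "yreg d F" and cut: "\<And>i j. d \<le> j \<Longrightarrow> fps_nth (fps_nth (F * m) i) j = 0"
  shows "m = 0"
proof (rule ccontr)
  assume "m \<noteq> 0"
  define k where "k = subdegree m"
  have mk: "fps_nth m k \<noteq> 0" using \<open>m \<noteq> 0\<close> unfolding k_def by simp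
  have "fps_nth (F * m) k = fps_nth F 0 * fps_nth m k"
    unfolding fps_mult_nth
    by (subst sum.remove[of _ 0]) (auto simp: k_def intro!: sum.neutral nth_less_subdegree_zero)
  moreover have "fps_nth F 0 * fps_nth m k \<noteq> 0" using F mk unfolding yreg_def by simp
  ultimately have "fps_nth (fps_nth (F * m) k) (subdegree (fps_nth (F * m) k)) \<noteq> 0"
    "subdegree (fps_nth (F * m) k) \<ge> d"
    using F mk unfolding yreg_def by auto
  then show False using cut by blast
qed

text \<open>By uniqueness of division, a formal quotient by a regular series is the Weierstrass
  quotient, which converges. Divisibility can thus be argued among formal series, which form an
  integral domain.\<close>

lemma conv2_quotient:
  assumes F: "yreg d F" "conv2 F" and c: "conv2 (F * m)"
  shows "conv2 m"
proof -
  have "F * m = wquot d F (F * m) * F + wrem d F (F * m)"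
    using weierstrass_division[OF F(1)] .
  then have "F * (m - wquot d F (F * m)) = wrem d F (F * m)" by (simp add: algebra_simps)
  then have "m - wquot d F (F * m) = 0"
    using yreg_mult_eq_cutoff[OF F(1), of "m - wquot d F (F * m)"] wrem_nth_ge by simp
  then show ?thesis using conv2_wquot_wrem[OF F c] by simp
qed

text \<open>A unit is regular of order 0, where division leaves no remainder; its inverse is the
  quotient of 1.\<close>

lemma conv2_inverse_ex:
  assumes "conv2 v" "fps_nth (fps_nth v 0) 0 \<noteq> 0"
  obtains w where "conv2 w" "w * v = 1"
proof -
  have v: "yreg 0 v" using assms(2) unfolding yreg_def by (auto simp: subdegree_eq_0_iff)
  have "wrem 0 v 1 = 0" unfolding wrem_def by (intro fps_ext) simp
  then show thesis
    using that[of "wquot 0 v 1"] conv2_wquot_wrem[OF v assms(1), of 1] weierstrass_division[OF v, of 1]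
    by simp
qed

section \<open>Common factors and the characteristic polynomial\<close>

definition cdvd :: "complex fps fps \<Rightarrow> complex fps fps \<Rightarrow> bool" where
  "cdvd a b \<longleftrightarrow> (\<exists>c. conv2 c \<and> b = a * c)"

text \<open>Removing the largest power of x from \<open>r\<close> makes it regular in y, of order
  below \<open>e\<close> because no y^j with j at least \<open>e\<close> occurs. The same power of x
  cancels from \<open>a\<close>, since a regular \<open>f\<close> is not divisible by x.\<close>

lemma cut_syzygy:
  assumes f: "yreg d f" and r: "r \<noteq> 0" "conv2 r" "\<And>i j. e \<le> j \<Longrightarrow> fps_nth (fps_nth r i) j = 0"
    and eq: "G * r = f * a"
  shows "\<exists>h b. conv2 h \<and> fps_nth h 0 \<noteq> 0 \<and> subdegree (fps_nth h 0) < e \<and> G * h = f * b"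
proof -
  define k where "k = subdegree r"
  define h where "h = fps_shift k r"
  have rh: "r = h * fps_X ^ k" using fps_shift_times_fps_X_power[of k r] unfolding h_def k_def by simp
  have h0: "fps_nth h 0 \<noteq> 0" using r(1) unfolding h_def k_def by simp
  have "fps_nth (fps_nth h 0) (subdegree (fps_nth h 0)) \<noteq> 0" using h0 by simp
  then have lt: "subdegree (fps_nth h 0) < e" using r(3)[of "subdegree (fps_nth h 0)" k]
    unfolding h_def by (metis add.left_neutral fps_shift_nth not_le)
  have f0: "f \<noteq> 0" "subdegree f = 0" using f unfolding yreg_def by (auto simp: subdegree_eq_0_iff)
  have "a = fps_shift k a * fps_X ^ k"
  proof (cases "a = 0")
    case False
    have "(G * h) * fps_X ^ k = f * a" using eq rh by (simp add: mult_ac)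
    then have "subdegree ((G * h) * fps_X ^ k) = subdegree a" and "G * h \<noteq> 0"
      using False f0 by auto
    then have "k \<le> subdegree a" by simp
    then show ?thesis using fps_shift_times_fps_X_power[of k a] by simp
  qed auto
  then have "(G * h) * fps_X ^ k = (f * fps_shift k a) * fps_X ^ k"
    using eq rh by (simp add: mult_ac)
  then have "G * h = f * fps_shift k a" by simp
  then show ?thesis using h0 lt conv2_shift[OF r(2), of k] unfolding h_def by blast
qed

text \<open>Euclid's lemma without unique factorisation: among the y-regular h with f dividing G * h,
  one of minimal y-order divides f, and the cofactor also divides G.\<close>

lemma common_factor_if_not_euclid:
  assumes f: "yreg d f" "conv2 f" and G: "conv2 G" and u: "conv2 u" "cdvd f (G * u)" "\<not> cdvd f u"
  shows "\<exists>q. conv2 q \<and> cdvd q f \<and> cdvd q G \<and> fps_nth (fps_nth q 0) 0 = 0"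
proof -
  \<comment> \<open>The y-regular members of the ideal quotient (f : G). The cofactor is left formal
    here; its convergence is recovered through \<open>conv2_quotient\<close>.\<close>
  define J where "J = {h. conv2 h \<and> fps_nth h 0 \<noteq> 0 \<and> (\<exists>b. G * h = f * b)}"
  have reduce: "\<exists>h'\<in>J. subdegree (fps_nth h' 0) < e"
    if h: "conv2 h" "yreg e h" "G * h = f * b" and v: "conv2 v" "G * v = f * c" "wrem e h v \<noteq> 0" for h e b v c
  proof -
    have "v = wquot e h v * h + wrem e h v" using weierstrass_division[OF h(2)] .
    then have "wrem e h v = v - wquot e h v * h" by (metis add_diff_cancel_left')
    then have "G * wrem e h v = G * v - wquot e h v * (G * h)"
      by (simp only: right_diff_distrib mult_ac)
    also have "\<dots> = f * (c - wquot e h v * b)" unfolding h(3) v(2) by (simp add: algebra_simps)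
    finally have *: "G * wrem e h v = f * (c - wquot e h v * b)" .
    show ?thesis
      using cut_syzygy[OF f(1) v(3) _ wrem_nth_ge *] conv2_wquot_wrem[OF h(2,1) v(1)]
      unfolding J_def by blast
  qed
  obtain a where a: "G * u = f * a" using u(2) unfolding cdvd_def by auto
  have "wrem d f u \<noteq> 0"
  proof
    assume "wrem d f u = 0"
    then have "u = f * wquot d f u" using weierstrass_division[OF f(1), of u] by (simp add: mult.commute)
    then show False using u(3) conv2_wquot_wrem[OF f u(1)] unfolding cdvd_def by blast
  qed
  \<comment> \<open>Reducing \<open>u\<close> modulo \<open>f\<close>, itself in the ideal quotient,
    gives a member of order strictly below \<open>d\<close>. This strict inequality is what finally
    makes \<open>q\<close> a nonunit.\<close>
  then obtain h0 where h0: "h0 \<in> J" "subdegree (fps_nth h0 0) < d"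
    using reduce[OF f(2,1) _ u(1) a, of G] by (metis mult.commute)
  obtain h where h: "h \<in> J" "\<And>h'. h' \<in> J \<Longrightarrow> subdegree (fps_nth h 0) \<le> subdegree (fps_nth h' 0)"
    using ex_has_least_nat[of "\<lambda>h. h \<in> J" h0 "\<lambda>h. subdegree (fps_nth h 0)"] h0 by blast
  define e where "e = subdegree (fps_nth h 0)"
  have he: "yreg e h" "conv2 h" using h(1) unfolding yreg_def e_def J_def by auto
  obtain b where b: "G * h = f * b" using h(1) unfolding J_def by auto
  \<comment> \<open>\<open>f\<close> lies in the ideal quotient, so a nonzero remainder modulo
    \<open>h\<close> would contradict the minimality of \<open>h\<close>.\<close>
  have "wrem e h f = 0"
  proof (rule ccontr)
    assume "wrem e h f \<noteq> 0"
    then obtain h' where "h' \<in> J" "subdegree (fps_nth h' 0) < e"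
      using reduce[OF he(2,1) b f(2), of G] by (metis mult.commute)
    then show False using h(2) unfolding e_def by (meson not_le)
  qed
  define q where "q = wquot e h f"
  have fq: "f = q * h" using weierstrass_division[OF he(1), of f] \<open>wrem e h f = 0\<close> unfolding q_def by simp
  have h_nz: "h \<noteq> 0" using he(1) unfolding yreg_def by auto
  have "h * G = h * (q * b)" using b fq by (simp add: mult_ac)
  then have Gq: "G = q * b" using h_nz by simp
  have cq: "conv2 q" unfolding q_def using conv2_wquot_wrem[OF he f(2)] by simp
  have "conv2 (f * b)" using conv2_mult[OF G he(2)] b by simp
  then have cb: "conv2 b" using conv2_quotient[OF f] by blast
  have "fps_nth f 0 = fps_nth q 0 * fps_nth h 0" unfolding fq by simp
  then have "d = subdegree (fps_nth q 0) + e" and "fps_nth q 0 \<noteq> 0"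
    using f(1) unfolding yreg_def e_def by auto
  moreover have "e < d" using h(2)[OF h0(1)] h0(2) unfolding e_def by simp
  ultimately have "fps_nth (fps_nth q 0) 0 = 0" by auto
  then show ?thesis using cq cb fq Gq he(2) unfolding cdvd_def by blast
qed

text \<open>A nonunit common factor of least y-order is irreducible: a product of two nonunits would
  split that order into two positive summands. This takes the place of a factorisation into
  primes.\<close>

lemma irreducible_common_factor:
  assumes f: "yreg d f" and q: "conv2 q" "cdvd q f" "cdvd q G" "fps_nth (fps_nth q 0) 0 = 0"
  obtains p where "conv2 p" "cdvd p f" "cdvd p G" "fps_nth (fps_nth p 0) 0 = 0" "p \<noteq> 0"
    "\<And>a b. conv2 a \<Longrightarrow> conv2 b \<Longrightarrow> p = a * b \<Longrightarrow> fps_nth (fps_nth a 0) 0 \<noteq> 0 \<or> fps_nth (fps_nth b 0) 0 \<noteq> 0"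
proof -
  define S where "S = {p. conv2 p \<and> cdvd p f \<and> cdvd p G \<and> fps_nth (fps_nth p 0) 0 = 0}"
  obtain p where p: "p \<in> S" "\<And>p'. p' \<in> S \<Longrightarrow> subdegree (fps_nth p 0) \<le> subdegree (fps_nth p' 0)"
    using ex_has_least_nat[of "\<lambda>h. h \<in> S" q "\<lambda>h. subdegree (fps_nth h 0)"] q unfolding S_def by auto
  obtain c where c: "f = p * c" using p(1) unfolding S_def cdvd_def by auto
  have p0: "fps_nth p 0 \<noteq> 0" using f unfolding c yreg_def by auto
  show thesis
  proof (rule that[of p])
    fix a b assume ab: "conv2 a" "conv2 b" "p = a * b"
    show "fps_nth (fps_nth a 0) 0 \<noteq> 0 \<or> fps_nth (fps_nth b 0) 0 \<noteq> 0"
    proof (rule ccontr)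
      assume "\<not> ?thesis"
      then have z: "fps_nth (fps_nth a 0) 0 = 0" "fps_nth (fps_nth b 0) 0 = 0" by auto
      have p0ab: "fps_nth p 0 = fps_nth a 0 * fps_nth b 0" unfolding ab(3) by simp
      then have nz: "fps_nth a 0 \<noteq> 0" "fps_nth b 0 \<noteq> 0" using p0 by auto
      have "cdvd a f" "cdvd a G"
        using p(1) ab unfolding S_def cdvd_def by (auto simp: mult.assoc intro: conv2_mult)
      then have "a \<in> S" using ab z unfolding S_def by auto
      then have "subdegree (fps_nth p 0) \<le> subdegree (fps_nth a 0)" by (rule p(2))
      moreover have "subdegree (fps_nth p 0) = subdegree (fps_nth a 0) + subdegree (fps_nth b 0)"
        using p0ab nz by simp
      ultimately have "subdegree (fps_nth b 0) = 0" by simp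
      then show False using z(2) nz(2) by (simp add: subdegree_eq_0_iff)
    qed
  qed (use p(1) p0 in \<open>auto simp: S_def\<close>)
qed

lemma cdvd_power_cancel:
  assumes f: "yreg d f" "conv2 f" and G: "conv2 G" and u: "conv2 u" "cdvd f (G ^ n * u)"
    and cop: "\<And>q. conv2 q \<Longrightarrow> cdvd q f \<Longrightarrow> cdvd q G \<Longrightarrow> fps_nth (fps_nth q 0) 0 \<noteq> 0"
  shows "cdvd f u"
  using u(2)
proof (induction n)
  case (Suc n)
  have "cdvd f (G * (G ^ n * u))" using Suc.prems by (simp add: mult.assoc)
  then have "cdvd f (G ^ n * u)"
    using common_factor_if_not_euclid[OF f G conv2_mult[OF conv2_power[OF G] u(1)]] cop by blast
  then show ?case by (rule Suc.IH)
qed simp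

section \<open>Multiplication by G on the series modulo F\<close>

definition ycoeff :: "nat \<Rightarrow> complex fps fps \<Rightarrow> complex fps" where
  "ycoeff j r = Abs_fps (\<lambda>i. fps_nth (fps_nth r i) j)"

lemma conv1_ycoeff:
  assumes "conv2 r" shows "conv1 (ycoeff j r)"
proof -
  obtain s A B where s: "s > 0" "A \<ge> 0" "B \<ge> (1::real)" "\<And>i. wbound s (A * B ^ i) (fps_nth r i)"
    by (rule conv2_bounds2[OF assms assms, of 1]) auto
  have "wbound (1 / (2 * B)) (2 * (A / s ^ j)) (ycoeff j r)"
  proof (rule wbound_geometric[where B = B])
    fix i
    have "norm (fps_nth (fps_nth r i) j) * s ^ j \<le> A * B ^ i"
      using wbound_nth[OF s(4)] s(1) by simp
    then show "norm (fps_nth (ycoeff j r) i) \<le> A / s ^ j * B ^ i"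
      using s(1) unfolding ycoeff_def by (simp add: field_simps)
  qed (use s in auto)
  then show ?thesis unfolding conv1_def using s
    by (intro exI[of _ "1 / (2 * B)"]) (auto intro!: divide_pos_pos)
qed

lemma ycoeff_expand:
  assumes "\<And>i j. d \<le> j \<Longrightarrow> fps_nth (fps_nth r i) j = 0"
  shows "r = (\<Sum>j<d. xser (ycoeff j r) * fps_const (fps_X ^ j))"
proof (intro fps_ext)
  fix i n
  have "fps_nth (fps_nth (\<Sum>j<d. xser (ycoeff j r) * fps_const (fps_X ^ j)) i) n
      = (\<Sum>j<d. if j = n then fps_nth (fps_nth r i) n else 0)"
    unfolding fps_sum_nth xser_def ycoeff_def
    by (rule sum.cong) (auto simp: fps_X_power_nth)
  also have "\<dots> = fps_nth (fps_nth r i) n" using assms by auto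
  finally show "fps_nth (fps_nth r i) n
      = fps_nth (fps_nth (\<Sum>j<d. xser (ycoeff j r) * fps_const (fps_X ^ j)) i) n" by simp
qed

text \<open>Matrix of multiplication by G on the free module O/(F) over the series in x, with respect to
  the basis of powers of y.\<close>

definition mult_mat :: "nat \<Rightarrow> complex fps fps \<Rightarrow> complex fps fps \<Rightarrow> complex fps mat" where
  "mult_mat d F G = mat d d (\<lambda>(i, j). ycoeff j (wrem d F (G * fps_const (fps_X ^ i))))"

definition mult_cp :: "nat \<Rightarrow> complex fps fps \<Rightarrow> complex fps fps \<Rightarrow> complex fps poly" where
  "mult_cp d F G = char_poly (mult_mat d F G)"

text \<open>A property of indexed families that is closed under the ring operations. It is used with
  convergence (over a one-point index) and with polynomial dependence on parameters, so that one
  passage through the determinant serves both.\<close>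

definition fam_ring :: "(('l \<Rightarrow> 'a::comm_ring_1) \<Rightarrow> bool) \<Rightarrow> bool" where
  "fam_ring P \<longleftrightarrow> P (\<lambda>_. 0) \<and> P (\<lambda>_. 1) \<and> (\<forall>a. P a \<longrightarrow> P (\<lambda>l. - a l))
     \<and> (\<forall>a b. P a \<longrightarrow> P b \<longrightarrow> P (\<lambda>l. a l + b l)) \<and> (\<forall>a b. P a \<longrightarrow> P b \<longrightarrow> P (\<lambda>l. a l * b l))"

lemma fam_ringD:
  assumes "fam_ring P"
  shows "P (\<lambda>_. 0)" "P (\<lambda>_. 1)" "P a \<Longrightarrow> P (\<lambda>l. - a l)" "P a \<Longrightarrow> P b \<Longrightarrow> P (\<lambda>l. a l + b l)"
    "P a \<Longrightarrow> P b \<Longrightarrow> P (\<lambda>l. a l * b l)"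
  using assms unfolding fam_ring_def by auto

lemma fam_ring_sum: "fam_ring P \<Longrightarrow> (\<And>i. i \<in> I \<Longrightarrow> P (a i)) \<Longrightarrow> P (\<lambda>l. \<Sum>i\<in>I. a i l)"
  by (induction I rule: infinite_finite_induct) (auto intro: fam_ringD)

lemma fam_ring_prod: "fam_ring P \<Longrightarrow> (\<And>i. i \<in> I \<Longrightarrow> P (a i)) \<Longrightarrow> P (\<lambda>l. \<Prod>i\<in>I. a i l)"
  by (induction I rule: infinite_finite_induct) (auto intro: fam_ringD)

lemma fam_ring_poly:
  assumes P: "fam_ring P"
  shows "fam_ring (\<lambda>p. \<forall>k. P (\<lambda>l. coeff (p l) k))"
  unfolding fam_ring_def[of "\<lambda>p. \<forall>k. P (\<lambda>l. coeff (p l) k)"]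
  using fam_ringD[OF P] by (auto simp: coeff_mult coeff_1 intro!: fam_ring_sum[OF P])

text \<open>Leibniz's formula writes each coefficient as a ring expression in the matrix
  entries.\<close>

lemma fam_ring_char_poly:
  assumes P: "fam_ring P" and A: "\<And>i j. i < d \<Longrightarrow> j < d \<Longrightarrow> P (\<lambda>l. A l i j)"
  shows "P (\<lambda>l. coeff (char_poly (mat d d (\<lambda>(i, j). A l i j))) k)"
proof -
  define Q where "Q = (\<lambda>p. \<forall>k. P (\<lambda>l. coeff (p l) k))"
  have Q: "fam_ring Q" unfolding Q_def by (rule fam_ring_poly[OF P])
  have entry: "Q (\<lambda>l. char_poly_matrix (mat d d (\<lambda>(i, j). A l i j)) $$ (i, j))" if "i < d" "j < d" for i j
  proof -
    have eq: "(\<lambda>l. char_poly_matrix (mat d d (\<lambda>(i, j). A l i j)) $$ (i, j))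
        = (\<lambda>l. (if i = j then [:0, 1:] else 0) + [:- A l i j:])"
      using that by (auto simp: char_poly_matrix_def)
    have "Q (\<lambda>l. if i = j then [:0, 1:] else 0)" "Q (\<lambda>l. [:- A l i j:])"
      unfolding Q_def
    proof (safe)
      fix k
      show "P (\<lambda>l. coeff (if i = j then [:0, 1:] else 0) k)"
        using fam_ringD[OF P] by (cases k; cases "k - 1") auto
      show "P (\<lambda>l. coeff [:- A l i j:] k)"
        using fam_ringD[OF P] A[OF that] by (cases k) auto
    qed
    then show ?thesis unfolding eq by (rule fam_ringD(4)[OF Q])
  qed
  have sg: "Q (\<lambda>l. signof p)" for p :: "nat \<Rightarrow> nat"
    using fam_ringD(2)[OF Q] fam_ringD(3)[OF Q fam_ringD(2)[OF Q]] by (auto simp: sign_def)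
  have "Q (\<lambda>l. char_poly (mat d d (\<lambda>(i, j). A l i j)))"
    unfolding char_poly_def
    by (subst det_def'[of _ d], simp)
       (intro fam_ring_sum[OF Q] fam_ring_prod[OF Q] fam_ringD(5)[OF Q] sg entry, auto simp: permutes_in_image)
  then show ?thesis unfolding Q_def by simp
qed

lemma conv1_mult_cp:
  assumes "yreg d F" "conv2 F" "conv2 G"
  shows "conv1 (coeff (mult_cp d F G) k)"
proof -
  have "fam_ring (\<lambda>a. conv1 (a ()))"
    unfolding fam_ring_def by (auto intro: conv1_add conv1_mult conv1_uminus)
  note fam_ring_char_poly[OF this, of d "\<lambda>_ i j. ycoeff j (wrem d F (G * fps_const (fps_X ^ i)))" k]
  moreover have "conv1 (ycoeff j (wrem d F (G * fps_const (fps_X ^ i))))" for i j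
    using conv2_wquot_wrem[OF assms(1,2)] conv2_mult[OF assms(3) conv2_const] by (auto intro: conv1_ycoeff)
  ultimately show ?thesis unfolding mult_cp_def mult_mat_def by blast
qed

interpretation xser: comm_ring_hom xser
  by unfold_locales (auto simp: xser_add xser_mult)

text \<open>The determinant trick. \<open>N\<close> is G times the identity minus the multiplication
  matrix, and it sends the column of powers of y to multiples of F. Applying row 0 of the adjugate
  leaves det N times y^0 = 1, again a multiple of F; \<open>d > 0\<close> provides this row.\<close>

lemma cayley_hamilton_mod:
  assumes F: "yreg d F" and d: "d > 0"
  shows "\<exists>Q. poly (map_poly xser (mult_cp d F G)) G = F * Q"
proof -
  define A where "A = map_mat xser (mult_mat d F G)"
  define N where "N = map_mat (\<lambda>p. poly p G) (char_poly_matrix A)"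
  have A: "A \<in> carrier_mat d d" unfolding A_def mult_mat_def by auto
  have N: "N \<in> carrier_mat d d" unfolding N_def using A by auto
  have "poly (map_poly xser (mult_cp d F G)) G = poly (char_poly A) G"
    unfolding A_def mult_cp_def by (subst xser.char_poly_hom[of _ d]) (auto simp: mult_mat_def)
  also have "\<dots> = det N" unfolding N_def char_poly_def by (rule comm_ring_hom.hom_det[OF poly_hom.comm_ring_hom_axioms, symmetric])
  finally have 1: "poly (map_poly xser (mult_cp d F G)) G = det N" .
  define w where "w = (\<lambda>i. wquot d F (G * fps_const (fps_X ^ i)))"
  let ?y = "\<lambda>j. fps_const (fps_X ^ j) :: complex fps fps"
  have row: "(\<Sum>j<d. N $$ (i, j) * ?y j) = F * w i" if i: "i < d" for i
  proof -
    have "(\<Sum>j<d. N $$ (i, j) * ?y j)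
        = (\<Sum>j<d. (if i = j then G * ?y j else 0) - xser (ycoeff j (wrem d F (G * ?y i))) * ?y j)"
      using i by (intro sum.cong)
        (auto simp: N_def A_def mult_mat_def char_poly_matrix_def algebra_simps)
    also have "\<dots> = G * ?y i - wrem d F (G * ?y i)"
      using i ycoeff_expand[of d "wrem d F (G * ?y i)", OF wrem_nth_ge] by (simp add: sum_subtractf)
    also have "\<dots> = F * w i" unfolding w_def
      using weierstrass_division[OF F, of "G * ?y i"] by (simp add: algebra_simps)
    finally show ?thesis .
  qed
  have adj: "(\<Sum>i<d. adj_mat N $$ (0, i) * N $$ (i, j)) = (if j = 0 then det N else 0)" if j: "j < d" for j
  proof -
    have "(adj_mat N * N) $$ (0, j) = (\<Sum>i = 0..<d. adj_mat N $$ (0, i) * N $$ (i, j))"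
      using N adj_mat(1)[OF N] j d by (auto simp: scalar_prod_def intro!: sum.cong)
    moreover have "(adj_mat N * N) $$ (0, j) = (if j = 0 then det N else 0)"
      unfolding adj_mat(3)[OF N] using j d by auto
    ultimately show ?thesis by (simp add: atLeast0LessThan)
  qed
  have "det N = (\<Sum>j<d. (if j = 0 then det N else 0) * ?y j)"
    using d by (subst sum.remove[of _ 0]) (auto intro!: sum.neutral)
  also have "\<dots> = (\<Sum>j<d. (\<Sum>i<d. adj_mat N $$ (0, i) * N $$ (i, j)) * ?y j)"
    using adj by (intro sum.cong) auto
  also have "\<dots> = (\<Sum>i<d. adj_mat N $$ (0, i) * (\<Sum>j<d. N $$ (i, j) * ?y j))"
    unfolding sum_distrib_left sum_distrib_right by (subst sum.swap) (simp add: mult.assoc)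
  also have "\<dots> = (\<Sum>i<d. adj_mat N $$ (0, i) * (F * w i))"
    using row by (intro sum.cong) auto
  also have "\<dots> = F * (\<Sum>i<d. adj_mat N $$ (0, i) * w i)"
    unfolding sum_distrib_left by (simp add: mult_ac)
  finally show ?thesis unfolding 1 by blast
qed

section \<open>A power of x in the ideal and the spanning monomials\<close>

lemma X_power_in_ideal:
  assumes F: "yreg d F" and conv: "conv2 f" "conv2 e" "conv2 G" and Fe: "F = e * f"
    and cop: "\<And>q. conv2 q \<Longrightarrow> cdvd q f \<Longrightarrow> cdvd q G \<Longrightarrow> fps_nth (fps_nth q 0) 0 \<noteq> 0"
    and M: "\<And>k. coeff (mult_cp d F G) k \<noteq> 0 \<Longrightarrow> subdegree (coeff (mult_cp d F G) k) \<le> M"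
  shows "\<exists>a b. conv2 a \<and> conv2 b \<and> fps_X ^ M = a * f + b * G"
proof (cases "d = 0")
  case True
  have cF: "conv2 F" unfolding Fe using conv by (intro conv2_mult)
  have "fps_nth (fps_nth F 0) 0 \<noteq> 0" using F True unfolding yreg_def by (auto simp: subdegree_eq_0_iff)
  then obtain w where w: "conv2 w" "w * F = 1" using conv2_inverse_ex[OF cF] by blast
  have "fps_X ^ M = fps_X ^ M * (w * F)" unfolding w(2) by simp
  also have "\<dots> = (fps_X ^ M * w * e) * f + 0 * G" unfolding Fe by (simp add: mult_ac)
  finally have "fps_X ^ M = (fps_X ^ M * w * e) * f + 0 * G" .
  moreover have "conv2 (fps_X ^ M * w * e)" using w conv by (intro conv2_mult) auto
  ultimately show ?thesis using conv2_0 by blast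
next
  case False
  define c where "c = coeff (mult_cp d F G)"
  have cF: "conv2 F" unfolding Fe using conv by (intro conv2_mult)
  have cc: "conv1 (c k)" for k unfolding c_def by (rule conv1_mult_cp[OF F cF conv(3)])
  have mm: "mult_mat d F G \<in> carrier_mat d d" unfolding mult_mat_def by auto
  have deg: "degree (mult_cp d F G) = d" "c d = 1"
    unfolding c_def mult_cp_def using degree_monic_char_poly[OF mm] by auto
  \<comment> \<open>Coefficient 0 is, up to sign, the determinant of multiplication by G, and it
    vanishes if F and G have a nonunit common factor. A nonzero coefficient exists in any case
    because the polynomial is monic.\<close>
  define l where "l = (LEAST k. c k \<noteq> 0)"
  have cl: "c l \<noteq> 0" unfolding l_def using deg(2) by (metis (mono_tags) LeastI zero_neq_one)
  have lo: "c k = 0" if "k < l" for k using not_less_Least that unfolding l_def by blast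
  have ld: "l \<le> d" using deg(2) lo[of d] by (metis not_le zero_neq_one)
  define T where "T = (\<Sum>k\<in>{Suc l..d}. xser (c k) * G ^ (k - Suc l))"
  have cT: "conv2 T" unfolding T_def
    using conv cc by (intro conv2_sum conv2_mult conv2_xser conv2_power) auto
  obtain Q where Q: "poly (map_poly xser (mult_cp d F G)) G = F * Q"
    using cayley_hamilton_mod[OF F] False by blast
  define P where "P = map_poly xser (mult_cp d F G)"
  have cP: "coeff P k = xser (c k)" for k unfolding P_def c_def by simp
  have "degree P \<le> d" using degree_map_poly_le[of xser "mult_cp d F G"] deg(1) unfolding P_def by simp
  then have "(\<Sum>k\<le>degree P. coeff P k * G ^ k) = (\<Sum>k\<le>d. coeff P k * G ^ k)"
    by (intro sum.mono_neutral_left) (auto simp: coeff_eq_0)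
  then have "poly P G = (\<Sum>k\<le>d. xser (c k) * G ^ k)"
    unfolding poly_altdef cP .
  also have "\<dots> = (\<Sum>k\<in>{l..d}. xser (c k) * G ^ k)"
    by (rule sum.mono_neutral_right) (use lo in \<open>auto simp: not_le\<close>)
  also have "\<dots> = xser (c l) * G ^ l + (\<Sum>k\<in>{Suc l..d}. xser (c k) * G ^ k)"
    using ld by (simp add: sum.atLeast_Suc_atMost)
  also have "(\<Sum>k\<in>{Suc l..d}. xser (c k) * G ^ k) = G ^ Suc l * T"
    unfolding T_def sum_distrib_left
  proof (rule sum.cong)
    fix k assume "k \<in> {Suc l..d}"
    then have "G ^ k = G ^ Suc l * G ^ (k - Suc l)" by (metis atLeastAtMost_iff le_add_diff_inverse power_add)
    then show "xser (c k) * G ^ k = G ^ Suc l * (xser (c k) * G ^ (k - Suc l))" by (simp only: mult_ac)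
  qed simp
  finally have FQ: "F * Q = G ^ l * (xser (c l) + G * T)" using Q unfolding P_def by (simp add: algebra_simps)
  have cS: "conv2 (xser (c l) + G * T)"
    using conv cT cc by (intro conv2_add conv2_mult conv2_xser)
  have "conv2 (F * Q)" unfolding FQ using conv cS by (intro conv2_mult conv2_power)
  \<comment> \<open>Cayley-Hamilton gave only a formal cofactor; its convergence follows from that
    of \<open>F * Q\<close>.\<close>
  then have cQ: "conv2 Q" by (rule conv2_quotient[OF F cF])
  have "G ^ l * (xser (c l) + G * T) = f * (e * Q)" using FQ unfolding Fe by (simp add: mult_ac)
  then have dv: "cdvd f (G ^ l * (xser (c l) + G * T))"
    unfolding cdvd_def using conv cQ conv2_mult by blast
  have F0: "fps_nth F 0 = fps_nth e 0 * fps_nth f 0" unfolding Fe by simp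
  then have fr: "yreg (subdegree (fps_nth f 0)) f" using F unfolding yreg_def by auto
  have "cdvd f (xser (c l) + G * T)"
    by (rule cdvd_power_cancel[OF fr conv(1,3) cS dv cop])
  then obtain w where w: "conv2 w" "xser (c l) + G * T = f * w" unfolding cdvd_def by blast
  define m where "m = subdegree (c l)"
  have mM: "m \<le> M" using M cl unfolding m_def c_def by blast
  \<comment> \<open>\<open>c l\<close> is x^m times the unit \<open>v\<close>, so membership of
    \<open>c l\<close> in the ideal passes to x^m and then to x^M.\<close>
  define v where "v = xser (fps_shift m (c l))"
  have "c l = fps_shift m (c l) * fps_X ^ m" unfolding m_def by (rule subdegree_decompose)
  then have clv: "xser (c l) = v * fps_X ^ m" unfolding v_def by (metis xser_X_power xser_mult)
  have "conv2 v" unfolding v_def by (intro conv2_xser conv1_shift cc)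
  moreover have "fps_nth (fps_nth v 0) 0 \<noteq> 0" using cl unfolding v_def m_def xser_def by simp
  ultimately obtain v' where v': "conv2 v'" "v' * v = 1" using conv2_inverse_ex by blast
  have "fps_X ^ M = fps_X ^ (M - m) * ((v' * v) * fps_X ^ m)"
    unfolding v'(2) using mM by (simp flip: power_add)
  also have "\<dots> = fps_X ^ (M - m) * v' * (v * fps_X ^ m)" by (simp only: mult_ac)
  also have "v * fps_X ^ m = f * w - G * T" using clv w(2) by (simp add: eq_diff_eq)
  also have "fps_X ^ (M - m) * v' * (f * w - G * T)
      = (fps_X ^ (M - m) * v' * w) * f + (- (fps_X ^ (M - m) * v' * T)) * G"
    by (simp add: algebra_simps)
  finally have "fps_X ^ M = (fps_X ^ (M - m) * v' * w) * f + (- (fps_X ^ (M - m) * v' * T)) * G" .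
  moreover have "conv2 (fps_X ^ (M - m) * v' * w)" "conv2 (- (fps_X ^ (M - m) * v' * T))"
    using v' w cT by (auto intro!: conv2_mult conv2_uminus)
  ultimately show ?thesis by blast
qed

text \<open>Division by \<open>f\<close> bounds the degree in y, and x^M in the ideal removes the
  high powers of x. The remainder has degree below the order \<open>d'\<close> of \<open>f\<close>,
  but it is recorded with the order \<open>d\<close> of F, since this is the order that the
  parameters control.\<close>

lemma quotient_spanned:
  assumes F: "yreg d F" and conv: "conv2 f" "conv2 e" "conv2 G" and Fe: "F = e * f"
    and cop: "\<And>q. conv2 q \<Longrightarrow> cdvd q f \<Longrightarrow> cdvd q G \<Longrightarrow> fps_nth (fps_nth q 0) 0 \<noteq> 0"
    and M: "\<And>k. coeff (mult_cp d F G) k \<noteq> 0 \<Longrightarrow> subdegree (coeff (mult_cp d F G) k) \<le> M"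
    and h: "conv2 h"
  shows "\<exists>p a b. conv2 a \<and> conv2 b \<and> h = p + a * f + b * G
      \<and> (\<forall>i j. M \<le> i \<or> d \<le> j \<longrightarrow> fps_nth (fps_nth p i) j = 0)"
proof -
  obtain a b where ab: "conv2 a" "conv2 b" "fps_X ^ M = a * f + b * G"
    using X_power_in_ideal[OF F conv Fe cop M] by blast
  have F0: "fps_nth F 0 = fps_nth e 0 * fps_nth f 0" unfolding Fe by simp
  define d' where "d' = subdegree (fps_nth f 0)"
  have fr: "yreg d' f" and dd: "d' \<le> d" using F F0 unfolding yreg_def d'_def by auto
  define q r where "q = wquot d' f h" and "r = wrem d' f h"
  have qr: "h = q * f + r" "conv2 q" "conv2 r"
    unfolding q_def r_def using weierstrass_division[OF fr] conv2_wquot_wrem[OF fr conv(1) h] by auto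
  define t where "t = fps_shift M r"
  have "r = t * fps_X ^ M + fps_cutoff M r" unfolding t_def by (simp add: fps_shift_cutoff)
  then have "h = fps_cutoff M r + (q + t * a) * f + (t * b) * G"
    using qr(1) unfolding ab(3) by (simp add: algebra_simps)
  moreover have "conv2 (q + t * a)" "conv2 (t * b)"
    unfolding t_def using qr ab by (auto intro!: conv2_add conv2_mult conv2_shift)
  moreover have "fps_nth (fps_nth (fps_cutoff M r) i) j = 0" if "M \<le> i \<or> d \<le> j" for i j
    using that dd wrem_nth_ge[of d' j f h i] unfolding r_def by auto
  ultimately show ?thesis by blast
qed

section \<open>Germs of holomorphic functions and their Taylor series\<close>

definition yslice :: "complex fps fps \<Rightarrow> complex \<Rightarrow> complex fps" where
  "yslice a y = Abs_fps (\<lambda>i. eval_fps (fps_nth a i) y)"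

definition ev :: "complex fps fps \<Rightarrow> complex \<times> complex \<Rightarrow> complex" where
  "ev a z = eval_fps (yslice a (snd z)) (fst z)"

definition bidisc :: "real \<Rightarrow> (complex \<times> complex) set" where
  "bidisc r = ball 0 r \<times> ball 0 r"

text \<open>One radius serves both variables: with the rate \<open>1 / (2 * r)\<close> the term of
  index \<open>i\<close> is at most \<open>A * (1 / 2) ^ i\<close> throughout
  \<open>bidisc r\<close>.\<close>

definition conv_on :: "real \<Rightarrow> real \<Rightarrow> complex fps fps \<Rightarrow> bool" where
  "conv_on r A a \<longleftrightarrow> r > 0 \<and> A \<ge> 0 \<and> (\<forall>i. wbound r (A * (1 / (2 * r)) ^ i) (fps_nth a i))"

lemma norm_eval_wbound:
  assumes "wbound s K a" "norm y < s" shows "norm (eval_fps a y) \<le> K"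
proof -
  have s: "s > 0" using assms(2) by (meson norm_ge_zero order_le_less_trans)
  have "ereal (norm y) < fps_conv_radius a"
    using conv_radius_wbound[OF assms(1) s] assms(2) by (meson ereal_less(2) less_ereal.simps(1) less_le_trans)
  then have sm: "summable (\<lambda>j. norm (fps_nth a j * y ^ j))" by (rule norm_summable_fps)
  have "norm (eval_fps a y) \<le> (\<Sum>j. norm (fps_nth a j * y ^ j))"
    unfolding eval_fps_def by (rule summable_norm[OF sm])
  also have "\<dots> \<le> K"
  proof (rule suminf_le_const[OF sm])
    fix n
    have "(\<Sum>j<n. norm (fps_nth a j * y ^ j)) \<le> (\<Sum>j<n. norm (fps_nth a j) * s ^ j)"
      using assms(2) by (intro sum_mono) (auto simp: norm_mult norm_power intro!: mult_left_mono power_mono)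
    also have "\<dots> \<le> (\<Sum>j\<le>n. norm (fps_nth a j) * s ^ j)"
      using s by (intro sum_mono2) auto
    also have "\<dots> \<le> K" using assms(1) unfolding wbound_def by auto
    finally show "(\<Sum>j<n. norm (fps_nth a j * y ^ j)) \<le> K" .
  qed
  finally show ?thesis .
qed

lemma conv_on_mono:
  assumes "conv_on r A a" "0 < s" "s \<le> r" shows "conv_on s A a"
proof -
  have "A * (1 / (2 * r)) ^ i \<le> A * (1 / (2 * s)) ^ i" for i
    using assms unfolding conv_on_def by (intro mult_left_mono power_mono) (auto simp: field_simps)
  then show ?thesis using assms unfolding conv_on_def
    by (auto intro!: wbound_mono[OF wbound_antimono[of r _ _ s]])
qed

lemma conv2_conv_on:
  assumes "conv2 a" obtains r A where "conv_on r A a"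
proof -
  obtain s A B where s: "s > 0" "A \<ge> 0" "B \<ge> (1::real)" "\<And>i. wbound s (A * B ^ i) (fps_nth a i)"
    by (rule conv2_bounds2[OF assms assms, of 1]) auto
  define r where "r = min s (1 / (2 * B))"
  have r: "r > 0" "r \<le> s" "B \<le> 1 / (2 * r)" using s unfolding r_def by (auto simp: field_simps min_def)
  have "A * B ^ i \<le> A * (1 / (2 * r)) ^ i" for i
    using s r by (intro mult_left_mono power_mono) auto
  then have "wbound r (A * (1 / (2 * r)) ^ i) (fps_nth a i)" for i
    using wbound_mono[OF wbound_antimono[OF s(4)]] r by (meson less_imp_le)
  then show thesis using that[of r A] r s unfolding conv_on_def by auto
qed

lemma conv_on_radius: "conv_on r A a \<Longrightarrow> ereal r \<le> fps_conv_radius (fps_nth a i)"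
  unfolding conv_on_def using conv_radius_wbound by blast

lemma conv_on_eval: "conv_on r A a \<Longrightarrow> norm y < r \<Longrightarrow> norm (eval_fps (fps_nth a i) y) \<le> A * (1 / (2 * r)) ^ i"
  unfolding conv_on_def using norm_eval_wbound by blast

lemma conv_on_yslice:
  assumes "conv_on r A a" "norm y < r" shows "wbound r (2 * A) (yslice a y)"
  by (rule wbound_geometric[where B = "1 / (2 * r)"])
     (use assms conv_on_eval[OF assms] in \<open>auto simp: yslice_def conv_on_def\<close>)

lemma conv_on_yslice_radius: "conv_on r A a \<Longrightarrow> norm y < r \<Longrightarrow> ereal r \<le> fps_conv_radius (yslice a y)"
  using conv_radius_wbound[OF conv_on_yslice] unfolding conv_on_def by blast

lemma eval_fps_sum:
  fixes z :: complex
  assumes "\<And>i. i \<in> I \<Longrightarrow> ereal (norm z) < fps_conv_radius (f i)"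
  shows "ereal (norm z) < fps_conv_radius (sum f I) \<and> eval_fps (sum f I) z = (\<Sum>i\<in>I. eval_fps (f i) z)"
  using assms
proof (induction I rule: infinite_finite_induct)
  case (insert i I)
  have 1: "ereal (norm z) < fps_conv_radius (f i)" using insert.prems by simp
  have 2: "ereal (norm z) < fps_conv_radius (sum f I)" "eval_fps (sum f I) z = (\<Sum>i\<in>I. eval_fps (f i) z)"
    using insert.IH insert.prems by auto
  have "ereal (norm z) < fps_conv_radius (f i + sum f I)"
    by (rule less_le_trans[OF _ fps_conv_radius_add]) (use 1 2 in simp)
  then show ?case using insert.hyps eval_fps_add[OF 1 2(1)] 2(2) by simp
qed auto

lemma less_radius: "norm z < r \<Longrightarrow> ereal r \<le> R \<Longrightarrow> ereal (norm z) < R"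
  by (meson less_ereal.simps(1) less_le_trans)

lemma ev_altdef: "ev a = (\<lambda>z. \<Sum>i. eval_fps (fps_nth a i) (snd z) * fst z ^ i)"
  unfolding ev_def yslice_def eval_fps_def by simp

lemma ev_mult:
  assumes a: "conv_on r A a" and b: "conv_on r B b" and z: "z \<in> bidisc r"
  shows "ev (a * b) z = ev a z * ev b z"
proof -
  obtain x y where xy: "z = (x, y)" by (cases z)
  have n: "norm x < r" "norm y < r" using z unfolding bidisc_def xy by auto
  have ra: "ereal (norm y) < fps_conv_radius (fps_nth a i)" for i
    by (rule less_radius[OF n(2) conv_on_radius[OF a]])
  have rb: "ereal (norm y) < fps_conv_radius (fps_nth b i)" for i
    by (rule less_radius[OF n(2) conv_on_radius[OF b]])
  have rab: "ereal (norm y) < fps_conv_radius (fps_nth a i * fps_nth b j)" for i j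
    using ra rb fps_conv_radius_mult by (meson less_le_trans min_less_iff_conj)
  have "yslice (a * b) y = yslice a y * yslice b y"
    by (rule fps_ext) (simp add: yslice_def fps_mult_nth eval_fps_sum[OF rab] eval_fps_mult[OF ra rb])
  then show ?thesis unfolding ev_def xy
    using eval_fps_mult[OF less_radius[OF n(1) conv_on_yslice_radius[OF a n(2)]]
      less_radius[OF n(1) conv_on_yslice_radius[OF b n(2)]]] by simp
qed

lemma ev_add:
  assumes a: "conv_on r A a" and b: "conv_on r B b" and z: "z \<in> bidisc r"
  shows "ev (a + b) z = ev a z + ev b z"
proof -
  obtain x y where xy: "z = (x, y)" by (cases z)
  have n: "norm x < r" "norm y < r" using z unfolding bidisc_def xy by auto
  have "yslice (a + b) y = yslice a y + yslice b y"
    by (rule fps_ext) (simp add: yslice_def eval_fps_add[OF less_radius[OF n(2) conv_on_radius[OF a]]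
      less_radius[OF n(2) conv_on_radius[OF b]]])
  then show ?thesis unfolding ev_def xy
    using eval_fps_add[OF less_radius[OF n(1) conv_on_yslice_radius[OF a n(2)]]
      less_radius[OF n(1) conv_on_yslice_radius[OF b n(2)]]] by simp
qed

lemma ev_origin: "ev a 0 = fps_nth (fps_nth a 0) 0"
  unfolding ev_def yslice_def by (simp add: eval_fps_at_0)

lemma bidisc_nhd: "r > 0 \<Longrightarrow> open (bidisc r) \<and> 0 \<in> bidisc r"
  unfolding bidisc_def by (auto intro: open_Times simp: zero_prod_def)

lemma eventually_nhds_bidisc:
  "(\<forall>\<^sub>F z in nhds 0. P z) \<longleftrightarrow> (\<exists>r>0. \<forall>z\<in>bidisc r. P z)"
proof
  assume "\<forall>\<^sub>F z in nhds 0. P z"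
  then obtain S where "open S" "0 \<in> S" "\<forall>z\<in>S. P z" unfolding eventually_nhds by auto
  then obtain e where e: "e > 0" "ball 0 e \<subseteq> S" using open_contains_ball by blast
  have "bidisc (e / 2) \<subseteq> ball 0 e"
  proof
    fix z :: "complex \<times> complex" assume "z \<in> bidisc (e / 2)"
    then have "norm (fst z) + norm (snd z) < e" unfolding bidisc_def by auto
    then have "norm z < e" using norm_Pair_le[of "fst z" "snd z"] by simp
    then show "z \<in> ball 0 e" by simp
  qed
  then show "\<exists>r>0. \<forall>z\<in>bidisc r. P z" using e \<open>\<forall>z\<in>S. P z\<close> by (intro exI[of _ "e / 2"]) auto
next
  assume "\<exists>r>0. \<forall>z\<in>bidisc r. P z"
  then show "\<forall>\<^sub>F z in nhds 0. P z" using bidisc_nhd unfolding eventually_nhds by blast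
qed

text \<open>The one-variable identity theorem is applied twice: in x for each fixed small y, and
  then in y for each coefficient.\<close>

lemma ev_inj:
  assumes a: "conv2 a" and b: "conv2 b" and eq: "germ_eq (ev a) (ev b)"
  shows "a = b"
proof -
  obtain r1 A where r1: "conv_on r1 A a" using conv2_conv_on[OF a] by blast
  obtain r2 B where r2: "conv_on r2 B b" using conv2_conv_on[OF b] by blast
  obtain r3 where r3: "r3 > 0" "\<And>z. z \<in> bidisc r3 \<Longrightarrow> ev a z = ev b z"
    using eq unfolding germ_eq_def eventually_nhds_bidisc by auto
  define r where "r = min r3 (min r1 r2)"
  have r: "r > 0" using r1 r2 r3 unfolding r_def conv_on_def by auto
  have ra: "conv_on r A a" and rb: "conv_on r B b"
    using conv_on_mono[OF r1 r] conv_on_mono[OF r2 r] unfolding r_def by auto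
  have nh: "\<forall>\<^sub>F y in nhds (0::complex). norm y < r"
    using r eventually_nhds_in_open[of "ball 0 r" "0::complex"] by simp
  have sl: "yslice a y = yslice b y" if y: "norm y < r" for y
  proof (rule eval_fps_eqD)
    show "fps_conv_radius (yslice a y) > 0" "fps_conv_radius (yslice b y) > 0"
      using conv_on_yslice_radius[OF ra y] conv_on_yslice_radius[OF rb y] r
      by (meson ereal_less(2) less_le_trans)+
    show "\<forall>\<^sub>F x in nhds 0. eval_fps (yslice a y) x = eval_fps (yslice b y) x"
      using nh
    proof eventually_elim
      case (elim x)
      then have "(x, y) \<in> bidisc r3" using y unfolding bidisc_def r_def by auto
      then show ?case using r3(2) unfolding ev_def by fastforce
    qed
  qed
  show ?thesis
  proof (rule fps_ext)
    fix i
    show "fps_nth a i = fps_nth b i"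
    proof (rule eval_fps_eqD)
      show "fps_conv_radius (fps_nth a i) > 0" "fps_conv_radius (fps_nth b i) > 0"
        using conv_on_radius[OF ra] conv_on_radius[OF rb] r by (meson ereal_less(2) less_le_trans)+
      show "\<forall>\<^sub>F y in nhds 0. eval_fps (fps_nth a i) y = eval_fps (fps_nth b i) y"
        using nh
      proof eventually_elim
        case (elim y)
        then show ?case using sl[of y] unfolding yslice_def by (metis fps_nth_Abs_fps)
      qed
    qed
  qed
qed

section \<open>Differentiation of double series\<close>

definition ydiff :: "complex fps fps \<Rightarrow> complex fps fps" where
  "ydiff a = Abs_fps (\<lambda>i. fps_deriv (fps_nth a i))"

lemma conv2_fps_deriv:
  assumes "conv2 a" shows "conv2 (fps_deriv a)"
proof -
  obtain s A B where s: "s > 0" "A \<ge> 0" "B \<ge> (1::real)" "\<And>i. wbound s (A * B ^ i) (fps_nth a i)"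
    by (rule conv2_bounds2[OF assms assms, of 1]) auto
  have "wbound s ((A * B) * (2 * B) ^ i) (fps_nth (fps_deriv a) i)" for i
  proof -
    have "wbound s (real (Suc i)) (of_nat (Suc i))"
      unfolding wbound_def
    proof
      fix n
      have "(\<Sum>j\<le>n. norm (fps_nth (of_nat (Suc i) :: complex fps) j) * s ^ j) = (\<Sum>j\<le>n. if j = 0 then real (Suc i) else 0)"
        by (rule sum.cong) (auto simp: fps_of_nat[symmetric] simp del: of_nat_Suc)
      then show "(\<Sum>j\<le>n. norm (fps_nth (of_nat (Suc i) :: complex fps) j) * s ^ j) \<le> real (Suc i)"
        by simp
    qed
    then have "wbound s (real (Suc i) * (A * B ^ Suc i)) (of_nat (Suc i) * fps_nth a (Suc i))"
      by (rule wbound_mult[OF _ s(4)]) (use s in simp)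
    moreover have "real (Suc i) * (A * B ^ Suc i) \<le> 2 ^ i * (A * B ^ Suc i)"
      using s by (intro mult_right_mono Suc_le_two_power) auto
    ultimately have "wbound s (2 ^ i * (A * B ^ Suc i)) (of_nat (Suc i) * fps_nth a (Suc i))"
      by (rule wbound_mono)
    moreover have "fps_nth (fps_deriv a) i = of_nat (Suc i) * fps_nth a (Suc i)" by simp
    moreover have "2 ^ i * (A * B ^ Suc i) = (A * B) * (2 * B) ^ i"
      by (simp add: power_mult_distrib mult_ac)
    ultimately show ?thesis by metis
  qed
  then show ?thesis unfolding conv2_def using s(1) by blast
qed

lemma wbound_deriv:
  assumes "wbound s K c" "s > 0" shows "wbound (s / 2) (K / s) (fps_deriv c)"
  unfolding wbound_def
proof
  fix n
  have "(\<Sum>j\<le>n. norm (fps_nth (fps_deriv c) j) * (s / 2) ^ j) * s \<le> (\<Sum>j\<le>n. norm (fps_nth c (Suc j)) * s ^ Suc j)"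
    unfolding sum_distrib_right
  proof (rule sum_mono)
    fix j
    have "norm (fps_nth (fps_deriv c) j) * (s / 2) ^ j * s
        = real (Suc j) / 2 ^ j * (norm (fps_nth c (Suc j)) * s ^ Suc j)"
      by (simp add: norm_mult power_divide del: of_nat_Suc)
    also have "\<dots> \<le> 1 * (norm (fps_nth c (Suc j)) * s ^ Suc j)"
      using Suc_le_two_power[of j] assms(2) by (intro mult_right_mono) (auto simp: field_simps)
    finally show "norm (fps_nth (fps_deriv c) j) * (s / 2) ^ j * s \<le> norm (fps_nth c (Suc j)) * s ^ Suc j" by simp
  qed
  also have "\<dots> = (\<Sum>j\<in>Suc ` {..n}. norm (fps_nth c j) * s ^ j)"
    by (subst sum.reindex) auto
  also have "\<dots> \<le> (\<Sum>j\<le>Suc n. norm (fps_nth c j) * s ^ j)"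
    using assms(2) by (intro sum_mono2) auto
  also have "\<dots> \<le> K" using assms(1) unfolding wbound_def by (rule spec)
  finally show "(\<Sum>j\<le>n. norm (fps_nth (fps_deriv c) j) * (s / 2) ^ j) \<le> K / s"
    using assms(2) by (simp add: field_simps)
qed

lemma conv2_ydiff:
  assumes "conv2 a" shows "conv2 (ydiff a)"
proof -
  obtain s A B where s: "s > 0" "\<And>i. wbound s (A * B ^ i) (fps_nth a i)"
    using assms unfolding conv2_def by auto
  have "wbound (s / 2) ((A / s) * B ^ i) (fps_nth (ydiff a) i)" for i
    using wbound_deriv[OF s(2) s(1), of i] unfolding ydiff_def by simp
  then show ?thesis unfolding conv2_def using s(1) by (meson half_gt_zero)
qed

lemma ev_terms_bound:
  assumes "conv_on r A a" "norm x < r" "norm y < r"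
  shows "norm (eval_fps (fps_nth a i) y * x ^ i) \<le> A * (1 / 2) ^ i"
proof -
  have r: "r > 0" "A \<ge> 0" using assms unfolding conv_on_def by auto
  have "norm (eval_fps (fps_nth a i) y * x ^ i) \<le> (A * (1 / (2 * r)) ^ i) * r ^ i"
    unfolding norm_mult norm_power using conv_on_eval[OF assms(1,3)] assms(2) r
    by (intro mult_mono power_mono) auto
  also have "\<dots> = A * (1 / 2) ^ i" using r by (simp add: power_divide power_mult_distrib)
  finally show ?thesis .
qed

lemma ev_uniform_limit:
  assumes "conv_on r A a"
  shows "uniform_limit (bidisc r) (\<lambda>n z. \<Sum>i<n. eval_fps (fps_nth a i) (snd z) * fst z ^ i) (ev a) sequentially"
proof -
  have "uniform_limit (bidisc r) (\<lambda>n z. \<Sum>i<n. eval_fps (fps_nth a i) (snd z) * fst z ^ i)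
     (\<lambda>z. \<Sum>i. eval_fps (fps_nth a i) (snd z) * fst z ^ i) sequentially"
    by (rule Weierstrass_m_test[where M = "\<lambda>i. A * (1 / 2) ^ i"])
       (use assms in \<open>auto simp: bidisc_def intro!: ev_terms_bound summable_mult summable_geometric\<close>)
  then show ?thesis unfolding ev_altdef .
qed

lemma ev_continuous_on:
  assumes "conv_on r A a" shows "continuous_on (bidisc r) (ev a)"
proof (rule uniform_limit_theorem[OF _ ev_uniform_limit[OF assms]])
  show "\<forall>\<^sub>F n in sequentially. continuous_on (bidisc r) (\<lambda>z. \<Sum>i<n. eval_fps (fps_nth a i) (snd z) * fst z ^ i)"
  proof (intro always_eventually allI continuous_intros)
    fix n i
    show "snd ` bidisc r \<subseteq> eball 0 (fps_conv_radius (fps_nth a i))"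
      using less_radius[OF _ conv_on_radius[OF assms]] unfolding bidisc_def by auto
  qed
qed auto

text \<open>\<open>fps_deriv\<close> is the derivative in x, the outer variable, and
  \<open>ydiff\<close> the one in y. Both partial derivatives are taken term by term; total
  differentiability then follows because the partial derivative in y is continuous, as a uniform
  limit.\<close>

lemma ev_has_derivative:
  assumes a: "conv_on r A a" and dx: "conv_on r B (fps_deriv a)" and dy: "conv_on r C (ydiff a)"
    and z: "z \<in> bidisc r"
  shows "(ev a has_derivative (\<lambda>w. ev (fps_deriv a) z * fst w + ev (ydiff a) z * snd w)) (at z)"
proof -
  obtain x y where xy: "z = (x, y)" by (cases z)
  have n: "norm x < r" "norm y < r" using z unfolding bidisc_def xy by auto
  let ?B = "ball (0::complex) r"
  have fx: "((\<lambda>x. ev a (x, y)) has_derivative (\<lambda>w. ev (fps_deriv a) (x, y) * w)) (at x within ?B)"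
  proof -
    have "((\<lambda>x. eval_fps (yslice a y) x) has_field_derivative eval_fps (fps_deriv (yslice a y)) x) (at x within ?B)"
      by (rule has_field_derivative_eval_fps[OF less_radius[OF n(1) conv_on_yslice_radius[OF a n(2)]]])
    moreover have "fps_deriv (yslice a y) = yslice (fps_deriv a) y"
    proof (rule fps_ext)
      fix i
      have "eval_fps (of_nat (Suc i) * fps_nth a (Suc i)) y = of_nat (Suc i) * eval_fps (fps_nth a (Suc i)) y"
        unfolding fps_of_nat[symmetric]
        using less_radius[OF n(2) conv_on_radius[OF a]] by (subst eval_fps_mult) auto
      then show "fps_nth (fps_deriv (yslice a y)) i = fps_nth (yslice (fps_deriv a) y) i"
        unfolding yslice_def by (simp del: of_nat_Suc)
    qed
    ultimately show ?thesis unfolding ev_def has_field_derivative_def by simp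
  qed
  have fy: "((\<lambda>y. ev a (x, y)) has_derivative (\<lambda>w. ev (ydiff a) (x, y) * w)) (at y within ?B)"
    if xB: "x \<in> ?B" and yB: "y \<in> ?B" for x y
  proof -
    have nx: "norm x < r" using xB by simp
    have d: "((\<lambda>y. eval_fps (fps_nth a i) y * x ^ i) has_field_derivative eval_fps (fps_nth (ydiff a) i) y * x ^ i) (at y within ?B)"
      if "y \<in> ?B" for i y
      unfolding ydiff_def using that
      by (auto intro!: derivative_eq_intros has_field_derivative_eval_fps less_radius[OF _ conv_on_radius[OF a]])
    have u: "uniformly_convergent_on ?B (\<lambda>n y. \<Sum>i<n. eval_fps (fps_nth (ydiff a) i) y * x ^ i)"
      by (rule Weierstrass_m_test'[where M = "\<lambda>i. C * (1 / 2) ^ i"])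
         (use nx in \<open>auto intro!: ev_terms_bound[OF dy] summable_mult summable_geometric\<close>)
    have sm: "summable (\<lambda>i. eval_fps (fps_nth a i) y * x ^ i)"
      by (rule summable_comparison_test[of _ "\<lambda>i. A * (1 / 2) ^ i"])
         (use nx yB in \<open>auto intro!: exI[of _ 0] ev_terms_bound[OF a] summable_mult summable_geometric\<close>)
    have "((\<lambda>y. \<Sum>i. eval_fps (fps_nth a i) y * x ^ i) has_field_derivative
        (\<Sum>i. eval_fps (fps_nth (ydiff a) i) y * x ^ i)) (at y)"
      by (rule has_field_derivative_series'(2)[OF convex_ball d u yB sm]) (use yB in \<open>auto simp: interior_open\<close>)
    then show ?thesis unfolding ev_altdef has_field_derivative_def
      by (auto intro: has_derivative_at_withinI)
  qed
  have "((\<lambda>(x, y). ev a (x, y)) has_derivative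
      (\<lambda>(tx, ty). ev (fps_deriv a) (x, y) * tx + blinfun_apply (blinfun_mult_right (ev (ydiff a) (x, y))) ty))
      (at (x, y) within ?B \<times> ?B)"
  proof (rule has_derivative_partialsI[where f = "\<lambda>x y. ev a (x, y)" and fy = "\<lambda>x y. blinfun_mult_right (ev (ydiff a) (x, y))"])
    show "((\<lambda>x. ev a (x, y)) has_derivative (\<lambda>w. ev (fps_deriv a) (x, y) * w)) (at x within ?B)" by (rule fx)
    fix x' y' assume "x' \<in> ?B" "y' \<in> ?B"
    then show "((\<lambda>y. ev a (x', y)) has_derivative blinfun_apply (blinfun_mult_right (ev (ydiff a) (x', y')))) (at y' within ?B)"
      using fy[of x' y'] by simp
  next
    have eq: "(\<lambda>(x, y). blinfun_mult_right (ev (ydiff a) (x, y))) = (\<lambda>z. blinfun_mult_right (ev (ydiff a) z))"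
      by auto
    have "continuous_on (?B \<times> ?B) (\<lambda>z. blinfun_mult_right (ev (ydiff a) z))"
      using ev_continuous_on[OF dy] unfolding bidisc_def
      by (intro bounded_linear.continuous_on[OF bounded_linear_blinfun_mult_right])
    then show "continuous (at (x, y) within ?B \<times> ?B) (\<lambda>(x, y). blinfun_mult_right (ev (ydiff a) (x, y)))"
      unfolding eq using n by (simp add: continuous_on_eq_continuous_within)
  qed (use n in auto)
  moreover have "at (x, y) within ?B \<times> ?B = at (x, y)"
    using n by (intro at_within_open open_Times) auto
  ultimately show ?thesis unfolding xy by (simp add: case_prod_unfold)
qed

text \<open>The dictionary between germs and series: a germ has at most one such series by
  \<open>ev_inj\<close>, and a holomorphic germ has one by \<open>germ_hol_rep\<close>.\<close>

definition rep :: "(complex \<times> complex \<Rightarrow> complex) \<Rightarrow> complex fps fps \<Rightarrow> bool" where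
  "rep h a \<longleftrightarrow> conv2 a \<and> germ_eq h (ev a)"

lemma germ_eq_refl [simp]: "germ_eq a a"
  unfolding germ_eq_def by simp

lemma germ_eq_sym: "germ_eq a b \<Longrightarrow> germ_eq b a"
  unfolding germ_eq_def by (simp add: eq_commute)

lemma germ_eq_trans: "germ_eq a b \<Longrightarrow> germ_eq b c \<Longrightarrow> germ_eq a c"
  unfolding germ_eq_def by (erule (1) eventually_elim2) simp

lemma germ_eq_mult: "germ_eq a b \<Longrightarrow> germ_eq c d \<Longrightarrow> germ_eq (\<lambda>z. a z * c z) (\<lambda>z. b z * d z)"
  unfolding germ_eq_def by (erule (1) eventually_elim2) simp

lemma germ_eq_add: "germ_eq a b \<Longrightarrow> germ_eq c d \<Longrightarrow> germ_eq (\<lambda>z. a z + c z) (\<lambda>z. b z + d z)"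
  unfolding germ_eq_def by (erule (1) eventually_elim2) simp

lemma germ_eq_at_0: "germ_eq a b \<Longrightarrow> a 0 = b 0"
  unfolding germ_eq_def by (rule eventually_nhds_x_imp_x)

lemma rep_origin: "rep h a \<Longrightarrow> h 0 = fps_nth (fps_nth a 0) 0"
  unfolding rep_def using germ_eq_at_0 ev_origin by metis

lemma rep_unique: "rep h a \<Longrightarrow> rep k b \<Longrightarrow> germ_eq h k \<Longrightarrow> a = b"
  unfolding rep_def using ev_inj germ_eq_trans germ_eq_sym by metis

lemma conv_on_common:
  assumes "finite S" "\<And>a. a \<in> S \<Longrightarrow> conv2 a" "\<rho> > 0"
  shows "\<exists>r>0. r \<le> \<rho> \<and> (\<forall>a\<in>S. \<exists>A. conv_on r A a)"
  using assms(1,2)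
proof (induction S)
  case empty
  then show ?case using assms(3) by auto
next
  case (insert a S)
  then obtain r where r: "r > 0" "r \<le> \<rho>" "\<forall>a\<in>S. \<exists>A. conv_on r A a" by auto
  obtain s A where s: "conv_on s A a" using conv2_conv_on insert.prems by blast
  have "0 < min r s" using r s unfolding conv_on_def by auto
  moreover have "\<forall>a\<in>insert a S. \<exists>A. conv_on (min r s) A a"
    using r(3) s conv_on_mono[OF _ \<open>0 < min r s\<close>] by (metis insertE min.cobounded1 min.cobounded2)
  ultimately show ?case using r by (intro exI[of _ "min r s"]) auto
qed

lemma conv_on_common2:
  assumes "conv2 a" "conv2 b"
  obtains r A B where "conv_on r A a" "conv_on r B b"
  using conv_on_common[of "{a, b}" 1] assms that by auto

lemma rep_ev: "conv2 a \<Longrightarrow> rep (ev a) a"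
  unfolding rep_def by simp

lemma rep_mult:
  assumes "rep h a" "rep k b" shows "rep (\<lambda>z. h z * k z) (a * b)"
proof -
  obtain r A B where r: "conv_on r A a" "conv_on r B b"
    using conv_on_common2[of a b] assms unfolding rep_def by blast
  have "germ_eq (\<lambda>z. ev a z * ev b z) (ev (a * b))"
    unfolding germ_eq_def eventually_nhds_bidisc using ev_mult[OF r] r unfolding conv_on_def by auto
  moreover have "germ_eq (\<lambda>z. h z * k z) (\<lambda>z. ev a z * ev b z)"
    using assms unfolding rep_def by (auto intro: germ_eq_mult)
  ultimately show ?thesis using assms germ_eq_trans conv2_mult unfolding rep_def by blast
qed

lemma rep_add:
  assumes "rep h a" "rep k b" shows "rep (\<lambda>z. h z + k z) (a + b)"
proof -
  obtain r A B where r: "conv_on r A a" "conv_on r B b"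
    using conv_on_common2[of a b] assms unfolding rep_def by blast
  have "germ_eq (\<lambda>z. ev a z + ev b z) (ev (a + b))"
    unfolding germ_eq_def eventually_nhds_bidisc using ev_add[OF r] r unfolding conv_on_def by auto
  moreover have "germ_eq (\<lambda>z. h z + k z) (\<lambda>z. ev a z + ev b z)"
    using assms unfolding rep_def by (auto intro: germ_eq_add)
  ultimately show ?thesis using assms germ_eq_trans conv2_add unfolding rep_def by blast
qed

lemma conv2_derivative_germ:
  assumes "conv2 a"
  shows "\<exists>r>0. \<forall>z\<in>bidisc r. (ev a has_derivative (\<lambda>w. ev (fps_deriv a) z * fst w + ev (ydiff a) z * snd w)) (at z)"
proof -
  obtain r where r: "r > 0" "\<forall>b\<in>{a, fps_deriv a, ydiff a}. \<exists>A. conv_on r A b"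
    using conv_on_common[of "{a, fps_deriv a, ydiff a}" 1] assms conv2_fps_deriv conv2_ydiff by auto
  then obtain A B C where "conv_on r A a" "conv_on r B (fps_deriv a)" "conv_on r C (ydiff a)" by auto
  then show ?thesis using ev_has_derivative r(1) by blast
qed

lemma germ_hol_ev:
  assumes "conv2 a" shows "germ_hol (ev a)"
proof -
  obtain r where r: "r > 0" "\<forall>z\<in>bidisc r. (ev a has_derivative (\<lambda>w. ev (fps_deriv a) z * fst w + ev (ydiff a) z * snd w)) (at z)"
    using conv2_derivative_germ[OF assms] by auto
  have "holo2_on (ev a) (bidisc r)"
    unfolding holo2_on_def
  proof
    fix z assume "z \<in> bidisc r"
    then show "\<exists>D. (ev a has_derivative D) (at z) \<and> (\<forall>c w. D (cscale2 c w) = c * D w)"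
      using r(2) by (intro exI[of _ "\<lambda>w. ev (fps_deriv a) z * fst w + ev (ydiff a) z * snd w"])
        (auto simp: cscale2_def algebra_simps)
  qed
  then show ?thesis unfolding germ_hol_def using bidisc_nhd[OF r(1)] by blast
qed

text \<open>Turns analytic derivatives into formal ones: near 0 the function equals
  \<open>ev a\<close>, and uniqueness of the derivative identifies the partials. On a leaf,
  \<open>k1\<close> and \<open>k2\<close> will be the derivatives along the two fields.\<close>

lemma rep_partial:
  assumes h: "rep h a" and U: "open U" "0 \<in> U"
    and D: "\<And>z. z \<in> U \<Longrightarrow> \<exists>D. (h has_derivative D) (at z) \<and> D (1, 0) = k1 z \<and> D (0, 1) = k2 z"
  shows "rep k1 (fps_deriv a) \<and> rep k2 (ydiff a)"
proof -
  have ca: "conv2 a" and "germ_eq h (ev a)" using h unfolding rep_def by auto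
  then obtain V where V: "open V" "0 \<in> V" "\<And>z. z \<in> V \<Longrightarrow> h z = ev a z"
    unfolding germ_eq_def eventually_nhds by auto
  obtain r where r: "r > 0" "\<And>z. z \<in> bidisc r \<Longrightarrow> (ev a has_derivative (\<lambda>w. ev (fps_deriv a) z * fst w + ev (ydiff a) z * snd w)) (at z)"
    using conv2_derivative_germ[OF ca] by auto
  have "k1 z = ev (fps_deriv a) z \<and> k2 z = ev (ydiff a) z" if z: "z \<in> U \<inter> V \<inter> bidisc r" for z
  proof -
    obtain D where D: "(h has_derivative D) (at z)" "D (1, 0) = k1 z" "D (0, 1) = k2 z"
      using D z by blast
    have "(ev a has_derivative D) (at z)"
      by (rule has_derivative_transform_within_open[OF D(1) V(1)]) (use z V in auto)
    then have "D = (\<lambda>w. ev (fps_deriv a) z * fst w + ev (ydiff a) z * snd w)"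
      using r(2) z has_derivative_unique by blast
    then show ?thesis using D by auto
  qed
  moreover have "open (U \<inter> V \<inter> bidisc r)" "0 \<in> U \<inter> V \<inter> bidisc r"
    using U V bidisc_nhd[OF r(1)] by auto
  ultimately have "germ_eq k1 (ev (fps_deriv a))" "germ_eq k2 (ev (ydiff a))"
    unfolding germ_eq_def eventually_nhds by blast+
  then show ?thesis using conv2_fps_deriv[OF ca] conv2_ydiff[OF ca] unfolding rep_def by auto
qed

text \<open>Gives the holomorphy in y of the Taylor coefficients in x of a function of two variables,
  without contour integrals depending on a parameter.\<close>

lemma uniform_limit_coeff:
  fixes h :: "complex \<Rightarrow> 'b \<Rightarrow> complex" and c :: "nat \<Rightarrow> 'b \<Rightarrow> complex"
  assumes R: "R > 0" and M: "M \<ge> 0"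
    and c: "\<And>i y. y \<in> K \<Longrightarrow> norm (c i y) \<le> M / R ^ i"
    and h: "\<And>x y. norm x < R \<Longrightarrow> y \<in> K \<Longrightarrow> (\<lambda>i. c i y * x ^ i) sums h x y"
  shows "uniform_limit K (\<lambda>x y. (h x y - (\<Sum>l<i. c l y * x ^ l)) / x ^ i) (c i) (at 0)"
proof (rule uniform_limitI)
  fix e :: real assume e: "e > 0"
  \<comment> \<open>For \<open>norm x \<le> R / 2\<close> the tail beyond index \<open>i\<close>,
    divided by x^i, is dominated by a geometric series of ratio 1/2, with sum
    \<open>q * norm x\<close>. Dividing by \<open>q + 1\<close> below covers the case
    \<open>q = 0\<close>.\<close>
  define q where "q = 2 * M / R ^ Suc i"
  have q: "q \<ge> 0" using M R unfolding q_def by auto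
  define \<delta> where "\<delta> = min (R / 2) (e / (q + 1))"
  have \<delta>: "\<delta> > 0" using R e q unfolding \<delta>_def by auto
  have main: "dist ((h x y - (\<Sum>l<i. c l y * x ^ l)) / x ^ i) (c i y) < e"
    if x: "x \<noteq> 0" "norm x < \<delta>" and y: "y \<in> K" for x y
  proof -
    have nx: "norm x < R" "norm x \<le> R / 2" using x R unfolding \<delta>_def by auto
    have s: "(\<lambda>l. c (l + i) y * x ^ (l + i)) sums (h x y - (\<Sum>l<i. c l y * x ^ l))"
      using sums_split_initial_segment[OF h[OF nx(1) y], of i] by simp
    have "(\<lambda>l. c (l + i) y * x ^ (l + i) / x ^ i) sums ((h x y - (\<Sum>l<i. c l y * x ^ l)) / x ^ i)"
      by (rule sums_divide[OF s])
    then have "(\<lambda>l. c (l + i) y * x ^ l) sums ((h x y - (\<Sum>l<i. c l y * x ^ l)) / x ^ i)"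
      using x(1) by (simp add: power_add)
    from sums_split_initial_segment[OF this, of 1]
    have t: "(\<lambda>l. c (Suc l + i) y * x ^ Suc l) sums ((h x y - (\<Sum>l<i. c l y * x ^ l)) / x ^ i - c i y)"
      by simp
    have bnd: "norm (c (Suc l + i) y * x ^ Suc l) \<le> (M / R ^ Suc i * norm x) * (1 / 2) ^ l" for l
    proof -
      have "norm (c (Suc l + i) y * x ^ Suc l) \<le> (M / R ^ (Suc l + i)) * norm x ^ Suc l"
        unfolding norm_mult norm_power by (intro mult_right_mono c[OF y]) auto
      also have "\<dots> = (M / R ^ Suc i * norm x) * (norm x / R) ^ l"
        using R by (simp add: power_add power_divide field_simps)
      also have "\<dots> \<le> (M / R ^ Suc i * norm x) * (1 / 2) ^ l"
        using R M nx by (intro mult_left_mono power_mono) (auto simp: field_simps)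
      finally show ?thesis .
    qed
    have "norm ((h x y - (\<Sum>l<i. c l y * x ^ l)) / x ^ i - c i y) \<le> (\<Sum>l. (M / R ^ Suc i * norm x) * (1 / 2) ^ l)"
      unfolding sums_unique[OF t] by (rule norm_suminf_le) (use bnd in \<open>auto intro: summable_mult summable_geometric\<close>)
    also have "\<dots> = (M / R ^ Suc i * norm x) * 2"
      by (subst suminf_mult) (auto simp: suminf_geometric summable_geometric)
    also have "\<dots> = q * norm x" unfolding q_def by simp
    also have "\<dots> < e"
    proof -
      have "q * norm x \<le> q * \<delta>" using x q by (intro mult_left_mono) auto
      also have "\<dots> \<le> q * (e / (q + 1))" using q unfolding \<delta>_def by (intro mult_left_mono) auto
      also have "\<dots> < e" using q e by (simp add: field_simps)
      finally show ?thesis .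
    qed
    finally show ?thesis by (simp add: dist_norm)
  qed
  show "\<forall>\<^sub>F x in at 0. \<forall>y\<in>K. dist ((h x y - (\<Sum>l<i. c l y * x ^ l)) / x ^ i) (c i y) < e"
    unfolding eventually_at using \<delta> main by (intro exI[of _ \<delta>]) auto
qed

lemma holo2_slices:
  assumes "holo2_on h U" "open U"
  shows "(x, y) \<in> U \<Longrightarrow> (\<lambda>x. h (x, y)) field_differentiable (at x)"
    and "(x, y) \<in> U \<Longrightarrow> (\<lambda>y. h (x, y)) field_differentiable (at y)"
proof -
  assume "(x, y) \<in> U"
  then obtain D where D: "(h has_derivative D) (at (x, y))" "\<And>c w. D (cscale2 c w) = c * D w"
    using assms unfolding holo2_on_def by blast
  have "((\<lambda>x. (x, y)) has_derivative (\<lambda>w. (w, 0))) (at x)"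
    by (auto intro!: derivative_eq_intros)
  from has_derivative_compose[OF this D(1)]
  have "((\<lambda>x. h (x, y)) has_derivative (\<lambda>w. D (w, 0))) (at x)" .
  moreover have "(\<lambda>w. D (w, 0)) = (*) (D (1, 0))"
  proof
    fix w show "D (w, 0) = D (1, 0) * w"
      using D(2)[of w "(1, 0)"] by (simp add: cscale2_def mult.commute)
  qed
  ultimately have "((\<lambda>x. h (x, y)) has_derivative (*) (D (1, 0))) (at x)" by metis
  then show "(\<lambda>x. h (x, y)) field_differentiable (at x)"
    unfolding field_differentiable_def has_field_derivative_def by blast
  have "((\<lambda>y. (x, y)) has_derivative (\<lambda>w. (0, w))) (at y)"
    by (auto intro!: derivative_eq_intros)
  from has_derivative_compose[OF this D(1)]
  have "((\<lambda>y. h (x, y)) has_derivative (\<lambda>w. D (0, w))) (at y)" .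
  moreover have "(\<lambda>w. D (0, w)) = (*) (D (0, 1))"
  proof
    fix w show "D (0, w) = D (0, 1) * w"
      using D(2)[of w "(0, 1)"] by (simp add: cscale2_def mult.commute)
  qed
  ultimately have "((\<lambda>y. h (x, y)) has_derivative (*) (D (0, 1))) (at y)" by metis
  then show "(\<lambda>y. h (x, y)) field_differentiable (at y)"
    unfolding field_differentiable_def has_field_derivative_def by blast
qed

text \<open>One variable at a time: expand in x, show that each coefficient is holomorphic in y, and
  expand it in turn. Cauchy's inequalities at both stages give the convergence of the double
  series.\<close>

lemma germ_hol_rep:
  assumes "germ_hol h"
  shows "\<exists>a. rep h a"
proof -
  obtain U where U: "open U" "0 \<in> U" "holo2_on h U" using assms unfolding germ_hol_def by auto
  have "\<forall>\<^sub>F z in nhds 0. z \<in> U" by (rule eventually_nhds_in_open[OF U(1,2)])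
  then obtain r where r: "r > 0" "bidisc r \<subseteq> U" unfolding eventually_nhds_bidisc by auto
  define R where "R = r / 2"
  have R: "R > 0" "R < r" using r unfolding R_def by auto
  have inU: "(x, y) \<in> U" if "norm x \<le> R" "norm y \<le> R" for x y
    using that r R unfolding bidisc_def by auto
  have "continuous_on U h"
    using U(3) unfolding holo2_on_def
    by (intro continuous_at_imp_continuous_on ballI) (metis has_derivative_continuous)
  then have "continuous_on (cball 0 R \<times> cball 0 R) h"
    by (rule continuous_on_subset) (use inU in auto)
  then have "compact (h ` (cball 0 R \<times> cball 0 R))"
    by (rule compact_continuous_image) (intro compact_Times compact_cball)
  then obtain M where "\<forall>z\<in>h ` (cball 0 R \<times> cball 0 R). norm z \<le> M"
    using compact_imp_bounded bounded_iff by metis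
  then have M: "norm (h (x, y)) \<le> M" if "norm x \<le> R" "norm y \<le> R" for x y using that by auto
  have M0: "M \<ge> 0" using M[of 0 0] R norm_ge_zero order_trans by (metis less_imp_le norm_zero)
  have hx: "(\<lambda>x. h (x, y)) holomorphic_on cball 0 R" if "norm y \<le> R" for y
    using holo2_slices(1)[OF U(3,1) inU] that
    by (auto simp: holomorphic_on_def field_differentiable_at_within)
  have hy: "(\<lambda>y. h (x, y)) holomorphic_on cball 0 R" if "norm x \<le> R" for x
    using holo2_slices(2)[OF U(3,1) inU] that
    by (auto simp: holomorphic_on_def field_differentiable_at_within)
  define c where "c = (\<lambda>i y. (deriv ^^ i) (\<lambda>x. h (x, y)) 0 / fact i)"
  have cb: "norm (c i y) \<le> M / R ^ i" if y: "y \<in> cball 0 R" for i y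
  proof -
    have ny: "norm y \<le> R" using y by simp
    have "norm ((deriv ^^ i) (\<lambda>x. h (x, y)) 0) \<le> fact i * M / R ^ i"
      by (rule Cauchy_inequality)
         (use hx[OF ny] R M ny in \<open>auto intro: holomorphic_on_subset holomorphic_on_imp_continuous_on\<close>)
    then show ?thesis unfolding c_def by (simp add: norm_divide field_simps)
  qed
  have cs: "(\<lambda>i. c i y * x ^ i) sums h (x, y)" if x: "norm x < R" and y: "y \<in> cball 0 R" for x y
    using holomorphic_power_series[of "\<lambda>x. h (x, y)" 0 R x]
      holomorphic_on_subset[OF hx[of y] ball_subset_cball] x y
    unfolding c_def by auto
  \<comment> \<open>By induction, \<open>c i\<close> is the uniform limit, as x tends to 0, of what
    remains of \<open>h\<close> after the earlier terms are removed, divided by x^i; such limits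
    preserve holomorphy.\<close>
  have ch: "continuous_on (cball 0 R) (c i) \<and> c i holomorphic_on ball 0 R" for i
  proof (induction i rule: less_induct)
    case (less i)
    have "continuous_on (cball 0 R) (\<lambda>y. (h (x, y) - (\<Sum>l<i. c l y * x ^ l)) / x ^ i)
       \<and> (\<lambda>y. (h (x, y) - (\<Sum>l<i. c l y * x ^ l)) / x ^ i) holomorphic_on ball 0 R"
      if x: "x \<noteq> 0" "norm x < R" for x
    proof
      show "continuous_on (cball 0 R) (\<lambda>y. (h (x, y) - (\<Sum>l<i. c l y * x ^ l)) / x ^ i)"
        using less holomorphic_on_imp_continuous_on[OF hy] x by (intro continuous_intros) auto
      show "(\<lambda>y. (h (x, y) - (\<Sum>l<i. c l y * x ^ l)) / x ^ i) holomorphic_on ball 0 R"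
        using less holomorphic_on_subset[OF hy, of x "ball 0 R"] x by (intro holomorphic_intros) auto
    qed
    then have ev: "\<forall>\<^sub>F x in at 0. continuous_on (cball 0 R) (\<lambda>y. (h (x, y) - (\<Sum>l<i. c l y * x ^ l)) / x ^ i)
       \<and> (\<lambda>y. (h (x, y) - (\<Sum>l<i. c l y * x ^ l)) / x ^ i) holomorphic_on ball 0 R"
      unfolding eventually_at using R by (intro exI[of _ R]) auto
    have ul: "uniform_limit (cball 0 R) (\<lambda>x y. (h (x, y) - (\<Sum>l<i. c l y * x ^ l)) / x ^ i) (c i) (at 0)"
      by (rule uniform_limit_coeff[where h = "\<lambda>x y. h (x, y)"]) (use R M0 cb cs in auto)
    show ?case
      by (rule holomorphic_uniform_limit[OF ev ul]) auto
  qed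
  define a where "a = Abs_fps (\<lambda>i. fps_expansion (c i) 0)"
  have "wbound (R / 4) ((2 * M) * (1 / R) ^ i) (fps_nth a i)" for i
  proof -
    \<comment> \<open>Cauchy's inequality on radius \<open>R / 2\<close> gives the growth rate
      \<open>2 / R\<close> in \<open>j\<close>; the radius \<open>R / 4\<close> brings the ratio
      down to 1/2.\<close>
    have "wbound (R / 4) (2 * (M / R ^ i)) (fps_nth a i)"
    proof (rule wbound_geometric[where B = "2 / R"])
      fix j
      have "norm ((deriv ^^ j) (c i) 0) \<le> fact j * (M / R ^ i) / (R / 2) ^ j"
      proof (rule Cauchy_inequality)
        show "c i holomorphic_on ball 0 (R / 2)"
          using ch[of i] R by (auto intro: holomorphic_on_subset)
        show "continuous_on (cball 0 (R / 2)) (c i)"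
          using ch[of i] R by (auto intro: continuous_on_subset)
      qed (use R cb in auto)
      then show "norm (fps_nth (fps_nth a i) j) \<le> M / R ^ i * (2 / R) ^ j"
        unfolding a_def fps_expansion_def by (simp add: norm_divide field_simps)
    qed (use R M0 in auto)
    then show ?thesis by (simp add: power_divide)
  qed
  then have ca: "conv2 a" unfolding conv2_def using R by (intro exI[of _ "R / 4"]) auto
  have "h z = ev a z" if z: "z \<in> bidisc R" for z
  proof -
    obtain x y where xy: "z = (x, y)" by (cases z)
    have n: "norm x < R" "norm y < R" using z unfolding bidisc_def xy by auto
    have "eval_fps (fps_nth a i) y = c i y" for i
      using eval_fps_expansion'[of "c i" 0 "ereal R" y] ch[of i] n unfolding a_def by auto
    then have "ev a z = (\<Sum>i. c i y * x ^ i)" unfolding ev_altdef xy by simp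
    also have "\<dots> = h z" using sums_unique[OF cs[OF n(1), of y]] n unfolding xy by simp
    finally show ?thesis by simp
  qed
  then have "germ_eq h (ev a)" unfolding germ_eq_def eventually_nhds_bidisc using R by blast
  then show ?thesis using ca unfolding rep_def by blast
qed

section \<open>Polynomial dependence on parameters\<close>

lemma fam_ring_fps:
  assumes P: "fam_ring P"
  shows "fam_ring (\<lambda>a. \<forall>n. P (\<lambda>l. fps_nth (a l) n))"
  unfolding fam_ring_def[of "\<lambda>a. \<forall>n. P (\<lambda>l. fps_nth (a l) n)"]
proof (intro conjI allI impI)
  fix n
  show "P (\<lambda>l. fps_nth 0 n)" "P (\<lambda>l. fps_nth 1 n)" using fam_ringD(1,2)[OF P] by (cases n, auto)+
next
  fix a n assume "\<forall>n. P (\<lambda>l. fps_nth (a l) n)"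
  then show "P (\<lambda>l. fps_nth (- a l) n)" using fam_ringD(3)[OF P] by simp
next
  fix a b n assume "\<forall>n. P (\<lambda>l. fps_nth (a l) n)" "\<forall>n. P (\<lambda>l. fps_nth (b l) n)"
  then show "P (\<lambda>l. fps_nth (a l + b l) n)" using fam_ringD(4)[OF P] by simp
next
  fix a b n assume "\<forall>n. P (\<lambda>l. fps_nth (a l) n)" "\<forall>n. P (\<lambda>l. fps_nth (b l) n)"
  then show "P (\<lambda>l. fps_nth (a l * b l) n)"
    unfolding fps_mult_nth by (intro fam_ring_sum[OF P] fam_ringD(5)[OF P]) auto
qed

lemma fam_ring_diff: "fam_ring P \<Longrightarrow> P a \<Longrightarrow> P b \<Longrightarrow> P (\<lambda>l. a l - b l)"
  using fam_ringD(4)[of P a "\<lambda>l. - b l"] fam_ringD(3)[of P b] by simp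

text \<open>The recursion for the inverse of a power series divides by its constant coefficient
  only.\<close>

lemma fam_ring_inverse:
  fixes f :: "'l \<Rightarrow> complex fps"
  assumes P: "fam_ring P" and f: "\<And>n. P (\<lambda>l. fps_nth (f l) n)" and i: "P (\<lambda>l. inverse (fps_nth (f l) 0))"
  shows "P (\<lambda>l. fps_nth (inverse (f l)) n)"
proof (induction n rule: less_induct)
  case (less n)
  show ?case
  proof (cases n)
    case 0
    then show ?thesis using i by simp
  next
    case (Suc m)
    have "(\<lambda>l. fps_nth (inverse (f l)) n) = (\<lambda>l. - inverse (fps_nth (f l) 0)
        * (\<Sum>i = 1..n. fps_nth (f l) i * fps_nth (inverse (f l)) (n - i)))"
      unfolding fps_inverse_def Suc by simp
    moreover have "P (\<lambda>l. - inverse (fps_nth (f l) 0)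
        * (\<Sum>i = 1..n. fps_nth (f l) i * fps_nth (inverse (f l)) (n - i)))"
      using Suc by (intro fam_ringD(5)[OF P] fam_ringD(3)[OF P] fam_ring_sum[OF P] i f less) auto
    ultimately show ?thesis by simp
  qed
qed

text \<open>The recursion of Weierstrass division consists of ring operations apart from one
  inversion, that of the coefficient of y^d in F(0, y).\<close>

lemma fam_ring_wrem:
  fixes F h :: "'l \<Rightarrow> complex fps fps"
  assumes P: "fam_ring P" and F: "\<And>i j. P (\<lambda>l. fps_nth (fps_nth (F l) i) j)"
    and h: "\<And>i j. P (\<lambda>l. fps_nth (fps_nth (h l) i) j)"
    and u: "P (\<lambda>l. inverse (fps_nth (fps_nth (F l) 0) d))"
  shows "P (\<lambda>l. fps_nth (fps_nth (wrem d (F l) (h l)) i) j)"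
proof -
  define Q where "Q = (\<lambda>a. \<forall>n. P (\<lambda>l. fps_nth (a l) n))"
  have Q: "fam_ring Q" unfolding Q_def by (rule fam_ring_fps[OF P])
  have QF: "Q (\<lambda>l. fps_nth (F l) i)" and Qh: "Q (\<lambda>l. fps_nth (h l) i)" for i
    unfolding Q_def using F h by auto
  have Qs: "Q a \<Longrightarrow> Q (\<lambda>l. fps_shift d (a l))" for a unfolding Q_def by simp
  have Qc: "Q (\<lambda>l. fps_cutoff d (a l))" if "Q a" for a
    unfolding Q_def
  proof
    fix n
    show "P (\<lambda>l. fps_nth (fps_cutoff d (a l)) n)"
      using that fam_ringD(1)[OF P] unfolding Q_def by (cases "n < d") auto
  qed
  have Qu: "Q (\<lambda>l. inverse (fps_shift d (fps_nth (F l) 0)))"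
    unfolding Q_def using F u by (intro allI fam_ring_inverse[OF P]) auto
  have Qq: "Q (\<lambda>l. wq d (F l) (h l) i)" for i
  proof (induction i rule: less_induct)
    case (less i)
    show ?case by (subst wq.simps)
      (intro fam_ringD(5)[OF Q] Qs fam_ring_diff[OF Q] fam_ring_sum[OF Q] QF Qh Qu less; simp)
  qed
  have "Q (\<lambda>l. fps_nth (wrem d (F l) (h l)) i)"
    unfolding wrem_def fps_nth_Abs_fps
    by (intro fam_ringD(5)[OF Q] Qc fam_ring_diff[OF Q] fam_ring_sum[OF Q] QF Qh Qq)
  then show ?thesis unfolding Q_def by simp
qed

lemma fam_ring_mult_cp:
  fixes F G :: "'l \<Rightarrow> complex fps fps"
  assumes P: "fam_ring P" and F: "\<And>i j. P (\<lambda>l. fps_nth (fps_nth (F l) i) j)"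
    and G: "\<And>i j. P (\<lambda>l. fps_nth (fps_nth (G l) i) j)"
    and u: "P (\<lambda>l. inverse (fps_nth (fps_nth (F l) 0) d))"
  shows "P (\<lambda>l. fps_nth (coeff (mult_cp d (F l) (G l)) k) i)"
proof -
  define Q where "Q = (\<lambda>a. \<forall>n. P (\<lambda>l. fps_nth (a l) n))"
  have Q: "fam_ring Q" unfolding Q_def by (rule fam_ring_fps[OF P])
  have "P (\<lambda>l. fps_nth (fps_nth (G l * fps_const (fps_X ^ m)) i) j)" for m i j
    using G fam_ringD(1)[OF P]
    by (cases "j < m") (simp_all add: fps_mult_right_const_nth fps_X_power_mult_right_nth)
  then have "Q (\<lambda>l. ycoeff j (wrem d (F l) (G l * fps_const (fps_X ^ i))))" for i j
    unfolding Q_def ycoeff_def fps_nth_Abs_fps by (intro allI fam_ring_wrem[OF P] F u)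
  then have "Q (\<lambda>l. coeff (mult_cp d (F l) (G l)) k)"
    unfolding mult_cp_def mult_mat_def by (intro fam_ring_char_poly[OF Q])
  then show ?thesis unfolding Q_def by simp
qed

text \<open>Agreement is asked on \<open>V\<close> only: the inverse of a leading coefficient
  becomes polynomial on the set where an extra coordinate equals that inverse.\<close>

definition agree_alg :: "'l set \<Rightarrow> ('l \<Rightarrow> complex) set \<Rightarrow> ('l \<Rightarrow> complex) \<Rightarrow> bool" where
  "agree_alg V B a \<longleftrightarrow> (\<exists>v\<in>fun_alg B. \<forall>l\<in>V. a l = v l)"

lemma fam_ring_agree_alg: "fam_ring (agree_alg V B)"
  unfolding fam_ring_def
proof (intro conjI allI impI)
  show "agree_alg V B (\<lambda>_. 0)" "agree_alg V B (\<lambda>_. 1)"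
    unfolding agree_alg_def
    by (rule bexI[OF _ fun_alg.const[of 0]], simp) (rule bexI[OF _ fun_alg.const[of 1]], simp)
next
  fix a assume "agree_alg V B a"
  then obtain v where v: "v \<in> fun_alg B" "\<forall>l\<in>V. a l = v l" unfolding agree_alg_def by auto
  have "(\<lambda>l. (-1) * v l) \<in> fun_alg B" by (rule fun_alg.mult[OF fun_alg.const v(1)])
  then show "agree_alg V B (\<lambda>l. - a l)" unfolding agree_alg_def using v(2) by force
next
  fix a b assume "agree_alg V B a" "agree_alg V B b"
  then obtain v w where v: "v \<in> fun_alg B" "\<forall>l\<in>V. a l = v l" and w: "w \<in> fun_alg B" "\<forall>l\<in>V. b l = w l"
    unfolding agree_alg_def by auto
  show "agree_alg V B (\<lambda>l. a l + b l)" unfolding agree_alg_def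
    by (rule bexI[OF _ fun_alg.add[OF v(1) w(1)]]) (use v w in auto)
  show "agree_alg V B (\<lambda>l. a l * b l)" unfolding agree_alg_def
    by (rule bexI[OF _ fun_alg.mult[OF v(1) w(1)]]) (use v w in auto)
qed

lemma agree_alg_zeros_stable:
  fixes a :: "nat \<Rightarrow> 'l \<Rightarrow> complex"
  assumes "finite B" "\<And>i. agree_alg V B (a i)"
  shows "\<exists>N. \<forall>l\<in>V. (\<exists>i. a i l \<noteq> 0) \<longrightarrow> (\<exists>i<N. a i l \<noteq> 0)"
proof -
  have "\<forall>i. \<exists>v. v \<in> fun_alg B \<and> (\<forall>l\<in>V. a i l = v l)" using assms(2) unfolding agree_alg_def by blast
  then obtain v where v: "\<And>i. v i \<in> fun_alg B" "\<And>i l. l \<in> V \<Longrightarrow> a i l = v i l" by metis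
  obtain N where "\<forall>l. (\<forall>i<N. v i l = 0) \<longrightarrow> (\<forall>i. v i l = 0)"
    using fun_alg_zeros_stable[of B v, OF assms(1) v(1)] by auto
  then show ?thesis using v(2) by (intro exI[of _ N]) auto
qed

text \<open>A parameter is a triple of coefficient families (of V1, V2, F, G, indexed by 0, 1, 2, 3; for
  F and G the component index is a dummy), a point, and a number inverting a leading coefficient.\<close>

type_synonym 'n param = "(nat \<Rightarrow> 'n \<Rightarrow> ('n \<Rightarrow> nat) \<Rightarrow> complex) \<times> (complex ^ 'n) \<times> complex"

section \<open>Taylor coefficients along a leaf as functions of the parameters\<close>

definition exponents :: "nat \<Rightarrow> ('n::finite \<Rightarrow> nat) set" where
  "exponents d = {\<alpha>. (\<Sum>i\<in>UNIV. \<alpha> i) \<le> d}"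

definition pev :: "nat \<Rightarrow> (('n::finite \<Rightarrow> nat) \<Rightarrow> complex) \<Rightarrow> complex ^ 'n \<Rightarrow> complex" where
  "pev d c x = (\<Sum>\<alpha>\<in>exponents d. c \<alpha> * (\<Prod>i\<in>UNIV. (vec_nth x i) ^ (\<alpha> i)))"

lemma poly_fun_iff: "poly_fun d P \<longleftrightarrow> (\<exists>c. P = pev d c)"
  unfolding poly_fun_def pev_def[abs_def] exponents_def ..

lemma finite_exponents: "finite (exponents d :: ('n::finite \<Rightarrow> nat) set)"
proof (rule finite_subset)
  show "exponents d \<subseteq> PiE UNIV (\<lambda>_::'n. {..d})"
  proof
    fix \<alpha> :: "'n \<Rightarrow> nat" assume "\<alpha> \<in> exponents d"
    then have "\<alpha> i \<le> d" for i
      using member_le_sum[of i UNIV \<alpha>] unfolding exponents_def by (auto intro: order_trans)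
    then show "\<alpha> \<in> PiE UNIV (\<lambda>_. {..d})" by auto
  qed
qed (auto intro: finite_PiE)

lemma poly_fun_mono:
  fixes P :: "complex ^ 'n \<Rightarrow> complex"
  assumes "poly_fun d P" "d \<le> e" shows "poly_fun e P"
proof -
  obtain c where c: "P = pev d c" using assms(1) unfolding poly_fun_iff by auto
  have "pev d c = pev e (\<lambda>\<alpha>. if \<alpha> \<in> exponents d then c \<alpha> else 0)"
  proof
    fix x
    show "pev d c x = pev e (\<lambda>\<alpha>. if \<alpha> \<in> exponents d then c \<alpha> else 0) x"
      unfolding pev_def
      by (rule sum.mono_neutral_cong_left)
         (use assms(2) finite_exponents in \<open>auto simp: exponents_def\<close>)
  qed
  then show ?thesis unfolding c poly_fun_iff by blast
qed

definition gens :: "nat \<Rightarrow> ('n::finite param \<Rightarrow> complex) set" where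
  "gens E = (\<lambda>(k, i, \<alpha>) (c, x, t). c k i \<alpha>) ` ({..<4} \<times> UNIV \<times> exponents E)
     \<union> (\<lambda>i (c, x, t). vec_nth x i) ` UNIV \<union> {\<lambda>(c, x, t). t}"

lemma finite_gens: "finite (gens E)"
  unfolding gens_def by (intro finite_UnI finite_imageI finite_cartesian_product finite_exponents) auto

definition vfield :: "nat \<Rightarrow> (nat \<Rightarrow> 'n::finite \<Rightarrow> ('n \<Rightarrow> nat) \<Rightarrow> complex) \<Rightarrow> nat \<Rightarrow> complex ^ 'n \<Rightarrow> complex ^ 'n" where
  "vfield E c k x = (\<chi> i. pev E (c k i) x)"

lemma fun_alg_sum: "(\<And>i. i \<in> I \<Longrightarrow> f i \<in> fun_alg B) \<Longrightarrow> (\<lambda>l. \<Sum>i\<in>I. f i l) \<in> fun_alg B"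
  by (induction I rule: infinite_finite_induct) (auto intro: fun_alg.intros)

lemma fun_alg_prod: "(\<And>i. i \<in> I \<Longrightarrow> f i \<in> fun_alg B) \<Longrightarrow> (\<lambda>l. \<Prod>i\<in>I. f i l) \<in> fun_alg B"
  by (induction I rule: infinite_finite_induct) (auto intro: fun_alg.intros)

lemma fun_alg_power: "f \<in> fun_alg B \<Longrightarrow> (\<lambda>l. f l ^ n) \<in> fun_alg B"
  by (induction n) (auto intro: fun_alg.intros)

lemma pev_fun_alg:
  assumes "k < 4" shows "(\<lambda>(c, x, t). pev E (c k i) x) \<in> fun_alg (gens E)"
proof -
  have c: "(\<lambda>(c, x, t). c k i \<alpha>) \<in> fun_alg (gens E)" if "\<alpha> \<in> exponents E" for \<alpha>
    using assms that by (intro fun_alg.gen) (force simp: gens_def)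
  have x: "(\<lambda>(c, x, t). vec_nth x i) \<in> fun_alg (gens E)" for i
    by (intro fun_alg.gen) (force simp: gens_def)
  have "(\<lambda>l. \<Sum>\<alpha>\<in>exponents E. (case l of (c, x, t) \<Rightarrow> c k i \<alpha>)
      * (\<Prod>j\<in>UNIV. (case l of (c, x, t) \<Rightarrow> vec_nth x j) ^ (\<alpha> j))) \<in> fun_alg (gens E)"
    by (intro fun_alg_sum fun_alg.mult fun_alg_prod fun_alg_power x c)
  then show ?thesis unfolding pev_def by (simp add: case_prod_unfold)
qed

text \<open>The algebra is stable under the Lie derivatives along both fields, with \<open>c\<close>
  and \<open>t\<close> held constant: coordinates go to components of the fields, and the product
  rule does the rest. Complex linearity of \<open>D\<close> is carried along for holomorphy on the
  leaf.\<close>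

lemma fun_alg_derivations:
  fixes u :: "'n::finite param \<Rightarrow> complex"
  assumes "u \<in> fun_alg (gens E)"
  shows "\<exists>u1\<in>fun_alg (gens E). \<exists>u2\<in>fun_alg (gens E). \<forall>c x t. \<exists>D. ((\<lambda>x. u (c, x, t)) has_derivative D) (at x)
     \<and> (\<forall>a v. D (a *s v) = a * D v) \<and> D (vfield E c 0 x) = u1 (c, x, t) \<and> D (vfield E c 1 x) = u2 (c, x, t)"
  using assms
proof induction
  case (const a)
  show ?case
    by (intro bexI[of _ "\<lambda>_. 0"] allI exI[of _ "\<lambda>_. 0"]) (auto intro: fun_alg.const)
next
  case (gen b)
  then consider (c) k i \<alpha> where "b = (\<lambda>(c, x, t). c k i \<alpha>)" | (x) i where "b = (\<lambda>(c, x, t). vec_nth x i)"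
    | (t) "b = (\<lambda>(c, x, t). t)"
    unfolding gens_def by auto
  then show ?case
  proof cases
    case x
    have "((\<lambda>x. b (c, x, t)) has_derivative (\<lambda>v. vec_nth v i)) (at x)" for c x t
      unfolding x by (auto intro!: bounded_linear_imp_has_derivative bounded_linear_vec_nth)
    then show ?thesis
      using pev_fun_alg[of 0 E i] pev_fun_alg[of 1 E i]
      by (intro bexI[of _ "\<lambda>(c, x, t). pev E (c 0 i) x"] bexI[of _ "\<lambda>(c, x, t). pev E (c 1 i) x"]
          allI exI[of _ "\<lambda>v. vec_nth v i"]) (auto simp: vfield_def)
  next
    case c
    then show ?thesis
      by (intro bexI[of _ "\<lambda>_. 0"] allI exI[of _ "\<lambda>_. 0"]) (auto intro: fun_alg.const)
  next
    case t
    then show ?thesis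
      by (intro bexI[of _ "\<lambda>_. 0"] allI exI[of _ "\<lambda>_. 0"]) (auto intro: fun_alg.const)
  qed
next
  case (add u v)
  then obtain u1 u2 v1 v2 where
    S: "u1 \<in> fun_alg (gens E)" "u2 \<in> fun_alg (gens E)" "v1 \<in> fun_alg (gens E)" "v2 \<in> fun_alg (gens E)" and
    u: "\<And>c x t. \<exists>D. ((\<lambda>x. u (c, x, t)) has_derivative D) (at x)
     \<and> (\<forall>a v. D (a *s v) = a * D v) \<and> D (vfield E c 0 x) = u1 (c, x, t) \<and> D (vfield E c 1 x) = u2 (c, x, t)" and
    v: "\<And>c x t. \<exists>D. ((\<lambda>x. v (c, x, t)) has_derivative D) (at x)
     \<and> (\<forall>a v. D (a *s v) = a * D v) \<and> D (vfield E c 0 x) = v1 (c, x, t) \<and> D (vfield E c 1 x) = v2 (c, x, t)"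
    by blast
  show ?case
  proof (rule bexI[of _ "\<lambda>l. u1 l + v1 l"], rule bexI[of _ "\<lambda>l. u2 l + v2 l"], intro allI)
    fix c x t
    obtain D where D: "((\<lambda>x. u (c, x, t)) has_derivative D) (at x)" "\<forall>a v. D (a *s v) = a * D v"
      "D (vfield E c 0 x) = u1 (c, x, t)" "D (vfield E c 1 x) = u2 (c, x, t)" using u by blast
    obtain D' where D': "((\<lambda>x. v (c, x, t)) has_derivative D') (at x)" "\<forall>a v. D' (a *s v) = a * D' v"
      "D' (vfield E c 0 x) = v1 (c, x, t)" "D' (vfield E c 1 x) = v2 (c, x, t)" using v by blast
    show "\<exists>D. ((\<lambda>x. u (c, x, t) + v (c, x, t)) has_derivative D) (at x) \<and> (\<forall>a v. D (a *s v) = a * D v)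
       \<and> D (vfield E c 0 x) = u1 (c, x, t) + v1 (c, x, t) \<and> D (vfield E c 1 x) = u2 (c, x, t) + v2 (c, x, t)"
      by (rule exI[of _ "\<lambda>w. D w + D' w"])
         (use D D' in \<open>auto intro!: has_derivative_add simp: distrib_left\<close>)
  qed (use S in \<open>auto intro: fun_alg.intros\<close>)
next
  case (mult u v)
  then obtain u1 u2 v1 v2 where
    S: "u1 \<in> fun_alg (gens E)" "u2 \<in> fun_alg (gens E)" "v1 \<in> fun_alg (gens E)" "v2 \<in> fun_alg (gens E)" and
    u: "\<And>c x t. \<exists>D. ((\<lambda>x. u (c, x, t)) has_derivative D) (at x)
     \<and> (\<forall>a v. D (a *s v) = a * D v) \<and> D (vfield E c 0 x) = u1 (c, x, t) \<and> D (vfield E c 1 x) = u2 (c, x, t)" and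
    v: "\<And>c x t. \<exists>D. ((\<lambda>x. v (c, x, t)) has_derivative D) (at x)
     \<and> (\<forall>a v. D (a *s v) = a * D v) \<and> D (vfield E c 0 x) = v1 (c, x, t) \<and> D (vfield E c 1 x) = v2 (c, x, t)"
    by blast
  show ?case
  proof (rule bexI[of _ "\<lambda>l. u l * v1 l + u1 l * v l"], rule bexI[of _ "\<lambda>l. u l * v2 l + u2 l * v l"], intro allI)
    fix c x t
    obtain D where D: "((\<lambda>x. u (c, x, t)) has_derivative D) (at x)" "\<forall>a v. D (a *s v) = a * D v"
      "D (vfield E c 0 x) = u1 (c, x, t)" "D (vfield E c 1 x) = u2 (c, x, t)" using u by blast
    obtain D' where D': "((\<lambda>x. v (c, x, t)) has_derivative D') (at x)" "\<forall>a v. D' (a *s v) = a * D' v"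
      "D' (vfield E c 0 x) = v1 (c, x, t)" "D' (vfield E c 1 x) = v2 (c, x, t)" using v by blast
    show "\<exists>D. ((\<lambda>x. u (c, x, t) * v (c, x, t)) has_derivative D) (at x) \<and> (\<forall>a v. D (a *s v) = a * D v)
       \<and> D (vfield E c 0 x) = u (c, x, t) * v1 (c, x, t) + u1 (c, x, t) * v (c, x, t)
       \<and> D (vfield E c 1 x) = u (c, x, t) * v2 (c, x, t) + u2 (c, x, t) * v (c, x, t)"
      by (rule exI[of _ "\<lambda>w. u (c, x, t) * D' w + D w * v (c, x, t)"])
         (intro conjI has_derivative_mult[OF D(1) D'(1)]; use D(2-4) D'(2-4) in \<open>simp add: algebra_simps\<close>)
  qed (use S mult.hyps in \<open>auto intro: fun_alg.intros\<close>)
qed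

text \<open>Partial derivatives in the two times are Lie derivatives along the fields. The Taylor
  coefficients at 0 are therefore iterated derivations evaluated at \<open>p\<close>, divided by
  factorials, and one family of functions serves all leaves.\<close>

lemma taylor_family:
  fixes u :: "'n::finite param \<Rightarrow> complex"
  assumes "u \<in> fun_alg (gens E)"
  shows "\<exists>T. (\<forall>i j. T i j \<in> fun_alg (gens E)) \<and> (\<forall>c p t \<phi> U. leaf_param (vfield E c 0) (vfield E c 1) p \<phi> U \<longrightarrow>
    rep (\<lambda>z. u (c, \<phi> z, t)) (Abs_fps (\<lambda>i. Abs_fps (\<lambda>j. T i j (c, p, t)))))"
proof -
  let ?S = "fun_alg (gens E) :: ('n param \<Rightarrow> complex) set"
  have "\<forall>u\<in>?S. \<exists>u1 u2. u1 \<in> ?S \<and> u2 \<in> ?S \<and> (\<forall>c x t. \<exists>D. ((\<lambda>x. u (c, x, t)) has_derivative D) (at x)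
     \<and> (\<forall>a v. D (a *s v) = a * D v) \<and> D (vfield E c 0 x) = u1 (c, x, t) \<and> D (vfield E c 1 x) = u2 (c, x, t))"
    using fun_alg_derivations by blast
  then obtain \<delta>1 where "\<forall>u\<in>?S. \<exists>u2. \<delta>1 u \<in> ?S \<and> u2 \<in> ?S \<and> (\<forall>c x t. \<exists>D. ((\<lambda>x. u (c, x, t)) has_derivative D) (at x)
     \<and> (\<forall>a v. D (a *s v) = a * D v) \<and> D (vfield E c 0 x) = \<delta>1 u (c, x, t) \<and> D (vfield E c 1 x) = u2 (c, x, t))"
    unfolding bchoice_iff by blast
  then obtain \<delta>2 where \<delta>: "\<forall>u\<in>?S. \<delta>1 u \<in> ?S \<and> \<delta>2 u \<in> ?S \<and> (\<forall>c x t. \<exists>D. ((\<lambda>x. u (c, x, t)) has_derivative D) (at x)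
     \<and> (\<forall>a v. D (a *s v) = a * D v) \<and> D (vfield E c 0 x) = \<delta>1 u (c, x, t) \<and> D (vfield E c 1 x) = \<delta>2 u (c, x, t))"
    unfolding bchoice_iff by blast
  then have S1: "\<delta>1 u \<in> ?S" and S2: "\<delta>2 u \<in> ?S" if "u \<in> ?S" for u using that by auto
  have S1n: "(\<delta>1 ^^ i) u \<in> ?S" if "u \<in> ?S" for u i using that S1 by (induction i) auto
  have S2n: "(\<delta>2 ^^ i) u \<in> ?S" if "u \<in> ?S" for u i using that S2 by (induction i) auto
  define T where "T = (\<lambda>i j l. (1 / (fact i * fact j)) * (\<delta>2 ^^ j) ((\<delta>1 ^^ i) u) l)"
  have TS: "T i j \<in> ?S" for i j
    unfolding T_def using S1n S2n assms by (intro fun_alg.mult fun_alg.const) auto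
  have "rep (\<lambda>z. u (c, \<phi> z, t)) (Abs_fps (\<lambda>i. Abs_fps (\<lambda>j. T i j (c, p, t))))"
    if leaf: "leaf_param (vfield E c 0) (vfield E c 1) p \<phi> U" for c p t \<phi> U
  proof -
    have U: "open U" "0 \<in> U" "\<phi> 0 = p" using leaf unfolding leaf_param_def by auto
    have der: "\<exists>D. ((\<lambda>z. v (c, \<phi> z, t)) has_derivative D) (at z) \<and> (\<forall>a w. D (cscale2 a w) = a * D w)
        \<and> D (1, 0) = \<delta>1 v (c, \<phi> z, t) \<and> D (0, 1) = \<delta>2 v (c, \<phi> z, t)" if v: "v \<in> ?S" and z: "z \<in> U" for v z
    proof -
      obtain D where D: "(\<phi> has_derivative D) (at z)" "\<forall>c w. D (cscale2 c w) = c *s D w"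
        "D (1, 0) = vfield E c 0 (\<phi> z)" "D (0, 1) = vfield E c 1 (\<phi> z)"
        using leaf z unfolding leaf_param_def by blast
      obtain D' where D': "((\<lambda>x. v (c, x, t)) has_derivative D') (at (\<phi> z))" "\<forall>a v. D' (a *s v) = a * D' v"
        "D' (vfield E c 0 (\<phi> z)) = \<delta>1 v (c, \<phi> z, t)" "D' (vfield E c 1 (\<phi> z)) = \<delta>2 v (c, \<phi> z, t)"
        using \<delta> v by blast
      show ?thesis
        using has_derivative_compose[OF D(1) D'(1)] D D' by (intro exI[of _ "\<lambda>w. D' (D w)"]) auto
    qed
    have "germ_hol (\<lambda>z. v (c, \<phi> z, t))" if "v \<in> ?S" for v
    proof -
      have "holo2_on (\<lambda>z. v (c, \<phi> z, t)) U"
        unfolding holo2_on_def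
      proof
        fix z assume "z \<in> U"
        from der[OF that this] show "\<exists>D. ((\<lambda>z. v (c, \<phi> z, t)) has_derivative D) (at z)
            \<and> (\<forall>a w. D (cscale2 a w) = a * D w)" by (elim exE conjE) (intro exI conjI)
      qed
      then show ?thesis unfolding germ_hol_def using U(1,2) by (intro exI[of _ U]) simp
    qed
    then have "\<forall>v. \<exists>a. v \<in> ?S \<longrightarrow> rep (\<lambda>z. v (c, \<phi> z, t)) a" using germ_hol_rep by simp
    from choice[OF this] obtain A where "\<forall>v. v \<in> ?S \<longrightarrow> rep (\<lambda>z. v (c, \<phi> z, t)) (A v)" ..
    then have A: "\<And>v. v \<in> ?S \<Longrightarrow> rep (\<lambda>z. v (c, \<phi> z, t)) (A v)" by simp
    have rd: "rep (\<lambda>z. \<delta>1 v (c, \<phi> z, t)) (fps_deriv (A v)) \<and> rep (\<lambda>z. \<delta>2 v (c, \<phi> z, t)) (ydiff (A v))"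
      if "v \<in> ?S" for v
    proof (rule rep_partial[OF A[OF that] U(1,2)])
      fix z assume "z \<in> U"
      from der[OF that this] show "\<exists>D. ((\<lambda>z. v (c, \<phi> z, t)) has_derivative D) (at z)
          \<and> D (1, 0) = \<delta>1 v (c, \<phi> z, t) \<and> D (0, 1) = \<delta>2 v (c, \<phi> z, t)"
        by (elim exE conjE) (intro exI conjI)
    qed
    have A1: "A (\<delta>1 v) = fps_deriv (A v)" if "v \<in> ?S" for v
      using rep_unique[OF A[OF S1[OF that]]] rd[OF that] by auto
    have A2: "A (\<delta>2 v) = ydiff (A v)" if "v \<in> ?S" for v
      using rep_unique[OF A[OF S2[OF that]]] rd[OF that] by auto
    have o: "fps_nth (fps_nth (A v) 0) 0 = v (c, p, t)" if "v \<in> ?S" for v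
      using rep_origin[OF A[OF that]] U(3) by simp
    have y: "fps_nth (fps_nth (A v) 0) j = (\<delta>2 ^^ j) v (c, p, t) / fact j" if "v \<in> ?S" for v j
      using that
    proof (induction j arbitrary: v)
      case (Suc j)
      have "fps_nth (fps_nth (A (\<delta>2 v)) 0) j = of_nat (Suc j) * fps_nth (fps_nth (A v) 0) (Suc j)"
        unfolding A2[OF Suc.prems] ydiff_def by simp
      moreover have "fps_nth (fps_nth (A (\<delta>2 v)) 0) j = (\<delta>2 ^^ Suc j) v (c, p, t) / fact j"
        using Suc.IH[OF S2[OF Suc.prems]] by (simp add: funpow_swap1)
      ultimately show ?case by (simp add: field_simps del: of_nat_Suc)
    qed (simp add: o)
    have x: "fps_nth (fps_nth (A v) i) j = (\<delta>2 ^^ j) ((\<delta>1 ^^ i) v) (c, p, t) / (fact i * fact j)" if "v \<in> ?S" for v i j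
      using that
    proof (induction i arbitrary: v)
      case (Suc i)
      have "fps_nth (fps_nth (A (\<delta>1 v)) i) j = of_nat (Suc i) * fps_nth (fps_nth (A v) (Suc i)) j"
        unfolding A1[OF Suc.prems] by (simp add: fps_of_nat[symmetric] del: of_nat_Suc)
      moreover have "fps_nth (fps_nth (A (\<delta>1 v)) i) j = (\<delta>2 ^^ j) ((\<delta>1 ^^ Suc i) v) (c, p, t) / (fact i * fact j)"
        using Suc.IH[OF S1[OF Suc.prems]] by (simp add: funpow_swap1)
      ultimately show ?case by (simp add: field_simps del: of_nat_Suc)
    qed (simp add: y)
    have "A u = Abs_fps (\<lambda>i. Abs_fps (\<lambda>j. T i j (c, p, t)))"
      by (intro fps_ext) (simp add: x[OF assms] T_def)
    then show ?thesis using A[OF assms] by simp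
  qed
  then show ?thesis using TS by blast
qed

section \<open>The bound in the regular case\<close>

lemma ev_0 [simp]: "ev 0 z = 0"
  unfolding ev_def yslice_def by (simp add: eval_fps_def)

lemma rep_germ_eq: "rep h a \<Longrightarrow> rep k a \<Longrightarrow> germ_eq h k"
  unfolding rep_def by (meson germ_eq_sym germ_eq_trans)

text \<open>The assumption concerns irreducible germs, the algebra needs all nonunit series. A
  nonunit common factor yields an irreducible one, whose irreducibility and divisibilities pass to
  germs through \<open>rep\<close>.\<close>

lemma no_common_factor_if_no_irreducible:
  assumes f: "yreg d a" and rep: "rep f a" "rep G b"
    and irr: "\<And>q. germ_irred q \<Longrightarrow> germ_dvd q f \<Longrightarrow> \<not> germ_dvd q G"
    and q: "conv2 q" "cdvd q a" "cdvd q b"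
  shows "fps_nth (fps_nth q 0) 0 \<noteq> 0"
proof
  assume "fps_nth (fps_nth q 0) 0 = 0"
  then obtain p where p: "conv2 p" "cdvd p a" "cdvd p b" "fps_nth (fps_nth p 0) 0 = 0" "p \<noteq> 0"
    "\<And>a b. conv2 a \<Longrightarrow> conv2 b \<Longrightarrow> p = a * b \<Longrightarrow> fps_nth (fps_nth a 0) 0 \<noteq> 0 \<or> fps_nth (fps_nth b 0) 0 \<noteq> 0"
    using irreducible_common_factor[OF f q] by blast
  have rp: "rep (ev p) p" using p(1) by (rule rep_ev)
  have dvd: "germ_dvd (ev p) h" if h: "rep h e" and e: "cdvd p e" for h e
  proof -
    obtain c where c: "conv2 c" "e = p * c" using e unfolding cdvd_def by auto
    have "rep (\<lambda>z. ev p z * ev c z) e" unfolding c(2) by (rule rep_mult[OF rp rep_ev[OF c(1)]])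
    then have "germ_eq h (\<lambda>z. ev p z * ev c z)" by (rule rep_germ_eq[OF h])
    then show ?thesis unfolding germ_dvd_def using germ_hol_ev[OF c(1)] by blast
  qed
  have "\<not> germ_eq (ev p) (\<lambda>_. 0)"
    using ev_inj[OF p(1) conv2_0] p(5) unfolding germ_eq_def by auto
  moreover have "germ_unit u \<or> germ_unit v"
    if uv: "germ_hol u" "germ_hol v" "germ_eq (ev p) (\<lambda>z. u z * v z)" for u v
  proof -
    obtain u' v' where r: "rep u u'" "rep v v'" using germ_hol_rep uv by metis
    have "p = u' * v'" by (rule rep_unique[OF rp rep_mult[OF r] uv(3)])
    then have "fps_nth (fps_nth u' 0) 0 \<noteq> 0 \<or> fps_nth (fps_nth v' 0) 0 \<noteq> 0"
      using p(6) r unfolding rep_def by blast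
    then show ?thesis using uv rep_origin[OF r(1)] rep_origin[OF r(2)] unfolding germ_unit_def by auto
  qed
  ultimately have "germ_irred (ev p)"
    unfolding germ_irred_def germ_unit_def using germ_hol_ev[OF p(1)] p(4) ev_origin[of p] by auto
  then show False using irr dvd[OF rep(1) p(2)] dvd[OF rep(2) p(3)] by blast
qed

text \<open>The monomials x^i y^j are numbered by n = i * N + j, to fit the single index in
  \<open>quot_dim_le\<close>.\<close>

lemma ev_finite_support:
  assumes "\<And>i j. M \<le> i \<or> N \<le> j \<Longrightarrow> fps_nth (fps_nth p i) j = 0"
  shows "ev p z = (\<Sum>n<M * N. fps_nth (fps_nth p (n div N)) (n mod N) * (fst z ^ (n div N) * snd z ^ (n mod N)))"
    (is "_ = (\<Sum>n<_. ?t n)")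
proof -
  have e: "eval_fps (fps_nth p i) (snd z) = (\<Sum>j<N. fps_nth (fps_nth p i) j * snd z ^ j)" for i
    unfolding eval_fps_def by (rule suminf_finite) (use assms in auto)
  have "ev p z = (\<Sum>i<M. eval_fps (fps_nth p i) (snd z) * fst z ^ i)"
    unfolding ev_altdef by (rule suminf_finite) (use assms in \<open>auto simp: e\<close>)
  also have "\<dots> = (\<Sum>i<M. \<Sum>n = i * N..<i * N + N. ?t n)"
  proof (rule sum.cong)
    fix i assume "i \<in> {..<M}"
    have "(\<Sum>n = i * N..<i * N + N. ?t n) = (\<Sum>j<N. ?t (i * N + j))"
      using sum.atLeastLessThan_shift_0[of ?t "i * N" "i * N + N"] by (simp add: atLeast0LessThan add.commute)
    also have "\<dots> = (\<Sum>j<N. fps_nth (fps_nth p i) j * (fst z ^ i * snd z ^ j))"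
      by (rule sum.cong) auto
    also have "\<dots> = eval_fps (fps_nth p i) (snd z) * fst z ^ i"
      unfolding e sum_distrib_right by (simp add: mult_ac)
    finally show "eval_fps (fps_nth p i) (snd z) * fst z ^ i = (\<Sum>n = i * N..<i * N + N. ?t n)" ..
  qed simp
  also have "\<dots> = (\<Sum>n<M * N. ?t n)" by (rule sum.nat_group)
  finally show ?thesis .
qed

lemma germ_hol_mult: "germ_hol a \<Longrightarrow> germ_hol b \<Longrightarrow> germ_hol (\<lambda>z. a z * b z)"
proof -
  assume "germ_hol a" "germ_hol b"
  then obtain U V where U: "open U" "0 \<in> U" "holo2_on a U" and V: "open V" "0 \<in> V" "holo2_on b V"
    unfolding germ_hol_def by auto
  have "holo2_on (\<lambda>z. a z * b z) (U \<inter> V)"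
    unfolding holo2_on_def
  proof
    fix z assume "z \<in> U \<inter> V"
    then obtain D D' where D: "(a has_derivative D) (at z)" "\<forall>c w. D (cscale2 c w) = c * D w"
      and D': "(b has_derivative D') (at z)" "\<forall>c w. D' (cscale2 c w) = c * D' w"
      using U(3) V(3) unfolding holo2_on_def by blast
    show "\<exists>D. ((\<lambda>z. a z * b z) has_derivative D) (at z) \<and> (\<forall>c w. D (cscale2 c w) = c * D w)"
      by (rule exI[of _ "\<lambda>w. a z * D' w + D w * b z"], intro conjI has_derivative_mult[OF D(1) D'(1)])
         (use D(2) D'(2) in \<open>simp add: algebra_simps\<close>)
  qed
  then show ?thesis unfolding germ_hol_def using U V by (intro exI[of _ "U \<inter> V"]) auto
qed

lemma germ_hol_monomial: "germ_hol (\<lambda>z. fst z ^ i * snd z ^ j)"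
proof -
  have 1: "germ_hol fst" unfolding germ_hol_def holo2_on_def
    by (rule exI[of _ UNIV]) (auto simp: cscale2_def intro!: exI[of _ fst] derivative_eq_intros)
  have 2: "germ_hol snd" unfolding germ_hol_def holo2_on_def
    by (rule exI[of _ UNIV]) (auto simp: cscale2_def intro!: exI[of _ snd] derivative_eq_intros)
  have 3: "germ_hol (\<lambda>_. 1)" unfolding germ_hol_def holo2_on_def
    by (rule exI[of _ UNIV]) (auto intro!: exI[of _ "\<lambda>_. 0"])
  have "germ_hol (\<lambda>z. fst z ^ i)" by (induction i) (use 1 3 germ_hol_mult[OF 1] in auto)
  moreover have "germ_hol (\<lambda>z. snd z ^ j)" by (induction j) (use 2 3 germ_hol_mult[OF 2] in auto)
  ultimately show ?thesis by (rule germ_hol_mult)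
qed

lemma quot_dim_le_if_bounds:
  assumes F: "yreg d F" "d \<le> N" and Fe: "F = e * a" "G = k * b"
    and rep: "rep f a" "rep g b" and conv: "conv2 e" "conv2 k"
    and cop: "\<And>q. conv2 q \<Longrightarrow> cdvd q a \<Longrightarrow> cdvd q G \<Longrightarrow> fps_nth (fps_nth q 0) 0 \<noteq> 0"
    and M: "\<And>k. coeff (mult_cp d F G) k \<noteq> 0 \<Longrightarrow> subdegree (coeff (mult_cp d F G) k) \<le> M"
  shows "quot_dim_le f g (M * N)"
  unfolding quot_dim_le_def
proof (intro exI[of _ "\<lambda>n z. fst z ^ (n div N) * snd z ^ (n mod N)"] conjI allI impI)
  fix n show "germ_hol (\<lambda>z. fst z ^ (n div N) * snd z ^ (n mod N))" by (rule germ_hol_monomial)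
next
  fix h assume "germ_hol h"
  then obtain c where c: "rep h c" using germ_hol_rep by blast
  have ca: "conv2 a" "conv2 b" "conv2 c" using rep c unfolding rep_def by auto
  have cG: "conv2 G" unfolding Fe using ca conv by (intro conv2_mult)
  obtain p u v where p: "conv2 u" "conv2 v" "c = p + u * a + v * G"
    "\<And>i j. M \<le> i \<or> d \<le> j \<Longrightarrow> fps_nth (fps_nth p i) j = 0"
    using quotient_spanned[OF F(1) ca(1) conv(1) cG Fe(1) cop M ca(3)] by blast
  have "conv2 (c - u * a - v * G)" using p(1,2) ca cG by (intro conv2_diff conv2_mult)
  then have cp: "conv2 p" unfolding p(3) by simp
  \<comment> \<open>The combination found is in \<open>a\<close> and \<open>G\<close>; the factor
    \<open>k\<close> of \<open>G\<close> moves into the coefficient, because (f, G) is contained in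
    (f, g).\<close>
  define t where "t = (\<lambda>z. ev v z * ev k z)"
  have t: "rep t (v * k)" unfolding t_def using p(2) conv(2) by (intro rep_mult rep_ev)
  have "rep (\<lambda>z. ev p z + ev u z * f z + t z * g z) (p + u * a + v * k * b)"
    using p(1) cp by (intro rep_add rep_mult rep_ev rep t)
  moreover have "c = p + u * a + v * k * b" unfolding p(3) Fe by (simp add: mult.assoc)
  ultimately have "germ_eq h (\<lambda>z. ev p z + ev u z * f z + t z * g z)"
    using rep_germ_eq[OF c] by simp
  moreover have "ev p = (\<lambda>z. \<Sum>n<M * N. fps_nth (fps_nth p (n div N)) (n mod N) * (fst z ^ (n div N) * snd z ^ (n mod N)))"
    using p(4) F(2) by (intro ext ev_finite_support) auto
  ultimately have "germ_eq h (\<lambda>z. (\<Sum>n<M * N. fps_nth (fps_nth p (n div N)) (n mod N) * (fst z ^ (n div N) * snd z ^ (n mod N)))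
      + ev u z * f z + t z * g z)" by simp
  moreover have "germ_hol t" unfolding t_def using p(2) conv(2) by (intro germ_hol_mult germ_hol_ev)
  ultimately show "\<exists>c a b. germ_hol a \<and> germ_hol b \<and> germ_eq h (\<lambda>z. (\<Sum>i<M * N. c i * (fst z ^ (i div N) * snd z ^ (i mod N)))
      + a z * f z + b z * g z)"
    using germ_hol_ev[OF p(1)] by (intro exI[of _ "\<lambda>n. fps_nth (fps_nth p (n div N)) (n mod N)"] exI[of _ "ev u"] exI[of _ t]) simp
qed

text \<open>A common degree bound \<open>E\<close> lets one finite set of generators serve all data,
  and F is assumed nonzero on the line x = 0 so that Weierstrass division by it is
  available.\<close>

lemma regular_bound:
  "\<exists>B. \<forall>(V1 :: complex ^ 'n \<Rightarrow> complex ^ 'n) V2 F G p \<phi> U hf f hg g.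
     poly_vf E V1 \<longrightarrow> poly_vf E V2 \<longrightarrow> poly_fun E F \<longrightarrow> poly_fun E G \<longrightarrow> leaf_param V1 V2 p \<phi> U \<longrightarrow>
     \<not> (\<forall>\<^sub>F y in nhds 0. F (\<phi> (0, y)) = 0) \<longrightarrow>
     germ_hol hf \<longrightarrow> germ_hol f \<longrightarrow> germ_hol hg \<longrightarrow> germ_hol g \<longrightarrow>
     germ_eq (F \<circ> \<phi>) (\<lambda>z. hf z * f z) \<longrightarrow> germ_eq (G \<circ> \<phi>) (\<lambda>z. hg z * g z) \<longrightarrow>
     (\<forall>q. germ_irred q \<and> germ_dvd q f \<longrightarrow> \<not> germ_dvd q (G \<circ> \<phi>)) \<longrightarrow> quot_dim_le f g B"
proof -
  let ?S = "fun_alg (gens E) :: ('n param \<Rightarrow> complex) set"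
  have ex: "\<exists>T. (\<forall>i j. T i j \<in> ?S) \<and> (\<forall>c p t \<phi> U. leaf_param (vfield E c 0) (vfield E c 1) p \<phi> U \<longrightarrow>
    rep (\<lambda>z. pev E (c k undefined) (\<phi> z)) (Abs_fps (\<lambda>i. Abs_fps (\<lambda>j. T i j (c, p, t)))))" if "k < 4" for k
    using taylor_family[OF pev_fun_alg[OF that, of E undefined]] by simp
  have "(2::nat) < 4" by simp
  from ex[OF this] obtain TF where TF0: "(\<forall>i j. TF i j \<in> ?S) \<and> (\<forall>c p t \<phi> U. leaf_param (vfield E c 0) (vfield E c 1) p \<phi> U \<longrightarrow>
    rep (\<lambda>z. pev E (c 2 undefined) (\<phi> z)) (Abs_fps (\<lambda>i. Abs_fps (\<lambda>j. TF i j (c, p, t)))))" ..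
  have TF: "TF i j \<in> ?S" "leaf_param (vfield E c 0) (vfield E c 1) p \<phi> U \<Longrightarrow>
    rep (\<lambda>z. pev E (c 2 undefined) (\<phi> z)) (Abs_fps (\<lambda>i. Abs_fps (\<lambda>j. TF i j (c, p, t))))" for i j c p t \<phi> U
    using TF0 by simp_all blast
  have "(3::nat) < 4" by simp
  from ex[OF this] obtain TG where TG0: "(\<forall>i j. TG i j \<in> ?S) \<and> (\<forall>c p t \<phi> U. leaf_param (vfield E c 0) (vfield E c 1) p \<phi> U \<longrightarrow>
    rep (\<lambda>z. pev E (c 3 undefined) (\<phi> z)) (Abs_fps (\<lambda>i. Abs_fps (\<lambda>j. TG i j (c, p, t)))))" ..
  have TG: "TG i j \<in> ?S" "leaf_param (vfield E c 0) (vfield E c 1) p \<phi> U \<Longrightarrow>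
    rep (\<lambda>z. pev E (c 3 undefined) (\<phi> z)) (Abs_fps (\<lambda>i. Abs_fps (\<lambda>j. TG i j (c, p, t))))" for i j c p t \<phi> U
    using TG0 by simp_all blast
  define aF aG :: "'n param \<Rightarrow> complex fps fps"
    where "aF = (\<lambda>l. Abs_fps (\<lambda>i. Abs_fps (\<lambda>j. TF i j l)))"
      and "aG = (\<lambda>l. Abs_fps (\<lambda>i. Abs_fps (\<lambda>j. TG i j l)))"
  \<comment> \<open>The first use of Noetherianity: a uniform bound on the order of F(0, y).\<close>
  have "\<exists>N. \<forall>l\<in>UNIV. (\<exists>j. TF 0 j l \<noteq> 0) \<longrightarrow> (\<exists>j<N. TF 0 j l \<noteq> 0)"
    by (rule agree_alg_zeros_stable[OF finite_gens, of _ E]) (use TF(1) in \<open>auto simp: agree_alg_def\<close>)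
  then obtain N where N: "\<And>l j. TF 0 j l \<noteq> 0 \<Longrightarrow> \<exists>j<N. TF 0 j l \<noteq> 0" by blast
  \<comment> \<open>On \<open>V d\<close> the last coordinate is the inverse of the coefficient of
    y^d, which makes the characteristic polynomial depend polynomially on the parameters
    there.\<close>
  define V where "V = (\<lambda>d. {l. yreg d (aF l) \<and> inverse (fps_nth (fps_nth (aF l) 0) d) = snd (snd l)})"
  have ag: "agree_alg (V d) (gens E) v" if "v \<in> ?S" for v d using that unfolding agree_alg_def by auto
  have tS: "(\<lambda>(c, x, t). t) \<in> ?S" by (rule fun_alg.gen) (simp add: gens_def)
  have "\<exists>M. \<forall>l\<in>V d. (\<exists>i. fps_nth (coeff (mult_cp d (aF l) (aG l)) k) i \<noteq> 0)
      \<longrightarrow> (\<exists>i<M. fps_nth (coeff (mult_cp d (aF l) (aG l)) k) i \<noteq> 0)" for d k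
  proof (rule agree_alg_zeros_stable[OF finite_gens, of _ E], rule fam_ring_mult_cp[OF fam_ring_agree_alg])
    show "agree_alg (V d) (gens E) (\<lambda>l. inverse (fps_nth (fps_nth (aF l) 0) d))"
      unfolding agree_alg_def by (rule bexI[OF _ tS]) (auto simp: V_def)
  qed (use TF(1) TG(1) in \<open>auto simp: aF_def aG_def intro: ag\<close>)
  then have "\<forall>d. \<forall>k. \<exists>M. \<forall>l\<in>V d. coeff (mult_cp d (aF l) (aG l)) k \<noteq> 0 \<longrightarrow> subdegree (coeff (mult_cp d (aF l) (aG l)) k) \<le> M"
    by (meson fps_nonzero_nth less_imp_le order_trans subdegree_leI)
  then obtain m where m: "\<And>d k l. l \<in> V d \<Longrightarrow> coeff (mult_cp d (aF l) (aG l)) k \<noteq> 0 \<Longrightarrow> subdegree (coeff (mult_cp d (aF l) (aG l)) k) \<le> m d k"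
    by metis
  \<comment> \<open>Only finitely many pairs matter: \<open>d \<le> N\<close>, and
    \<open>k \<le> d\<close> since the polynomial has degree \<open>d\<close>. The sum is an upper
    bound for all these \<open>m d k\<close>.\<close>
  define M where "M = (\<Sum>d\<le>N. \<Sum>k\<le>d. m d k)"
  have mM: "subdegree (coeff (mult_cp d (aF l) (aG l)) k) \<le> M"
    if "d \<le> N" "l \<in> V d" "coeff (mult_cp d (aF l) (aG l)) k \<noteq> 0" for d k l
  proof -
    have "degree (mult_cp d (aF l) (aG l)) = d"
      unfolding mult_cp_def using degree_monic_char_poly[of "mult_mat d (aF l) (aG l)" d] by (simp add: mult_mat_def)
    then have "k \<le> d" using that(3) le_degree by metis
    then have "m d k \<le> (\<Sum>k\<le>d. m d k)" by (intro member_le_sum) auto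
    also have "\<dots> \<le> M" unfolding M_def using that(1) by (intro member_le_sum[of d _ "\<lambda>d. \<Sum>k\<le>d. m d k"]) auto
    finally show ?thesis using m[OF that(2,3)] by simp
  qed
  show ?thesis
  proof (intro exI[of _ "M * N"] allI impI)
    fix V1 V2 :: "complex ^ 'n \<Rightarrow> complex ^ 'n" and F G p \<phi> U hf f hg g
    assume poly: "poly_vf E V1" "poly_vf E V2" "poly_fun E F" "poly_fun E G" and leaf: "leaf_param V1 V2 p \<phi> U"
      and reg: "\<not> (\<forall>\<^sub>F y in nhds 0. F (\<phi> (0, y)) = 0)"
      and hol: "germ_hol hf" "germ_hol f" "germ_hol hg" "germ_hol g"
      and eq: "germ_eq (F \<circ> \<phi>) (\<lambda>z. hf z * f z)" "germ_eq (G \<circ> \<phi>) (\<lambda>z. hg z * g z)"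
      and irr: "\<forall>q. germ_irred q \<and> germ_dvd q f \<longrightarrow> \<not> germ_dvd q (G \<circ> \<phi>)"
    have "\<forall>i. \<exists>c. (\<lambda>x. vec_nth (V1 x) i) = pev E c" "\<forall>i. \<exists>c. (\<lambda>x. vec_nth (V2 x) i) = pev E c"
      using poly(1,2) unfolding poly_vf_def poly_fun_iff by auto
    then obtain c1 c2 where c12: "\<And>i. (\<lambda>x. vec_nth (V1 x) i) = pev E (c1 i)" "\<And>i. (\<lambda>x. vec_nth (V2 x) i) = pev E (c2 i)"
      by metis
    obtain cF cG where cFG: "F = pev E cF" "G = pev E cG" using poly(3,4) unfolding poly_fun_iff by auto
    define c where "c = (\<lambda>k::nat. if k = 0 then c1 else if k = 1 then c2 else if k = 2 then (\<lambda>_. cF) else (\<lambda>_. cG))"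
    have V12: "V1 = vfield E c 0" "V2 = vfield E c 1"
      using c12 unfolding vfield_def c_def by (auto simp: Finite_Cartesian_Product.vec_eq_iff fun_eq_iff)
    have FG: "F = pev E (c 2 undefined)" "G = pev E (c 3 undefined)" unfolding c_def cFG by auto
    have rF: "rep (F \<circ> \<phi>) (aF (c, p, t))" and rG: "rep (G \<circ> \<phi>) (aG (c, p, t))" for t
      using TF(2)[OF leaf[unfolded V12], of t] TG(2)[OF leaf[unfolded V12], of t]
      unfolding FG aF_def aG_def comp_def by auto
    \<comment> \<open>The order \<open>d\<close> has to be known before the last coordinate can be
      set to the right inverse, so it is read off with 0 in that place. By uniqueness of the Taylor
      series, \<open>Al\<close> shows that changing this coordinate does not change the
      series.\<close>
    define A where "A = aF (c, p, 0)"
    define d where "d = subdegree (fps_nth A 0)"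
    define l where "l = (c, p, inverse (fps_nth (fps_nth A 0) d))"
    have Al: "aF l = A" unfolding l_def A_def by (rule rep_unique[OF rF rF]) simp
    have A0: "fps_nth A 0 \<noteq> 0"
    proof
      assume "fps_nth A 0 = 0"
      then have "ev A (0, y) = 0" for y unfolding ev_def yslice_def by (simp add: eval_fps_at_0)
      moreover have "\<forall>\<^sub>F z in nhds 0. (F \<circ> \<phi>) z = ev A z"
        using rF[of 0] unfolding A_def rep_def germ_eq_def by simp
      moreover have "filterlim (\<lambda>y::complex. (0::complex, y)) (nhds 0) (nhds 0)"
        unfolding zero_prod_def by (intro tendsto_Pair tendsto_const tendsto_ident_at filterlim_ident)
      ultimately have "\<forall>\<^sub>F y in nhds 0. (F \<circ> \<phi>) (0, y) = 0"
        using eventually_compose_filterlim by fastforce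
      then show False using reg by simp
    qed
    have yr: "yreg d (aF l)" unfolding Al yreg_def d_def using A0 by simp
    have "fps_nth (fps_nth A 0) d \<noteq> 0" unfolding d_def using A0 by simp
    then have "TF 0 d l \<noteq> 0" unfolding Al[symmetric] aF_def by simp
    then obtain j where "j < N" "TF 0 j l \<noteq> 0" using N by blast
    then have "d \<le> j" unfolding d_def Al[symmetric] aF_def by (intro subdegree_leI) simp
    then have dN: "d \<le> N" using \<open>j < N\<close> by simp
    have lV: "l \<in> V d" unfolding V_def using yr Al by (simp add: l_def)
    obtain e a k b where r: "rep hf e" "rep f a" "rep hg k" "rep g b" using germ_hol_rep hol by metis
    have Fe: "aF l = e * a" using rep_unique[OF rF[folded l_def] rep_mult[OF r(1,2)] eq(1)] unfolding l_def by blast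
    have Ge: "aG l = k * b" using rep_unique[OF rG rep_mult[OF r(3,4)] eq(2)] unfolding l_def by blast
    have rGl: "rep (G \<circ> \<phi>) (aG l)" unfolding l_def by (rule rG)
    have "fps_nth (aF l) 0 = fps_nth e 0 * fps_nth a 0" unfolding Fe by simp
    then have ya: "yreg (subdegree (fps_nth a 0)) a" using yr unfolding yreg_def by auto
    show "quot_dim_le f g (M * N)"
    proof (rule quot_dim_le_if_bounds[OF yr dN Fe Ge r(2,4)])
      show "conv2 e" "conv2 k" using r unfolding rep_def by auto
      show "fps_nth (fps_nth q 0) 0 \<noteq> 0" if "conv2 q" "cdvd q a" "cdvd q (aG l)" for q
        by (rule no_common_factor_if_no_irreducible[OF ya r(2) rGl _ that]) (use irr in blast)
      show "subdegree (coeff (mult_cp d (aF l) (aG l)) k) \<le> M" if "coeff (mult_cp d (aF l) (aG l)) k \<noteq> 0" for k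
        by (rule mM[OF dN lV that])
    qed
  qed
qed

section \<open>Reduction to the regular case\<close>

text \<open>Maps the line x = 0 onto the line spanned by \<open>(c, 1)\<close>. Every line through
  the origin except y = 0 arises in this way, which is enough to find one on which a given nonzero
  germ does not vanish identically.\<close>

definition shear :: "complex \<Rightarrow> complex \<times> complex \<Rightarrow> complex \<times> complex" where
  "shear c z = (fst z + c * snd z, snd z)"

lemma shear_inverse: "shear c \<circ> shear (- c) = id"
  unfolding shear_def by auto

lemma comp_shear_cancel: "(a \<circ> shear c) \<circ> shear (- c) = a" "(a \<circ> shear (- c)) \<circ> shear c = a"
  using shear_inverse[of c] shear_inverse[of "- c"] by (simp_all add: comp_assoc)

lemma shear_0: "shear c 0 = 0"
  unfolding shear_def by (simp add: zero_prod_def)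

lemma has_derivative_shear: "(shear c has_derivative shear c) (at z)"
  unfolding shear_def[abs_def] by (auto intro!: derivative_eq_intros)

lemma continuous_shear: "continuous_on UNIV (shear c)"
  using has_derivative_shear by (meson continuous_at_imp_continuous_on has_derivative_continuous)

lemma shear_cscale2: "shear c (cscale2 a w) = cscale2 a (shear c w)"
  unfolding shear_def cscale2_def by (simp add: algebra_simps)

lemma open_vimage_shear: "open U \<Longrightarrow> open (shear c -` U)"
  using continuous_shear by (simp add: continuous_on_open_vimage)

lemma holo2_on_shear:
  assumes "holo2_on h U" shows "holo2_on (h \<circ> shear c) (shear c -` U)"
  unfolding holo2_on_def
proof
  fix z assume "z \<in> shear c -` U"
  then obtain D where D: "(h has_derivative D) (at (shear c z))" "\<And>c w. D (cscale2 c w) = c * D w"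
    using assms unfolding holo2_on_def by blast
  have "((\<lambda>z. h (shear c z)) has_derivative (\<lambda>w. D (shear c w))) (at z)"
    by (rule has_derivative_compose[OF has_derivative_shear D(1)])
  then show "\<exists>D. (h \<circ> shear c has_derivative D) (at z) \<and> (\<forall>c w. D (cscale2 c w) = c * D w)"
    unfolding comp_def by (intro exI[of _ "\<lambda>w. D (shear c w)"]) (simp add: shear_cscale2 D(2))
qed

section \<open>Invariance of the germ notions under shears\<close>

lemma germ_hol_shear: "germ_hol h \<Longrightarrow> germ_hol (h \<circ> shear c)"
  unfolding germ_hol_def using holo2_on_shear open_vimage_shear shear_0 by (metis vimageI2)

lemma germ_eq_shear: "germ_eq a b \<Longrightarrow> germ_eq (a \<circ> shear c) (b \<circ> shear c)"
proof -
  assume "germ_eq a b"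
  moreover have "filterlim (shear c) (nhds 0) (nhds 0)"
    unfolding filterlim_iff eventually_nhds
  proof safe
    fix P and S :: "(complex \<times> complex) set" assume "open S" "0 \<in> S" "\<forall>x\<in>S. P x"
    then show "\<exists>S. open S \<and> 0 \<in> S \<and> (\<forall>x\<in>S. P (shear c x))"
      using open_vimage_shear[of S c] by (intro exI[of _ "shear c -` S"]) (simp add: shear_0)
  qed
  ultimately show ?thesis unfolding germ_eq_def comp_def by (rule eventually_compose_filterlim)
qed

lemma germ_eq_shear_iff: "germ_eq (a \<circ> shear c) b \<longleftrightarrow> germ_eq a (b \<circ> shear (- c))"
  using germ_eq_shear[of "a \<circ> shear c" b "- c"] germ_eq_shear[of a "b \<circ> shear (- c)" c]
  by (auto simp: comp_shear_cancel)

lemma germ_unit_shear: "germ_unit a \<Longrightarrow> germ_unit (a \<circ> shear c)"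
  unfolding germ_unit_def using germ_hol_shear by (simp add: shear_0)

lemma comp_mult: "(\<lambda>z. a z * b z) \<circ> s = (\<lambda>z. (a \<circ> s) z * (b \<circ> s) z)" for a b :: "'a \<Rightarrow> complex"
  by auto

lemma germ_dvd_shear: "germ_dvd a b \<Longrightarrow> germ_dvd (a \<circ> shear c) (b \<circ> shear c)"
  unfolding germ_dvd_def using germ_hol_shear germ_eq_shear[of b _ c] by (fastforce simp: comp_mult)

lemma germ_irred_shear:
  assumes "germ_irred q" shows "germ_irred (q \<circ> shear c)"
proof -
  have "germ_unit a \<or> germ_unit b" if ab: "germ_hol a" "germ_hol b" "germ_eq (q \<circ> shear c) (\<lambda>z. a z * b z)" for a b
  proof -
    have "germ_eq q (\<lambda>z. (a \<circ> shear (- c)) z * (b \<circ> shear (- c)) z)"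
      using ab(3) unfolding germ_eq_shear_iff comp_mult .
    then have "germ_unit (a \<circ> shear (- c)) \<or> germ_unit (b \<circ> shear (- c))"
      using assms germ_hol_shear[OF ab(1)] germ_hol_shear[OF ab(2)] unfolding germ_irred_def by blast
    then show ?thesis using germ_unit_shear[of _ c] by (metis comp_shear_cancel(2))
  qed
  moreover have "\<not> germ_eq (q \<circ> shear c) (\<lambda>_. 0)"
    using assms unfolding germ_eq_shear_iff germ_irred_def by (simp add: comp_def)
  moreover have "\<not> germ_unit (q \<circ> shear c)"
    using assms germ_unit_shear[of "q \<circ> shear c" "- c"] unfolding germ_irred_def by (auto simp: comp_shear_cancel)
  ultimately show ?thesis using assms germ_hol_shear unfolding germ_irred_def by blast
qed

text \<open>Precomposition with a shear is an automorphism of the ring of germs; the inverse shear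
  carries the spanning set back.\<close>

lemma quot_dim_le_shear:
  assumes "quot_dim_le (f \<circ> shear c) (g \<circ> shear c) k" shows "quot_dim_le f g k"
proof -
  obtain e where e: "\<forall>i<k. germ_hol (e i)" "\<And>h. germ_hol h \<Longrightarrow> \<exists>x a b. germ_hol a \<and> germ_hol b \<and>
        germ_eq h (\<lambda>z. (\<Sum>i<k. x i * e i z) + a z * (f \<circ> shear c) z + b z * (g \<circ> shear c) z)"
    using assms unfolding quot_dim_le_def by blast
  show ?thesis
    unfolding quot_dim_le_def
  proof (intro exI[of _ "\<lambda>i. e i \<circ> shear (- c)"] conjI allI impI)
    fix h assume "germ_hol h"
    then obtain x a b where x: "germ_hol a" "germ_hol b"
      "germ_eq (h \<circ> shear c) (\<lambda>z. (\<Sum>i<k. x i * e i z) + a z * (f \<circ> shear c) z + b z * (g \<circ> shear c) z)"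
      using e(2)[OF germ_hol_shear] by blast
    have eq: "(\<lambda>z. (\<Sum>i<k. x i * e i z) + a z * (f \<circ> shear c) z + b z * (g \<circ> shear c) z) \<circ> shear (- c)
      = (\<lambda>z. (\<Sum>i<k. x i * (e i \<circ> shear (- c)) z) + (a \<circ> shear (- c)) z * f z + (b \<circ> shear (- c)) z * g z)"
      by (auto simp: fun_eq_iff shear_def)
    have "germ_eq h (\<lambda>z. (\<Sum>i<k. x i * (e i \<circ> shear (- c)) z) + (a \<circ> shear (- c)) z * f z + (b \<circ> shear (- c)) z * g z)"
      using x(3) unfolding germ_eq_shear_iff eq .
    then show "\<exists>x a b. germ_hol a \<and> germ_hol b \<and>
        germ_eq h (\<lambda>z. (\<Sum>i<k. x i * (e i \<circ> shear (- c)) z) + a z * f z + b z * g z)"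
      by (intro exI[of _ x] exI[of _ "a \<circ> shear (- c)"] exI[of _ "b \<circ> shear (- c)"] conjI germ_hol_shear x(1,2))
  qed (use e germ_hol_shear in blast)
qed

text \<open>In the sheared times the second field becomes V2 + c V1, whose degree is at most the
  larger of the two. The size of \<open>c\<close> is irrelevant, since bounds are uniform in the
  coefficients of the fields.\<close>

lemma leaf_param_shear:
  assumes "leaf_param V1 V2 p \<phi> U"
  shows "leaf_param V1 (\<lambda>x. V2 x + c *s V1 x) p (\<phi> \<circ> shear c) (shear c -` U)"
  unfolding leaf_param_def
proof (intro conjI ballI)
  show "open (shear c -` U)" "0 \<in> shear c -` U" "(\<phi> \<circ> shear c) 0 = p"
    using assms open_vimage_shear shear_0 unfolding leaf_param_def by auto
  fix z assume "z \<in> shear c -` U"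
  then obtain D where D: "(\<phi> has_derivative D) (at (shear c z))" "\<And>c w. D (cscale2 c w) = c *s D w"
      "D (1, 0) = V1 (\<phi> (shear c z))" "D (0, 1) = V2 (\<phi> (shear c z))"
    using assms unfolding leaf_param_def by blast
  interpret D: bounded_linear D using D(1) by (rule has_derivative_bounded_linear)
  have "shear c (0, 1) = (0, 1) + cscale2 c (1, 0)" "shear c (1, 0) = (1, 0)"
    unfolding shear_def cscale2_def by auto
  then have "D (shear c (0, 1)) = V2 (\<phi> (shear c z)) + c *s V1 (\<phi> (shear c z))"
    "D (shear c (1, 0)) = V1 (\<phi> (shear c z))"
    using D by (auto simp: D.add)
  moreover have "((\<lambda>z. \<phi> (shear c z)) has_derivative (\<lambda>w. D (shear c w))) (at z)"
    by (rule has_derivative_compose[OF has_derivative_shear D(1)])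
  ultimately show "\<exists>D. ((\<phi> \<circ> shear c) has_derivative D) (at z) \<and> (\<forall>c w. D (cscale2 c w) = c *s D w) \<and>
        D (1, 0) = V1 ((\<phi> \<circ> shear c) z) \<and> D (0, 1) = V2 ((\<phi> \<circ> shear c) z) + c *s V1 ((\<phi> \<circ> shear c) z)"
    unfolding comp_def by (intro exI[of _ "\<lambda>w. D (shear c w)"]) (auto simp: shear_cscale2 D(2))
qed

lemma poly_fun_add_scaled:
  fixes P Q :: "complex ^ 'n \<Rightarrow> complex"
  assumes "poly_fun d P" "poly_fun d Q" shows "poly_fun d (\<lambda>x. P x + c * Q x)"
proof -
  obtain a b where "P = pev d a" "Q = pev d b" using assms unfolding poly_fun_iff by auto
  then have "(\<lambda>x. P x + c * Q x) = pev d (\<lambda>\<alpha>. a \<alpha> + c * b \<alpha>)"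
    unfolding pev_def[abs_def] by (simp add: sum_distrib_left sum.distrib algebra_simps)
  then show ?thesis unfolding poly_fun_iff by blast
qed

text \<open>Take a point off the axis y = 0 where the germ does not vanish. On the line through it
  and the origin, the one-variable identity theorem forbids vanishing near 0.\<close>

lemma germ_regular_direction:
  assumes h: "germ_hol h" "\<not> germ_eq h (\<lambda>_. 0)"
  obtains c where "\<not> (\<forall>\<^sub>F y in nhds 0. (h \<circ> shear c) (0, y) = 0)"
proof -
  obtain U where U: "open U" "0 \<in> U" "holo2_on h U" using h(1) unfolding germ_hol_def by auto
  have "\<forall>\<^sub>F z in nhds 0. z \<in> U" by (rule eventually_nhds_in_open[OF U(1,2)])
  then obtain r where r: "r > 0" "bidisc r \<subseteq> U" unfolding eventually_nhds_bidisc by auto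
  obtain z where z: "z \<in> bidisc r" "h z \<noteq> 0"
    using h(2) r(1) unfolding germ_eq_def eventually_nhds_bidisc by blast
  obtain s t where st: "norm s < r" "norm t < r" "t \<noteq> 0" "h (s, t) \<noteq> 0"
  proof (cases "snd z = 0")
    case False
    then show thesis using that[of "fst z" "snd z"] z unfolding bidisc_def by auto
  next
    \<comment> \<open>A point on the axis y = 0 determines no shear; continuity in y moves it off
      the axis.\<close>
    case True
    have zs: "z = (fst z, 0)" using True by (simp add: prod_eq_iff)
    have "isCont (\<lambda>y. h (fst z, y)) 0"
      using holo2_slices(2)[OF U(3,1), of "fst z" 0] r(2) z(1) zs
      by (metis field_differentiable_imp_continuous_at subsetD)
    then have "\<forall>\<^sub>F y in at 0. h (fst z, y) \<noteq> 0"
      using z(2) zs by (metis continuous_at tendsto_imp_eventually_ne)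
    moreover have "\<forall>\<^sub>F y in at (0::complex). norm y < r \<and> y \<noteq> 0"
      unfolding eventually_at using r(1) by (intro exI[of _ r]) auto
    ultimately have "\<forall>\<^sub>F y in at (0::complex). h (fst z, y) \<noteq> 0 \<and> norm y < r \<and> y \<noteq> 0"
      by (rule eventually_conj)
    then obtain y where "h (fst z, y) \<noteq> 0" "norm y < r" "y \<noteq> 0"
      using eventually_happens at_neq_bot[of "0::complex"] by blast
    then show thesis using that[of "fst z" y] z(1) unfolding bidisc_def by auto
  qed
  define c where "c = s / t"
  \<comment> \<open>For \<open>norm y < \<rho>\<close> both coordinates of (c y, y) stay below
    \<open>r\<close> in norm. The disc contains \<open>t\<close>, because \<open>s = c * t\<close>
    and \<open>t\<close> are both below \<open>r\<close> in norm.\<close>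
  define \<rho> where "\<rho> = r / max 1 (norm c)"
  have \<rho>: "\<rho> > 0" using r(1) unfolding \<rho>_def by (intro divide_pos_pos) auto
  have sub: "(0, y) \<in> shear c -` U" if "norm y < \<rho>" for y
  proof -
    have m: "norm y * max 1 (norm c) < r"
      using that unfolding \<rho>_def by (subst (asm) pos_less_divide_eq) auto
    have "norm y * 1 \<le> norm y * max 1 (norm c)" "norm y * norm c \<le> norm y * max 1 (norm c)"
      by (intro mult_left_mono; simp)+
    then have "norm y < r" "norm (c * y) < r" using m by (auto simp: norm_mult mult.commute)
    then have "shear c (0, y) \<in> bidisc r" unfolding shear_def bidisc_def by simp
    then show ?thesis using r(2) by auto
  qed
  have "norm t * max 1 (norm c) < r"
    using st(1-3) unfolding c_def by (auto simp: norm_divide max_def)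
  then have t\<rho>: "norm t < \<rho>" unfolding \<rho>_def by (subst pos_less_divide_eq) auto
  let ?g = "\<lambda>y. (h \<circ> shear c) (0, y)"
  have g: "?g holomorphic_on ball 0 \<rho>"
    unfolding holomorphic_on_def
    using holo2_slices(2)[OF holo2_on_shear[OF U(3)] open_vimage_shear[OF U(1)] sub]
    by (auto intro: field_differentiable_at_within)
  have "\<not> (\<forall>\<^sub>F y in nhds 0. ?g y = 0)"
  proof
    assume "\<forall>\<^sub>F y in nhds 0. ?g y = 0"
    then obtain W where W: "open W" "0 \<in> W" "\<And>y. y \<in> W \<Longrightarrow> ?g y = 0" unfolding eventually_nhds by blast
    have "?g t = 0"
    proof (rule analytic_continuation_open[of "W \<inter> ball 0 \<rho>" "ball 0 \<rho>" ?g "\<lambda>_. 0"])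
      show "W \<inter> ball 0 \<rho> \<noteq> {}" using W \<rho> by auto
    qed (use W g t\<rho> in auto)
    moreover have "?g t = h (s, t)" unfolding c_def shear_def using st(3) by simp
    ultimately show False using st(4) by simp
  qed
  then show thesis by (rule that)
qed

theorem theorem4p1:
  "\<exists>B :: nat \<Rightarrow> nat \<Rightarrow> nat \<Rightarrow> nat \<Rightarrow> nat.
   \<forall>(V1 :: complex ^ 'n \<Rightarrow> complex ^ 'n) V2 F G p \<phi> U hf f hg g d1 d2 dF dG.
     poly_vf d1 V1 \<and> poly_vf d2 V2 \<and> poly_fun dF F \<and> poly_fun dG G \<and>
     commuting_vf V1 V2 \<and> lin_indep2 (V1 p) (V2 p) \<and>
     leaf_param V1 V2 p \<phi> U \<and>
     \<not> germ_eq (F \<circ> \<phi>) (\<lambda>_. 0) \<and> \<not> germ_eq (G \<circ> \<phi>) (\<lambda>_. 0) \<and>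
     germ_hol hf \<and> germ_hol f \<and> germ_hol hg \<and> germ_hol g \<and>
     germ_eq (F \<circ> \<phi>) (\<lambda>z. hf z * f z) \<and> germ_eq (G \<circ> \<phi>) (\<lambda>z. hg z * g z) \<and>
     (\<forall>q. germ_irred q \<and> germ_dvd q hf \<longrightarrow> germ_dvd q (G \<circ> \<phi>)) \<and>
     (\<forall>q. germ_irred q \<and> germ_dvd q hg \<longrightarrow> germ_dvd q (F \<circ> \<phi>)) \<and>
     (\<forall>q. germ_irred q \<and> germ_dvd q f \<longrightarrow> \<not> germ_dvd q (G \<circ> \<phi>)) \<and>
     (\<forall>q. germ_irred q \<and> germ_dvd q g \<longrightarrow> \<not> germ_dvd q (F \<circ> \<phi>))
     \<longrightarrow> quot_dim_le f g (B d1 d2 dF dG)"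
proof -
  define Q where "Q = (\<lambda>E B. \<forall>(V1 :: complex ^ 'n \<Rightarrow> complex ^ 'n) V2 F G p \<phi> U hf f hg g.
     poly_vf E V1 \<longrightarrow> poly_vf E V2 \<longrightarrow> poly_fun E F \<longrightarrow> poly_fun E G \<longrightarrow> leaf_param V1 V2 p \<phi> U \<longrightarrow>
     \<not> (\<forall>\<^sub>F y in nhds 0. F (\<phi> (0, y)) = 0) \<longrightarrow>
     germ_hol hf \<longrightarrow> germ_hol f \<longrightarrow> germ_hol hg \<longrightarrow> germ_hol g \<longrightarrow>
     germ_eq (F \<circ> \<phi>) (\<lambda>z. hf z * f z) \<longrightarrow> germ_eq (G \<circ> \<phi>) (\<lambda>z. hg z * g z) \<longrightarrow>
     (\<forall>q. germ_irred q \<and> germ_dvd q f \<longrightarrow> \<not> germ_dvd q (G \<circ> \<phi>)) \<longrightarrow> quot_dim_le f g B)"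
  have "\<forall>E. \<exists>B. Q E B" unfolding Q_def by (intro allI) (rule regular_bound)
  from choice[OF this] obtain B where "\<forall>E. Q E (B E)" ..
  then have "Q E (B E)" for E ..
  note B = this[unfolded Q_def, THEN spec, THEN spec, THEN spec, THEN spec, THEN spec, THEN spec, THEN spec,
      THEN spec, THEN spec, THEN spec, THEN spec, THEN mp, THEN mp, THEN mp, THEN mp, THEN mp, THEN mp,
      THEN mp, THEN mp, THEN mp, THEN mp, THEN mp, THEN mp, THEN mp]
  show ?thesis
  proof (intro exI[of _ "\<lambda>d1 d2 dF dG. B (max (max d1 d2) (max dF dG))"] allI impI, elim conjE)
    fix V1 V2 :: "complex ^ 'n \<Rightarrow> complex ^ 'n" and F G p \<phi> U hf f hg g d1 d2 dF dG
    assume poly: "poly_vf d1 V1" "poly_vf d2 V2" "poly_fun dF F" "poly_fun dG G"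
      and leaf: "leaf_param V1 V2 p \<phi> U" and nz: "\<not> germ_eq (F \<circ> \<phi>) (\<lambda>_. 0)"
      and hol: "germ_hol hf" "germ_hol f" "germ_hol hg" "germ_hol g"
      and eq: "germ_eq (F \<circ> \<phi>) (\<lambda>z. hf z * f z)" "germ_eq (G \<circ> \<phi>) (\<lambda>z. hg z * g z)"
      and irr: "\<forall>q. germ_irred q \<and> germ_dvd q f \<longrightarrow> \<not> germ_dvd q (G \<circ> \<phi>)"
    define E where "E = max (max d1 d2) (max dF dG)"
    \<comment> \<open>The product of \<open>hf\<close> and \<open>f\<close> stands in for F on the
      leaf: it is the same germ, and its holomorphy is at hand.\<close>
    have "germ_hol (\<lambda>z. hf z * f z)" using hol by (intro germ_hol_mult)
    moreover have "\<not> germ_eq (\<lambda>z. hf z * f z) (\<lambda>_. 0)" using nz eq(1) germ_eq_trans by blast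
    ultimately obtain c where c: "\<not> (\<forall>\<^sub>F y in nhds 0. ((\<lambda>z. hf z * f z) \<circ> shear c) (0, y) = 0)"
      using germ_regular_direction by blast
    have eqs: "germ_eq (F \<circ> \<phi> \<circ> shear c) ((\<lambda>z. hf z * f z) \<circ> shear c)"
      "germ_eq (G \<circ> \<phi> \<circ> shear c) ((\<lambda>z. hg z * g z) \<circ> shear c)"
      using germ_eq_shear[OF eq(1)] germ_eq_shear[OF eq(2)] by auto
    have reg: "\<not> (\<forall>\<^sub>F y in nhds 0. F ((\<phi> \<circ> shear c) (0, y)) = 0)"
    proof
      assume *: "\<forall>\<^sub>F y in nhds 0. F ((\<phi> \<circ> shear c) (0, y)) = 0"
      have "filterlim (\<lambda>y::complex. (0::complex, y)) (nhds 0) (nhds 0)"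
        unfolding zero_prod_def by (intro tendsto_Pair tendsto_const tendsto_ident_at filterlim_ident)
      from eventually_compose_filterlim[OF eqs(1)[unfolded germ_eq_def] this]
      have "\<forall>\<^sub>F y in nhds 0. (F \<circ> \<phi> \<circ> shear c) (0, y) = ((\<lambda>z. hf z * f z) \<circ> shear c) (0, y)" .
      with * have "\<forall>\<^sub>F y in nhds 0. ((\<lambda>z. hf z * f z) \<circ> shear c) (0, y) = 0"
        by eventually_elim simp
      then show False using c by simp
    qed
    have irr': "\<forall>q. germ_irred q \<and> germ_dvd q (f \<circ> shear c) \<longrightarrow> \<not> germ_dvd q (G \<circ> (\<phi> \<circ> shear c))"
    proof (intro allI impI notI, elim conjE)
      fix q assume q: "germ_irred q" "germ_dvd q (f \<circ> shear c)" "germ_dvd q (G \<circ> (\<phi> \<circ> shear c))"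
      have "germ_dvd (q \<circ> shear (- c)) f" "germ_dvd (q \<circ> shear (- c)) (G \<circ> \<phi>)"
        using germ_dvd_shear[OF q(2), of "- c"] germ_dvd_shear[OF q(3), of "- c"]
        by (simp_all add: comp_shear_cancel flip: comp_assoc)
      then show False using irr germ_irred_shear[OF q(1)] by blast
    qed
    have le: "d1 \<le> E" "d2 \<le> E" "dF \<le> E" "dG \<le> E" unfolding E_def by auto
    have comps: "poly_fun E (\<lambda>x. vec_nth (V1 x) i)" "poly_fun E (\<lambda>x. vec_nth (V2 x) i)" for i
      using poly(1,2) poly_fun_mono[OF _ le(1)] poly_fun_mono[OF _ le(2)] unfolding poly_vf_def by auto
    have vf: "poly_vf E V1" "poly_vf E (\<lambda>x. V2 x + c *s V1 x)"
      unfolding poly_vf_def using comps poly_fun_add_scaled[OF comps(2) comps(1)] by auto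
    have pf: "poly_fun E F" "poly_fun E G"
      using poly_fun_mono[OF poly(3) le(3)] poly_fun_mono[OF poly(4) le(4)] .
    have "quot_dim_le (f \<circ> shear c) (g \<circ> shear c) (B E)"
    proof (rule B[OF vf pf leaf_param_shear[OF leaf] reg _ _ _ _ _ _ irr'])
      show "germ_eq (F \<circ> (\<phi> \<circ> shear c)) (\<lambda>z. (hf \<circ> shear c) z * (f \<circ> shear c) z)"
        "germ_eq (G \<circ> (\<phi> \<circ> shear c)) (\<lambda>z. (hg \<circ> shear c) z * (g \<circ> shear c) z)"
        using eqs by (simp_all add: comp_mult comp_assoc)
    qed (intro germ_hol_shear hol)+
    then show "quot_dim_le f g (B (max (max d1 d2) (max dF dG)))"
      unfolding E_def[symmetric] by (rule quot_dim_le_shear)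
  qed
qed

end
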